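(* For $n\ge1$ let $H_n$ be a pair of Herglotz functions $m_\pm(\cdot;H_n)$, let $H$ be a pair of Herglotz functions $m_\pm(\cdot;H)$, and suppose that for every $n\ge1$ the transformation $H_n\mapsto H_{n+1}$ is of type $\mathcal S$, with associated matrix function $T_n(z)\in\mathcal S$. Suppose that $m_\pm(z;H_n)\to m_\pm(z;H)$ locally uniformly on $\mathbb C^+$. Then either: (1) $H$ is reflectionless on $\Sigma_{ac}(H_1)$, or (2) after suitably choosing the signs of the $T_j$ (that is, after possibly replacing some of the $T_j$ by $-T_j$), $T_n(z)\cdots T_1(z)\to T(z)$ locally uniformly on $\mathbb C$ for some $T\in\mathcal S$.
   Context: $\mathbb C^+=\{z\in\mathbb C:\operatorname{Im}z>0\}$. A Herglotz function is a holomorphic map $F:\mathbb C^+\to\mathbb C^+$; it has boundary values $F(x)=\lim_{y\to0+}F(x+iy)$ for almost every $x\in\mathbb R$. A pair $(m_+,m_-)$ of Herglotz functions, thought of as the half line $m$ functions of a whole line trace-normed canonical system with coefficient function $H$, is denoted by $H$, and one writes $m_\pm(z;H)$. $\Sigma_{ac}(H)=\{x\in\mathbb R:\operatorname{Im}m_+(x;H)>0\text{ and }\operatorname{Im}m_-(x;H)>0\}$, up to null sets. $H$ is reflectionless on a Borel set $A\subset\mathbb R$ if $m_+(x;H)=-\overline{m_-(x;H)}$ for almost every $x\in A$ (the condition is void if $A$ has measure zero). A matrix acts as a linear fractional transformation, $\begin{pmatrix}a&b\\c&d\end{pmatrix}w=\frac{aw+b}{cw+d}$; let $I=\begin{pmatrix}1&0\\0&-1\end{pmatrix}$.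 Write $T\in\mathcal S$ if $T(z)$ is an entire $SL(2,\mathbb C)$-valued function with $T(x)\in SL(2,\mathbb R)$ for $x\in\mathbb R$ and $T(z)w\in\mathbb C^+$ whenever $w,z\in\mathbb C^+$. A transformation $H_1\mapsto H_2$ of pairs of Herglotz functions is of type $\mathcal S$ if there is a $T\in\mathcal S$ (the associated matrix function) such that $m_-(z;H_2)=T(z)m_-(z;H_1)$ and $m_+(z;H_2)=IT(z)I\,m_+(z;H_1)$ for all $z\in\mathbb C^+$. The transformation determines $T$ up to a sign. *)

theory Defs
  imports "HOL-Complex_Analysis.Complex_Analysis"
begin

definition upper_half_plane :: "complex set" where
  "upper_half_plane = {z. Im z > 0}"

definition herglotz :: "(complex \<Rightarrow> complex) \<Rightarrow> bool" where
  "herglotz F \<longleftrightarrow>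
     F holomorphic_on upper_half_plane \<and> F ` upper_half_plane \<subseteq> upper_half_plane"

text \<open>
  Boundary values are treated as a relation, since they need not exist at every point of the
  real line. For a Herglotz function they exist off a Lebesgue null set, so the points without
  boundary values do not matter in the notions below, which are only meant up to null sets.
\<close>

definition has_boundary_value :: "(complex \<Rightarrow> complex) \<Rightarrow> real \<Rightarrow> complex \<Rightarrow> bool" where
  "has_boundary_value F x w \<longleftrightarrow> ((\<lambda>y. F (Complex x y)) \<longlongrightarrow> w) (at_right 0)"

text \<open>
  Pairs of half line m functions; only the values on the upper half plane are meaningful.
\<close>

record m_pair =
  m_plus :: "complex \<Rightarrow> complex"
  m_minus :: "complex \<Rightarrow> complex"

definition herglotz_pair :: "m_pair \<Rightarrow> bool" where
  "herglotz_pair H \<longleftrightarrow> herglotz (m_plus H) \<and> herglotz (m_minus H)"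

definition Sigma_ac :: "m_pair \<Rightarrow> real set" where
  "Sigma_ac H = {x. \<exists>p q. has_boundary_value (m_plus H) x p \<and> has_boundary_value (m_minus H) x q
                       \<and> Im p > 0 \<and> Im q > 0}"

definition reflectionless_on :: "m_pair \<Rightarrow> real set \<Rightarrow> bool" where
  "reflectionless_on H A \<longleftrightarrow>
     (AE x in lborel. x \<in> A \<longrightarrow>
        (\<exists>p q. has_boundary_value (m_plus H) x p \<and> has_boundary_value (m_minus H) x q
               \<and> p = - cnj q))"

text \<open>
  If the denominator vanishes, the value is 0 (in place of infinity). As 0 is not in the upper
  half plane, an assertion that the value equals, or is, a point of the upper half plane
  includes that the denominator does not vanish.
\<close>

definition moebius_act :: "complex^2^2 \<Rightarrow> complex \<Rightarrow> complex" where
  "moebius_act A w = (A $ 1 $ 1 * w + A $ 1 $ 2) / (A $ 2 $ 1 * w + A $ 2 $ 2)"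

definition I_mat :: "complex^2^2" where
  "I_mat = vector [vector [1, 0], vector [0, -1]]"

definition class_S :: "(complex \<Rightarrow> complex^2^2) set" where
  "class_S = {T. (\<forall>i j. (\<lambda>z. T z $ i $ j) holomorphic_on UNIV)
               \<and> (\<forall>z. det (T z) = 1)
               \<and> (\<forall>x::real. \<forall>i j. T (of_real x) $ i $ j \<in> \<real>)
               \<and> (\<forall>w\<in>upper_half_plane. \<forall>z\<in>upper_half_plane.
                     moebius_act (T z) w \<in> upper_half_plane)}"

definition type_S_via :: "(complex \<Rightarrow> complex^2^2) \<Rightarrow> m_pair \<Rightarrow> m_pair \<Rightarrow> bool" where
  "type_S_via T H1 H2 \<longleftrightarrow> T \<in> class_S \<and>
     (\<forall>z\<in>upper_half_plane.
        m_minus H2 z = moebius_act (T z) (m_minus H1 z) \<and>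
        m_plus H2 z = moebius_act (I_mat ** T z ** I_mat) (m_plus H1 z))"

definition loc_uniform_limit ::
  "complex set \<Rightarrow> (nat \<Rightarrow> complex \<Rightarrow> 'b::metric_space) \<Rightarrow> (complex \<Rightarrow> 'b) \<Rightarrow> bool" where
  "loc_uniform_limit S f l \<longleftrightarrow>
     (\<forall>z\<in>S. \<exists>U. open U \<and> z \<in> U \<and> uniform_limit (U \<inter> S) f l sequentially)"

text \<open>\<open>transfer_prod T n z\<close> is \<open>T n z ** \<dots> ** T 1 z\<close>; the value \<open>T 0\<close> is not used.\<close>

primrec transfer_prod ::
  "(nat \<Rightarrow> complex \<Rightarrow> complex^2^2) \<Rightarrow> nat \<Rightarrow> complex \<Rightarrow> complex^2^2" where
  "transfer_prod T 0 z = mat 1"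
| "transfer_prod T (Suc n) z = T (Suc n) z ** transfer_prod T n z"

end

theory Submission
  imports Defs
begin

text \<open>
  Let \<open>P n = T n ** \<dots> ** T 1\<close>. Conjugation by \<open>I_mat\<close> turns \<open>w\<close> into
  \<open>- w\<close>, so \<open>P n z\<close> maps the two points \<open>m_minus (H 1) z\<close> and
  \<open>- m_plus (H 1) z\<close>, one in each half plane, to the corresponding points of
  \<open>H (n + 1)\<close>. For \<open>z\<close> in the upper half plane \<open>P n z\<close> contracts the
  hyperbolic metric; for real \<open>z\<close> it is a hyperbolic isometry. The derivative of \<open>P n z\<close>
  in the hyperbolic metric at \<open>m_minus (H 1) z\<close> is
  \<open>Im (m_minus (H 1) z) / expansion n z\<close>. Since hyperbolic derivatives multiply and are at most 1,
  \<open>expansion n z\<close> is nondecreasing in \<open>n\<close>, and there are two cases.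

  If \<open>expansion\<close> stays bounded at one single point \<open>z\<close>, then the entries of
  \<open>P n z\<close> are bounded there. They are controlled by one entry of the Cayley conjugate of
  \<open>P n\<close> (\<open>corner\<close>), which has no zeros and modulus at least 1 in the upper half plane;
  so its logarithm obeys Harnack's inequality, which bounds \<open>P n\<close> off the real line by
  \<open>exp (M / \<bar>Im z\<bar>)\<close>, and a maximum principle bounds it across the line
  (\<open>class_S_locally_bounded\<close>). By Montel's theorem the \<open>P n\<close> have limit points in
  \<open>class_S\<close>. If there are two limit points \<open>Q\<close>, \<open>Q'\<close> with
  \<open>Q' \<noteq> \<plusminus> Q\<close>, both send \<open>m_minus (H 1)\<close> and
  \<open>- m_plus (H 1)\<close> to the same limits. Hence these two functions are the roots of a quadratic
  equation with entire coefficients that are real on the real line. At almost every point of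
  \<open>Sigma_ac (H 1)\<close> the boundary values are then complex conjugates of each other, and the real matrix
  \<open>Q x\<close> carries this relation over to \<open>H_lim\<close>
  (\<open>reflectionless_of_two_transfers\<close>). If all limit points agree up to sign, signs can be chosen so
  that the products converge.

  If \<open>expansion\<close> is unbounded at every point, then \<open>P n z\<close> collapses the upper half
  plane, in the sense that the Cayley transforms of \<open>P n z w1\<close> and \<open>P n z w2\<close> approach
  each other (\<open>contraction_to_zero\<close>). Bounded holomorphic functions that converge in the upper half
  plane have weakly convergent boundary values (\<open>weak_convergence\<close>), so the same is true weakly on
  the real line. There \<open>P n x\<close> is an isometry; therefore \<open>w1\<close> and \<open>w2\<close> can
  be replaced, with an error that is uniform in \<open>n\<close>, by the boundary values \<open>q\<close> of
  \<open>m_minus (H 1)\<close> and \<open>- cnj p\<close> of \<open>- cnj (m_plus (H 1))\<close> on the part of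
  \<open>Sigma_ac (H 1)\<close> where \<open>q\<close> is close to \<open>w1\<close> and \<open>- cnj p\<close> is
  close to \<open>w2\<close>. The images of \<open>q\<close> and \<open>- cnj p\<close> under \<open>P n x\<close>
  are the boundary values that belong to \<open>H (n + 1)\<close>. In the limit the boundary values of
  \<open>m_minus H_lim\<close> and \<open>- cnj (m_plus H_lim)\<close> agree almost everywhere on
  \<open>Sigma_ac (H 1)\<close>. This uses that boundary values exist almost everywhere
  (\<open>fatou_boundary_values\<close>, \<open>herglotz_boundary_values\<close>).
\<close>

(* Reserves $ for matrix entries; coefficients of power series do not occur. *)
no_notation fps_nth (infixl \<open>$\<close> 75)

section \<open>Moebius transformations that contract the upper half plane\<close>

lemma in_uhp [simp]: "z \<in> upper_half_plane \<longleftrightarrow> Im z > 0"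
  by (simp add: upper_half_plane_def)

lemma open_uhp: "open upper_half_plane"
  by (simp add: upper_half_plane_def open_halfspace_Im_gt)

lemma convex_uhp: "convex upper_half_plane"
  by (simp add: upper_half_plane_def convex_halfspace_Im_gt)

lemma herglotz_Im_pos: "herglotz F \<Longrightarrow> Im z > 0 \<Longrightarrow> Im (F z) > 0"
  unfolding herglotz_def by (metis image_subset_iff in_uhp)

lemma Im_le_norm: "Im z \<le> norm z"
  using abs_Im_le_cmod[of z] by linarith

lemma norm_diff_less_reflected:
  assumes "Im z > 0" "Im w > 0"
  shows "norm (z - w) < norm (z - cnj w)"
proof -
  have "(norm (z - cnj w))\<^sup>2 - (norm (z - w))\<^sup>2 = 4 * Im z * Im w"
    unfolding cmod_power2 by (simp add: power2_eq_square algebra_simps)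
  then have "(norm (z - w))\<^sup>2 < (norm (z - cnj w))\<^sup>2"
    using assms by (smt (verit) mult_pos_pos)
  then show ?thesis
    by (rule power2_less_imp_less) simp
qed

text \<open>
  The Schwarz-Pick lemma, multiplied out: Cayley maps centred at \<open>w\<close> and at \<open>F w\<close> reduce
  it to Schwarz's lemma in the unit disk.
\<close>

lemma schwarz_pick_uhp:
  assumes F: "herglotz F" and z: "Im z > 0" and w: "Im w > 0"
  shows "norm (F z - F w) * norm (z - cnj w) \<le> norm (z - w) * norm (F z - cnj (F w))"
proof -
  define \<psi> where "\<psi> = (\<lambda>\<zeta>. (w - cnj w * \<zeta>) / (1 - \<zeta>))"
  define g where "g = (\<lambda>\<zeta>. (F (\<psi> \<zeta>) - F w) / (F (\<psi> \<zeta>) - cnj (F w)))"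
  define \<xi> where "\<xi> = (z - w) / (z - cnj w)"
  have ne1: "1 - \<zeta> \<noteq> 0" if "norm \<zeta> < 1" for \<zeta> :: complex
    using that by auto
  have \<psi>: "Im (\<psi> \<zeta>) > 0" if "norm \<zeta> < 1" for \<zeta>
  proof -
    have "\<psi> \<zeta> = ((w - cnj w * \<zeta>) * cnj (1 - \<zeta>)) / (of_real ((norm (1 - \<zeta>))\<^sup>2))"
      unfolding \<psi>_def complex_div_cnj[of _ "1 - \<zeta>"] by simp
    then have eq: "Im (\<psi> \<zeta>) = Im ((w - cnj w * \<zeta>) * cnj (1 - \<zeta>)) / (norm (1 - \<zeta>))\<^sup>2"
      by (metis Im_divide_of_real)
    have "Im ((w - cnj w * \<zeta>) * cnj (1 - \<zeta>)) = Im w * (1 - (norm \<zeta>)\<^sup>2)"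
      unfolding cmod_power2 by (simp add: power2_eq_square algebra_simps)
    moreover have "(norm \<zeta>)\<^sup>2 < 1" using that by (simp add: power_less_one_iff abs_square_less_1)
    ultimately show ?thesis
      unfolding eq using w ne1[OF that] by (intro divide_pos_pos) auto
  qed
  have Fne: "F u - cnj (F w) \<noteq> 0" if "Im u > 0" for u
  proof
    assume "F u - cnj (F w) = 0"
    then have "Im (F u) = - Im (F w)" by (metis complex_cnj_cnj cnj.sel(2) eq_iff_diff_eq_0)
    then show False using herglotz_Im_pos[OF F that] herglotz_Im_pos[OF F w] by linarith
  qed
  have zne: "z - cnj w \<noteq> 0"
    using z w by (auto simp: complex_eq_iff)
  have "norm (g \<xi>) \<le> norm \<xi>"
  proof (rule Schwarz_Lemma)
    have "(F \<circ> \<psi>) holomorphic_on ball 0 1"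
    proof (rule holomorphic_on_compose_gen)
      show "\<psi> holomorphic_on ball 0 1"
        unfolding \<psi>_def using ne1 by (intro holomorphic_intros) auto
      show "F holomorphic_on upper_half_plane" using F by (simp add: herglotz_def)
      show "\<psi> ` ball 0 1 \<subseteq> upper_half_plane" using \<psi> by auto
    qed
    then show "g holomorphic_on ball 0 1"
      unfolding g_def o_def using Fne \<psi> by (intro holomorphic_intros) auto
    show "norm (g \<zeta>) < 1" if "norm \<zeta> < 1" for \<zeta>
      unfolding g_def norm_divide
      using norm_diff_less_reflected[of "F (\<psi> \<zeta>)" "F w"] \<psi>[OF that] w F herglotz_Im_pos
      by (metis Fne divide_less_eq_1 zero_less_norm_iff)
    show "g 0 = 0" by (simp add: g_def \<psi>_def)
    show "norm \<xi> < 1"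
      unfolding \<xi>_def norm_divide using norm_diff_less_reflected[OF z w] zne by auto
  qed
  moreover have "\<psi> \<xi> = z"
  proof -
    have "w - cnj w \<noteq> 0" using w by (auto simp: complex_eq_iff)
    moreover have "1 - \<xi> = (w - cnj w) / (z - cnj w)"
      unfolding \<xi>_def using zne by (simp add: field_simps)
    moreover have "w - cnj w * \<xi> = z * (w - cnj w) / (z - cnj w)"
      unfolding \<xi>_def using zne by (simp add: field_simps)
    ultimately show ?thesis unfolding \<psi>_def using zne by simp
  qed
  ultimately have "norm (F z - F w) / norm (F z - cnj (F w)) \<le> norm (z - w) / norm (z - cnj w)"
    by (simp add: g_def \<xi>_def norm_divide)
  moreover have "norm (F z - cnj (F w)) > 0" "norm (z - cnj w) > 0"
    using Fne[OF z] zne by auto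
  ultimately show ?thesis by (simp add: field_simps)
qed

text \<open>
  The inequality is \<open>Im w \<le> Im (A w) * \<bar>c w + d\<bar>\<^sup>2\<close> without a division: the
  Schwarz-Pick inequality for the derivative of the transformation at \<open>w\<close>. In this form it passes to
  limits of matrices.
\<close>

definition uhp_contractive :: "complex^2^2 \<Rightarrow> bool" where
  "uhp_contractive A \<longleftrightarrow> det A = 1 \<and>
     (\<forall>w. Im w > 0 \<longrightarrow> Im w \<le> Im ((A$1$1 * w + A$1$2) * cnj (A$2$1 * w + A$2$2)))"

lemma Im_divide_eq: "Im (p / q) = Im (p * cnj q) / (norm q)\<^sup>2"
proof -
  have "p / q = (p * cnj q) / of_real ((norm q)\<^sup>2)"
    using complex_div_cnj[of p q] by simp
  then show ?thesis by (metis Im_divide_of_real)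
qed

lemma uhp_contractiveD:
  assumes "uhp_contractive A" "Im w > 0"
  shows "A$2$1 * w + A$2$2 \<noteq> 0" "A$1$1 * w + A$1$2 \<noteq> 0" "Im (moebius_act A w) > 0"
    "Im w \<le> Im (moebius_act A w) * (norm (A$2$1 * w + A$2$2))\<^sup>2"
proof -
  have *: "Im w \<le> Im ((A$1$1 * w + A$1$2) * cnj (A$2$1 * w + A$2$2))"
    using assms by (auto simp: uhp_contractive_def)
  show ne: "A$2$1 * w + A$2$2 \<noteq> 0" "A$1$1 * w + A$1$2 \<noteq> 0"
    using * assms(2) by (metis complex_cnj_zero mult_zero_right zero_complex.sel(2) not_le, metis mult_zero_left zero_complex.sel(2) not_le)
  have "Im (moebius_act A w) * (norm (A$2$1 * w + A$2$2))\<^sup>2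
      = Im ((A$1$1 * w + A$1$2) * cnj (A$2$1 * w + A$2$2))"
    unfolding moebius_act_def Im_divide_eq using ne by simp
  then show 4: "Im w \<le> Im (moebius_act A w) * (norm (A$2$1 * w + A$2$2))\<^sup>2" using * by simp
  then have "0 < Im (moebius_act A w) * (norm (A$2$1 * w + A$2$2))\<^sup>2"
    using assms(2) by linarith
  then show "Im (moebius_act A w) > 0"
    by (simp add: zero_less_mult_iff)
qed

lemma moebius_diff:
  assumes "det A = 1" "A$2$1 * z + A$2$2 \<noteq> 0" "A$2$1 * w + A$2$2 \<noteq> 0"
  shows "moebius_act A z - moebius_act A w = (z - w) / ((A$2$1 * z + A$2$2) * (A$2$1 * w + A$2$2))"
proof -
  have "A$1$1 * A$2$2 - A$1$2 * A$2$1 = 1" using assms(1) by (simp add: det_2)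
  then have "(A$1$1 * z + A$1$2) * (A$2$1 * w + A$2$2) - (A$1$1 * w + A$1$2) * (A$2$1 * z + A$2$2) = z - w"
    by algebra
  then show ?thesis
    unfolding moebius_act_def using assms(2,3) by (simp add: diff_frac_eq)
qed

text \<open>
  Schwarz-Pick for the pair \<open>z, w\<close>, divided by \<open>\<bar>z - w\<bar>\<close>, in the limit
  \<open>z \<rightarrow> w\<close>.
\<close>

lemma uhp_contractiveI:
  assumes det: "det A = 1" and maps: "\<And>w. Im w > 0 \<Longrightarrow> Im (moebius_act A w) > 0"
  shows "uhp_contractive A"
  unfolding uhp_contractive_def
proof (intro conjI allI impI)
  fix w assume w: "Im w > 0"
  define D where "D = (\<lambda>z. A$2$1 * z + A$2$2)"
  have D: "D z \<noteq> 0" if "Im z > 0" for z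
    using maps[OF that] by (auto simp: moebius_act_def D_def)
  have hol: "herglotz (moebius_act A)"
    unfolding herglotz_def
  proof
    show "moebius_act A holomorphic_on upper_half_plane"
      unfolding moebius_act_def using D by (intro holomorphic_intros) (auto simp: D_def)
  qed (use maps in auto)
  let ?F = "moebius_act A"
  have "2 * Im w \<le> norm (D w) * norm (D w) * norm (?F w - cnj (?F w))"
  proof (rule tendsto_le[of "at w" "\<lambda>z. norm (D z) * norm (D w) * norm (?F z - cnj (?F w))" _ "\<lambda>z. norm (z - cnj w)"])
    have "continuous (at w) ?F"
      using hol w open_uhp unfolding herglotz_def
      by (metis continuous_on_eq_continuous_at holomorphic_on_imp_continuous_on in_uhp)
    then have "(?F \<longlongrightarrow> ?F w) (at w)" by (simp add: isCont_def)
    then show "((\<lambda>z. norm (D z) * norm (D w) * norm (?F z - cnj (?F w))) \<longlongrightarrow>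
          norm (D w) * norm (D w) * norm (?F w - cnj (?F w))) (at w)"
      unfolding D_def by (intro tendsto_intros)
    have "norm (w - cnj w) = 2 * Im w" using w by (simp add: complex_diff_cnj norm_mult)
    moreover have "((\<lambda>z. norm (z - cnj w)) \<longlongrightarrow> norm (w - cnj w)) (at w)"
      by (intro tendsto_intros)
    ultimately show "((\<lambda>z. norm (z - cnj w)) \<longlongrightarrow> 2 * Im w) (at w)" by simp
    have "eventually (\<lambda>z. z \<in> upper_half_plane \<and> z \<noteq> w) (at w)"
      using eventually_at_in_open[OF open_uhp, of w] w by (auto elim: eventually_mono)
    then show "\<forall>\<^sub>F z in at w. norm (z - cnj w) \<le> norm (D z) * norm (D w) * norm (?F z - cnj (?F w))"
    proof eventually_elim
      case (elim z)
      then have z: "Im z > 0" "z \<noteq> w" by auto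
      have "norm (?F z - ?F w) = norm (z - w) / (norm (D z) * norm (D w))"
        using moebius_diff[OF det, of z w] D z w by (simp add: D_def norm_divide norm_mult)
      then have "norm (z - w) / (norm (D z) * norm (D w)) * norm (z - cnj w)
          \<le> norm (z - w) * norm (?F z - cnj (?F w))"
        using schwarz_pick_uhp[OF hol z(1) w] by simp
      moreover have "norm (z - w) > 0" "norm (D z) * norm (D w) > 0" using D z w by auto
      ultimately show ?case by (simp add: field_simps)
    qed
  qed simp
  also have "norm (?F w - cnj (?F w)) = 2 * Im (?F w)"
    using maps[OF w] by (simp add: complex_diff_cnj norm_mult)
  finally have "Im w \<le> (norm (D w))\<^sup>2 * Im (?F w)" by (simp add: power2_eq_square)
  also have "\<dots> = Im ((A$1$1 * w + A$1$2) * cnj (D w))"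
  proof -
    have "?F w = (A$1$1 * w + A$1$2) / D w" by (simp add: moebius_act_def D_def)
    then have "Im (?F w) = Im ((A$1$1 * w + A$1$2) * cnj (D w)) / (norm (D w))\<^sup>2"
      by (simp only: Im_divide_eq)
    then show ?thesis using D[OF w] by (simp del: complex_cnj_add complex_cnj_mult times_complex.sel)
  qed
  finally show "Im w \<le> Im ((A$1$1 * w + A$1$2) * cnj (A$2$1 * w + A$2$2))" by (simp add: D_def)
qed (rule det)

lemma class_S_contractive: "T \<in> class_S \<Longrightarrow> Im z > 0 \<Longrightarrow> uhp_contractive (T z)"
  by (intro uhp_contractiveI) (auto simp: class_S_def)

lemma class_S_iff:
  "T \<in> class_S \<longleftrightarrow> (\<forall>i j. (\<lambda>z. T z $ i $ j) holomorphic_on UNIV) \<and> (\<forall>z. det (T z) = 1)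
     \<and> (\<forall>x::real. \<forall>i j. T (of_real x) $ i $ j \<in> \<real>)
     \<and> (\<forall>z. Im z > 0 \<longrightarrow> uhp_contractive (T z))"
  (is "_ \<longleftrightarrow> ?R")
proof
  assume "T \<in> class_S" then show ?R using class_S_contractive by (auto simp: class_S_def)
next
  assume ?R then show "T \<in> class_S" using uhp_contractiveD(3) by (auto simp: class_S_def)
qed

lemma norm_entry_le:
  fixes A :: "complex^2^2"
  assumes "norm (A$1$1) \<le> B" "norm (A$1$2) \<le> B" "norm (A$2$1) \<le> B" "norm (A$2$2) \<le> B"
  shows "norm (A$i$j) \<le> B"
  using exhaust_2[of i] exhaust_2[of j] assms by (elim disjE) simp_all

text \<open>
  If \<open>c \<noteq> 0\<close>, the only zero \<open>- d / c\<close> lies in the closed lower half plane, at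
  distance at least \<open>Im w\<close> from \<open>w\<close>.
\<close>

lemma coeff_le_of_zero_free:
  assumes "\<And>w. Im w > 0 \<Longrightarrow> c * w + d \<noteq> 0" "Im w > 0"
  shows "norm c * Im w \<le> norm (c * w + d)"
proof (cases "c = 0")
  case False
  have "Im (d / c) \<ge> 0"
  proof (rule ccontr)
    assume "\<not> Im (d / c) \<ge> 0"
    then have "c * (- (d / c)) + d \<noteq> 0" using assms(1)[of "- (d / c)"] by simp
    then show False using False by simp
  qed
  then have "Im w \<le> Im (w + d / c)" by simp
  also have "\<dots> \<le> norm (w + d / c)" by (rule Im_le_norm)
  finally have "norm c * Im w \<le> norm c * norm (w + d / c)" by (simp add: mult_left_mono)
  also have "\<dots> = norm (c * w + d)" using False by (simp add: norm_mult[symmetric] distrib_left)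
  finally show ?thesis .
qed auto

text \<open>
  The lower right entry of the matrix that describes \<open>A\<close> after a Cayley transform has moved source
  and target from the half plane to the unit disk.
\<close>

definition corner :: "complex^2^2 \<Rightarrow> complex" where
  "corner A = ((A$1$1 + A$2$2) - \<i> * (A$1$2 - A$2$1)) / 2"

lemma corner_eq:
  assumes "uhp_contractive A"
  shows "norm (corner A) = norm (A$2$1 * \<i> + A$2$2) * norm (moebius_act A \<i> + \<i>) / 2"
proof -
  have ne: "A$2$1 * \<i> + A$2$2 \<noteq> 0" using uhp_contractiveD(1)[OF assms, of \<i>] by simp
  have "(A$2$1 * \<i> + A$2$2) * (moebius_act A \<i> + \<i>) = (A$1$1 * \<i> + A$1$2) + \<i> * (A$2$1 * \<i> + A$2$2)"
    unfolding moebius_act_def using ne by (simp add: field_simps)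
  also have "\<dots> = \<i> * (2 * corner A)"
    unfolding corner_def by (simp add: algebra_simps)
  finally have "norm (A$2$1 * \<i> + A$2$2) * norm (moebius_act A \<i> + \<i>) = 2 * norm (corner A)"
    by (simp add: norm_mult flip: norm_mult[of "A$2$1 * \<i> + A$2$2"])
  then show ?thesis by simp
qed

text \<open>
  The transformed map sends the disk into itself and has derivative \<open>1 / (corner A)\<^sup>2\<close> at the
  centre. In the half plane this is \<open>\<bar>c \<i> + d\<bar> \<ge> 1 / sqrt Y\<close> combined with
  \<open>Y + 1 \<ge> 2 sqrt Y\<close> for \<open>Y = Im (A \<i>)\<close>.
\<close>

lemma corner_ge_1:
  assumes "uhp_contractive A"
  shows "norm (corner A) \<ge> 1"
proof -
  define D where "D = norm (A$2$1 * \<i> + A$2$2)"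
  define Y where "Y = Im (moebius_act A \<i>)"
  have Y: "Y > 0" and 1: "1 \<le> Y * D\<^sup>2"
    using uhp_contractiveD(3,4)[OF assms, of \<i>] by (auto simp: D_def Y_def)
  have D: "D \<ge> 0" by (simp add: D_def)
  have "Im (moebius_act A \<i> + \<i>) \<le> norm (moebius_act A \<i> + \<i>)" 
    by (rule Im_le_norm)
  then have "Y + 1 \<le> norm (moebius_act A \<i> + \<i>)" by (simp add: Y_def)
  then have "D * (Y + 1) / 2 \<le> norm (corner A)"
    unfolding corner_eq[OF assms] D_def[symmetric] using D by (simp add: mult_left_mono)
  moreover have "1 \<le> D * (Y + 1) / 2"
  proof -
    have "4 \<le> 4 * Y * D\<^sup>2" using 1 by simp
    also have "\<dots> \<le> (Y + 1)\<^sup>2 * D\<^sup>2"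
    proof (rule mult_right_mono)
      have "(Y + 1)\<^sup>2 - 4 * Y = (Y - 1)\<^sup>2" by (simp add: power2_eq_square algebra_simps)
      then show "4 * Y \<le> (Y + 1)\<^sup>2" using zero_le_power2[of "Y - 1"] by linarith
    qed simp
    finally have "2\<^sup>2 \<le> (D * (Y + 1))\<^sup>2" by (simp add: power_mult_distrib mult.commute)
    then have "2 \<le> D * (Y + 1)" using D Y by (intro power2_le_imp_le[of 2]) auto
    then show ?thesis by simp
  qed
  ultimately show ?thesis by linarith
qed

lemma entries_le_corner:
  assumes "uhp_contractive A"
  shows "norm (A$i$j) \<le> 4 * norm (corner A)"
proof -
  define D where "D = norm (A$2$1 * \<i> + A$2$2)"
  define N where "N = norm (A$1$1 * \<i> + A$1$2)"
  have ne: "A$2$1 * \<i> + A$2$2 \<noteq> 0" using uhp_contractiveD(1)[OF assms, of \<i>] by simp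
  have imp: "Im (moebius_act A \<i>) > 0" using uhp_contractiveD(3)[OF assms, of \<i>] by simp
  have c: "norm (A$2$1) \<le> D" 
    using coeff_le_of_zero_free[OF uhp_contractiveD(1)[OF assms], of \<i>] by (simp add: D_def)
  have a: "norm (A$1$1) \<le> N" 
    using coeff_le_of_zero_free[OF uhp_contractiveD(2)[OF assms], of \<i>] by (simp add: N_def)
  have d: "norm (A$2$2) \<le> 2 * D"
    using norm_triangle_ineq4[of "A$2$1 * \<i> + A$2$2" "A$2$1 * \<i>"] c by (simp add: D_def norm_mult)
  have b: "norm (A$1$2) \<le> 2 * N"
    using norm_triangle_ineq4[of "A$1$1 * \<i> + A$1$2" "A$1$1 * \<i>"] a by (simp add: N_def norm_mult)
  have "1 \<le> Im (moebius_act A \<i> + \<i>)" using imp by simp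
  then have "1 \<le> norm (moebius_act A \<i> + \<i>)"
    by (rule order_trans[OF _ Im_le_norm])
  then have "D * 1 \<le> D * norm (moebius_act A \<i> + \<i>)"
    by (intro mult_left_mono) (auto simp: D_def)
  then have "D \<le> 2 * norm (corner A)"
    unfolding corner_eq[OF assms] D_def[symmetric] by simp
  moreover have "N \<le> 2 * norm (corner A)"
  proof -
    have "(Im (moebius_act A \<i>))\<^sup>2 \<le> (Im (moebius_act A \<i>) + 1)\<^sup>2"
      using imp by (intro power_mono) linarith+
    then have "norm (moebius_act A \<i>) \<le> norm (moebius_act A \<i> + \<i>)"
      unfolding norm_complex_def by simp
    then have "D * norm (moebius_act A \<i>) \<le> D * norm (moebius_act A \<i> + \<i>)"
      by (intro mult_left_mono) (auto simp: D_def)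
    moreover have "D * norm (moebius_act A \<i>) = N"
      unfolding moebius_act_def D_def N_def norm_divide using ne by simp
    ultimately show ?thesis unfolding corner_eq[OF assms] D_def by simp
  qed
  ultimately have "norm (A$1$1) \<le> 4 * norm (corner A)" "norm (A$1$2) \<le> 4 * norm (corner A)"
    "norm (A$2$1) \<le> 4 * norm (corner A)" "norm (A$2$2) \<le> 4 * norm (corner A)"
    using a b c d norm_ge_zero[of "corner A"] by linarith+
  then show ?thesis by (rule norm_entry_le)
qed

text \<open>
  Neither the numerator nor the denominator of \<open>A w\<close> vanishes in the upper half plane, so the size of
  each of them at one point bounds its two coefficients.
\<close>

lemma entries_bound_by_orbit:
  assumes A: "uhp_contractive A" and w: "Im w > 0"
    and D: "norm (A$2$1 * w + A$2$2) \<le> D" and W: "norm (moebius_act A w) \<le> W"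
  shows "norm (A$i$j) \<le> (1 + W) * D * (1 + (1 + norm w) / Im w)"
proof -
  have D0: "D \<ge> 0" using D norm_ge_zero order_trans by blast
  have W0: "W \<ge> 0" using W norm_ge_zero order_trans by blast
  have ne: "A$2$1 * w + A$2$2 \<noteq> 0" using uhp_contractiveD(1)[OF A w] .
  have N: "norm (A$1$1 * w + A$1$2) \<le> W * D"
  proof -
    have "norm (A$1$1 * w + A$1$2) = norm (moebius_act A w) * norm (A$2$1 * w + A$2$2)"
      unfolding moebius_act_def norm_divide using ne by simp
    also have "\<dots> \<le> W * D" using D W W0 by (intro mult_mono) auto
    finally show ?thesis .
  qed
  have gen: "norm p \<le> B * (1 + (1 + norm w) / Im w) \<and> norm q \<le> B * (1 + (1 + norm w) / Im w)"
    if zf: "\<And>w. Im w > 0 \<Longrightarrow> p * w + q \<noteq> 0" and B: "norm (p * w + q) \<le> B" for p q B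
  proof
    have B0: "B \<ge> 0" using B norm_ge_zero order_trans by blast
    have "norm p * Im w \<le> B" using coeff_le_of_zero_free[OF zf w] B by linarith
    then have p: "norm p \<le> B / Im w" using w by (simp add: field_simps)
    show "norm p \<le> B * (1 + (1 + norm w) / Im w)"
    proof -
      have "0 \<le> B + B * norm w / Im w" using B0 w by simp
      moreover have "B * (1 + (1 + norm w) / Im w) = B / Im w + (B + B * norm w / Im w)"
        using w by (simp add: field_simps)
      ultimately show ?thesis using p by linarith
    qed
    have "norm q \<le> norm (p * w + q) + norm (p * w)"
      using norm_triangle_ineq4[of "p * w + q" "p * w"] by simp
    also have "\<dots> \<le> B + B / Im w * norm w"
      unfolding norm_mult using B p by (intro add_mono mult_right_mono) auto
    also have "\<dots> \<le> B + B / Im w * norm w + B / Im w"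
      using B0 w by simp
    also have "\<dots> = B * (1 + (1 + norm w) / Im w)"
      by (simp add: distrib_left add_divide_distrib)
    finally show "norm q \<le> B * (1 + (1 + norm w) / Im w)" .
  qed
  define E where "E = 1 + (1 + norm w) / Im w"
  have E: "E \<ge> 0" using w by (simp add: E_def)
  have "D * E \<le> (1 + W) * D * E" "W * D * E \<le> (1 + W) * D * E"
  proof -
    have "0 \<le> W * D * E" "0 \<le> D * E" using D0 W0 E by simp_all
    then show "D * E \<le> (1 + W) * D * E" "W * D * E \<le> (1 + W) * D * E"
      by (simp_all add: distrib_right)
  qed
  moreover have "norm (A$2$1) \<le> D * E" "norm (A$2$2) \<le> D * E"
    using gen[OF uhp_contractiveD(1)[OF A] D] by (simp_all add: E_def)
  moreover have "norm (A$1$1) \<le> W * D * E" "norm (A$1$2) \<le> W * D * E"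
    using gen[OF uhp_contractiveD(2)[OF A] N] by (simp_all add: E_def)
  ultimately have "norm (A$1$1) \<le> (1 + W) * D * E" "norm (A$1$2) \<le> (1 + W) * D * E"
    "norm (A$2$1) \<le> (1 + W) * D * E" "norm (A$2$2) \<le> (1 + W) * D * E"
    by linarith+
  then show ?thesis unfolding E_def by (rule norm_entry_le)
qed

section \<open>Normal families in the class S\<close>

text \<open>
  \<open>\<i> * ln g\<close> maps into the closed upper half plane, as \<open>ln \<bar>g\<bar> \<ge> 0\<close>.
  Adding \<open>\<i> * \<epsilon>\<close> makes it a Herglotz function, and Schwarz-Pick for Herglotz functions is
  Harnack's inequality for their imaginary parts.
\<close>

lemma harnack_of_zero_free:
  assumes hol: "g holomorphic_on upper_half_plane" and ge1: "\<And>z. Im z > 0 \<Longrightarrow> norm (g z) \<ge> 1"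
    and z: "Im z > 0" and w: "Im w > 0"
  shows "ln (norm (g z)) \<le> ln (norm (g w)) * ((norm (z - cnj w))\<^sup>2 / (Im z * Im w))"
proof -
  have nz: "g u \<noteq> 0" if "u \<in> upper_half_plane" for u
    using ge1[of u] that by auto
  obtain h where h: "h holomorphic_on upper_half_plane" and gh: "\<And>u. u \<in> upper_half_plane \<Longrightarrow> g u = exp (h u)"
    using contractible_imp_holomorphic_log[OF hol convex_imp_contractible[OF convex_uhp] nz] by blast
  have lnh: "ln (norm (g u)) = Re (h u)" if "Im u > 0" for u
    using gh[of u] that by simp
  have Re_h: "Re (h u) \<ge> 0" if "Im u > 0" for u
    using lnh[OF that] ge1[OF that] by (metis ln_ge_zero)
  define p where "p = norm (z - cnj w)"
  define q where "q = norm (z - w)"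
  have q0: "0 \<le> q" by (simp add: q_def)
  have qp: "q < p" unfolding p_def q_def by (rule norm_diff_less_reflected[OF z w])
  have pq: "p\<^sup>2 - q\<^sup>2 = 4 * Im z * Im w"
    unfolding p_def q_def cmod_power2 by (simp add: power2_eq_square algebra_simps)
  have main: "Re (h z) \<le> (Re (h w) + \<epsilon>) * (p\<^sup>2 / (Im z * Im w))" if \<epsilon>: "\<epsilon> > 0" for \<epsilon>
  proof -
    define F where "F = (\<lambda>u. \<i> * (h u + of_real \<epsilon>))"
    have ImF: "Im (F u) = Re (h u) + \<epsilon>" for u by (simp add: F_def)
    have "herglotz F"
      unfolding herglotz_def
    proof
      show "F holomorphic_on upper_half_plane" unfolding F_def by (intro holomorphic_intros h)
      show "F ` upper_half_plane \<subseteq> upper_half_plane"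
        using Re_h \<epsilon> by (auto simp: ImF intro!: add_nonneg_pos)
    qed
    note sp = schwarz_pick_uhp[OF this z w, folded p_def q_def]
    define X where "X = norm (F z - cnj (F w))"
    have B: "Im (F w) > 0" using Re_h[OF w] \<epsilon> by (simp add: ImF)
    have A: "Im (F z) > 0" using Re_h[OF z] \<epsilon> by (simp add: ImF)
    have "X \<le> norm (F z - F w) + norm (F w - cnj (F w))"
      unfolding X_def using norm_triangle_ineq[of "F z - F w" "F w - cnj (F w)"] by simp
    also have "norm (F w - cnj (F w)) = 2 * Im (F w)"
      using B by (simp add: complex_diff_cnj norm_mult)
    finally have "(X - 2 * Im (F w)) * p \<le> norm (F z - F w) * p"
      using qp q0 by (intro mult_right_mono) auto
    then have "(X - 2 * Im (F w)) * p \<le> q * X" using sp by (simp add: X_def)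
    then have 1: "X * (p - q) \<le> 2 * Im (F w) * p" by (simp add: algebra_simps)
    have "Im (F z) + Im (F w) \<le> X"
      using Im_le_norm[of "F z - cnj (F w)"] by (simp add: X_def)
    then have "(Im (F z) + Im (F w)) * (p - q) \<le> X * (p - q)" using qp by (intro mult_right_mono) auto
    then have "(Im (F z) + Im (F w)) * (p - q) \<le> 2 * Im (F w) * p" using 1 by linarith
    then have "(Im (F z) + Im (F w)) * (p - q) * (p + q) \<le> 2 * Im (F w) * p * (p + q)"
      using qp q0 by (intro mult_right_mono) auto
    moreover have "(Im (F z) + Im (F w)) * (p - q) * (p + q) = (Im (F z) + Im (F w)) * (p\<^sup>2 - q\<^sup>2)"
      by (simp add: power2_eq_square algebra_simps)
    moreover have "2 * Im (F w) * p * (p + q) \<le> 2 * Im (F w) * p * (2 * p)"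
      using qp q0 B by (intro mult_left_mono) auto
    moreover have "2 * Im (F w) * p * (2 * p) = 4 * (Im (F w) * p\<^sup>2)" by (simp add: power2_eq_square)
    ultimately have "(Im (F z) + Im (F w)) * (p\<^sup>2 - q\<^sup>2) \<le> 4 * (Im (F w) * p\<^sup>2)"
      by linarith
    then have "(Im (F z) + Im (F w)) * (Im z * Im w) \<le> Im (F w) * p\<^sup>2" unfolding pq by simp
    moreover have "Re (h z) * (Im z * Im w) \<le> (Im (F z) + Im (F w)) * (Im z * Im w)"
      using z w B \<epsilon> by (intro mult_right_mono) (auto simp: ImF)
    ultimately have "Re (h z) * (Im z * Im w) \<le> Im (F w) * p\<^sup>2" by linarith
    then show ?thesis using z w unfolding ImF by (simp add: pos_le_divide_eq)
  qed
  have "Re (h z) \<le> (Re (h w) + 0) * (p\<^sup>2 / (Im z * Im w))"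
  proof (rule tendsto_lowerbound)
    show "((\<lambda>\<epsilon>. (Re (h w) + \<epsilon>) * (p\<^sup>2 / (Im z * Im w))) \<longlongrightarrow> (Re (h w) + 0) * (p\<^sup>2 / (Im z * Im w))) (at_right 0)"
      by (intro tendsto_intros)
    show "\<forall>\<^sub>F \<epsilon> in at_right 0. Re (h z) \<le> (Re (h w) + \<epsilon>) * (p\<^sup>2 / (Im z * Im w))"
      using eventually_at_right_less[of 0] by eventually_elim (rule main)
  qed simp
  then show ?thesis by (simp add: lnh z w p_def)
qed

lemma Re_inverse_complex: "Re (1 / z) = Re z / (norm z)\<^sup>2"
  by (simp add: Re_divide cmod_power2)

text \<open>
  Growth of order \<open>exp (M / \<bar>Im z\<bar>)\<close> towards the real line is harmless for a function that
  is holomorphic across it. The boundary of the diamond \<open>\<bar>Re z\<bar> + \<bar>Im z\<bar> < R\<close>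
  meets the line only in the corners \<open>\<plusminus> R\<close>, and at an angle, so that
  \<open>Re (1 / (R - z))\<close> is comparable to \<open>1 / \<bar>Im z\<bar>\<close> on the adjacent edges. The
  factor \<open>exp (- 2 M / (R - z) - 2 M / (R + z))\<close> therefore compensates the growth, and the maximum
  principle applies to the product.
\<close>

lemma diamond_bound_of_growth_at_line:
  assumes hol: "f holomorphic_on UNIV" and M: "M > 0" and R: "R > 0" and C: "C \<ge> 0"
    and growth: "\<And>z. \<bar>Re z\<bar> + \<bar>Im z\<bar> = R \<Longrightarrow> Im z \<noteq> 0 \<Longrightarrow> norm (f z) \<le> C * exp (M / \<bar>Im z\<bar>)"
    and z: "norm z \<le> R / 4"
  shows "norm (f z) \<le> C * exp (6 * M / R)"
proof -
  define r where "r = complex_of_real R"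
  define S where "S = {z::complex. \<bar>Re z\<bar> + \<bar>Im z\<bar> < R}"
  define Q where "Q = {z::complex. \<bar>Re z\<bar> + \<bar>Im z\<bar> \<le> R}"
  define E where "E = (\<lambda>z. of_real (2 * M) * (1 / (r - z) + 1 / (r + z)))"
  define h where "h = (\<lambda>z. if z = r \<or> z = - r then 0 else f z * exp (- E z))"
  have ReE: "Re (E z) = 2 * M * (Re (1 / (r - z)) + Re (1 / (r + z)))" for z
    unfolding E_def by simp
  have openS: "open S" unfolding S_def by (intro open_Collect_less continuous_intros)
  have closedQ: "closed Q" unfolding Q_def by (intro closed_Collect_le continuous_intros)
  have SQ: "S \<subseteq> Q" by (auto simp: S_def Q_def)
  have clS: "closure S \<subseteq> Q" by (rule closure_minimal[OF SQ closedQ])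
  have normQ: "norm w \<le> R" if "w \<in> Q" for w
    using cmod_le[of w] that by (auto simp: Q_def)
  then have boQ: "bounded Q" by (auto simp: bounded_iff)
  then have "compact Q" using closedQ by (simp add: compact_eq_bounded_closed)
  moreover have "continuous_on Q f" using hol holomorphic_on_imp_continuous_on continuous_on_subset by blast
  ultimately obtain B where B: "\<And>w. w \<in> Q \<Longrightarrow> norm (f w) \<le> B" "B > 0"
    by (metis compact_continuous_image compact_imp_bounded bounded_pos imageI)
  have Re_pos: "Re (1 / (r - w)) \<ge> 0" "Re (1 / (r + w)) \<ge> 0" if "w \<in> Q" for w
    unfolding Re_inverse_complex using that by (auto simp: r_def Q_def intro!: divide_nonneg_nonneg)
  \<comment> \<open>near a corner the diamond lies in a sector of opening \<open>\<pi> / 2\<close>, on which \<open>Re (1 / u)\<close> is comparable to \<open>1 / \<bar>u\<bar>\<close>\<close>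
  have corner: "1 / (2 * norm u) \<le> Re (1 / u)" if "\<bar>Im u\<bar> \<le> Re u" "u \<noteq> 0" for u
  proof -
    have "Re u \<le> norm u" by (rule complex_Re_le_cmod)
    moreover have "norm u \<le> 2 * Re u" using cmod_le[of u] that by linarith
    ultimately show ?thesis
      unfolding Re_inverse_complex using that(2) by (simp add: power2_eq_square field_simps)
  qed
  have h_small: "norm (h w) \<le> B / M * norm (w - s)" if w: "w \<in> Q" and s: "s = r \<or> s = - r" for w s
  proof (cases "w = r \<or> w = - r")
    case True then show ?thesis using B(2) M by (simp add: h_def)
  next
    case False
    have "1 / (2 * norm (w - s)) \<le> Re (1 / (r - w)) + Re (1 / (r + w))"
      using s
    proof
      assume s: "s = r"
      have "1 / (2 * norm (r - w)) \<le> Re (1 / (r - w))"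
        using w False by (intro corner) (auto simp: Q_def r_def)
      then show ?thesis using Re_pos(2)[OF w] s by (simp add: norm_minus_commute)
    next
      assume s: "s = - r"
      have "1 / (2 * norm (r + w)) \<le> Re (1 / (r + w))"
        using w False by (intro corner) (auto simp: Q_def r_def add_eq_0_iff)
      then show ?thesis using Re_pos(1)[OF w] s by (simp add: add.commute)
    qed
    then have "2 * M * (1 / (2 * norm (w - s))) \<le> Re (E w)"
      unfolding ReE using M by (intro mult_left_mono) auto
    then have "M / norm (w - s) \<le> Re (E w)" by simp
    then have "norm (exp (- E w)) \<le> exp (- (M / norm (w - s)))" by simp
    also have "\<dots> \<le> norm (w - s) / M"
    proof -
      have pos: "norm (w - s) > 0" using False s by auto
      have "M / norm (w - s) \<le> exp (M / norm (w - s))" 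
        using exp_ge_add_one_self[of "M / norm (w - s)"] by linarith
      then have "inverse (exp (M / norm (w - s))) \<le> inverse (M / norm (w - s))"
        using pos M by (intro le_imp_inverse_le) auto
      then show ?thesis by (simp add: exp_minus)
    qed
    finally have "norm (f w) * norm (exp (- E w)) \<le> B * (norm (w - s) / M)"
      using B w by (intro mult_mono) auto
    then show ?thesis using False by (simp add: h_def norm_mult)
  qed
  have hol_away: "(\<lambda>w. f w * exp (- E w)) holomorphic_on - {r, - r}"
  proof -
    have "f holomorphic_on - {r, - r}" using hol holomorphic_on_subset by blast
    then show ?thesis
      unfolding E_def by (intro holomorphic_intros) (auto simp: add_eq_0_iff)
  qed
  have opn: "open (- {r, - r})" by (intro open_Compl finite_imp_closed) auto
  have h_hol: "h holomorphic_on - {r, - r}"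
    by (rule holomorphic_transform[OF hol_away]) (auto simp: h_def)
  have rS: "S \<inter> {r, - r} = {}" using R by (auto simp: S_def r_def)
  have h_cont: "continuous_on Q h"
    unfolding continuous_on_eq_continuous_within
  proof
    fix w assume w: "w \<in> Q"
    show "continuous (at w within Q) h"
    proof (cases "w = r \<or> w = - r")
      case True
      have "((\<lambda>u. B / M * norm (u - w)) \<longlongrightarrow> B / M * norm (w - w)) (at w within Q)"
        by (intro tendsto_intros)
      then have "((\<lambda>u. B / M * norm (u - w)) \<longlongrightarrow> 0) (at w within Q)" by simp
      moreover have "\<forall>\<^sub>F u in at w within Q. norm (h u) \<le> B / M * norm (u - w)"
        unfolding eventually_at_filter using h_small[OF _ True] by auto
      ultimately have "(h \<longlongrightarrow> 0) (at w within Q)" by (rule Lim_null_comparison[rotated])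
      then show ?thesis using True by (auto simp: continuous_within h_def)
    next
      case False
      then have "isCont h w"
        using h_hol opn by (metis ComplI continuous_on_eq_continuous_at holomorphic_on_imp_continuous_on insertE singletonD)
      then show ?thesis by (rule continuous_at_imp_continuous_at_within)
    qed
  qed
  have zS: "z \<in> S"
  proof -
    have "\<bar>Re z\<bar> \<le> R / 4" "\<bar>Im z\<bar> \<le> R / 4" using z abs_Re_le_cmod[of z] abs_Im_le_cmod[of z] by linarith+
    then show ?thesis using R by (simp add: S_def)
  qed
  have "norm (h z) \<le> C"
  proof (rule maximum_modulus_frontier[where S = S and f = h])
    show "h holomorphic_on interior S"
      unfolding interior_open[OF openS] using rS by (intro holomorphic_on_subset[OF h_hol]) auto
    show "continuous_on (closure S) h" using h_cont clS continuous_on_subset by blast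
    show "bounded S" using boQ SQ bounded_subset by blast
    show "norm (h w) \<le> C" if "w \<in> frontier S" for w
    proof (cases "w = r \<or> w = - r")
      case True then show ?thesis using C by (simp add: h_def)
    next
      case False
      have wQ: "w \<in> Q" and "w \<notin> S" using that clS openS by (auto simp: frontier_def interior_open)
      then have bd: "\<bar>Re w\<bar> + \<bar>Im w\<bar> = R" by (auto simp: S_def Q_def)
      have Im: "Im w \<noteq> 0"
      proof
        assume "Im w = 0"
        then have "w = r \<or> w = - r" using bd R by (auto simp: r_def complex_eq_iff)
        then show False using False by simp
      qed
      have edge: "Re (1 / u) = 1 / (2 * \<bar>Im u\<bar>)" if "Re u = \<bar>Im u\<bar>" "Im u \<noteq> 0" for u
        unfolding Re_inverse_complex cmod_power2 using that by (simp add: power2_eq_square field_simps)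
      have "1 / (2 * \<bar>Im w\<bar>) \<le> Re (1 / (r - w)) + Re (1 / (r + w))"
      proof (cases "Re w \<ge> 0")
        case True
        have "Re (1 / (r - w)) = 1 / (2 * \<bar>Im (r - w)\<bar>)" using True Im bd by (intro edge) (auto simp: r_def)
        then show ?thesis using Re_pos(2)[OF wQ] by (simp add: r_def)
      next
        case False
        have "Re (1 / (r + w)) = 1 / (2 * \<bar>Im (r + w)\<bar>)" using False Im bd by (intro edge) (auto simp: r_def)
        then show ?thesis using Re_pos(1)[OF wQ] by (simp add: r_def)
      qed
      then have "2 * M * (1 / (2 * \<bar>Im w\<bar>)) \<le> Re (E w)"
        unfolding ReE using M by (intro mult_left_mono) auto
      then have "M / \<bar>Im w\<bar> \<le> Re (E w)" by simp
      then have "norm (f w) * norm (exp (- E w)) \<le> (C * exp (M / \<bar>Im w\<bar>)) * exp (- (M / \<bar>Im w\<bar>))"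
        using growth[OF bd Im] C by (intro mult_mono) auto
      also have "\<dots> = C" by (simp add: mult.assoc flip: exp_add)
      finally show ?thesis using False by (simp add: h_def norm_mult)
    qed
  qed (rule zS)
  moreover have "z \<noteq> r" "z \<noteq> - r" using zS rS by auto
  ultimately have hz: "norm (f z) * exp (- Re (E z)) \<le> C" by (simp add: h_def norm_mult)
  have "Re (E z) \<le> 6 * M / R"
  proof -
    have aux: "Re (1 / u) \<le> 3 / (2 * R)" if "norm u \<ge> 3 * R / 4" for u :: complex
    proof -
      have "Re (1 / u) \<le> norm (1 / u)" by (rule complex_Re_le_cmod)
      also have "\<dots> = 1 / norm u" by (simp add: norm_divide)
      also have "\<dots> \<le> 1 / (3 * R / 4)"
        using that R less_le_trans[of 0 "3 * R / 4" "norm u"] by (intro divide_left_mono mult_pos_pos) auto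
      also have "\<dots> \<le> 3 / (2 * R)" using R by (simp add: field_simps)
      finally show ?thesis .
    qed
    have nr: "norm r = R" using R by (simp add: r_def)
    have "norm (r - z) \<ge> 3 * R / 4" using norm_triangle_ineq2[of r z] nr z by linarith
    moreover have "norm (r + z) \<ge> 3 * R / 4" using norm_diff_ineq[of r z] nr z by linarith
    ultimately have "Re (1 / (r - z)) + Re (1 / (r + z)) \<le> 3 / (2 * R) + 3 / (2 * R)"
      by (intro add_mono aux)
    then have "Re (E z) \<le> 2 * M * (3 / (2 * R) + 3 / (2 * R))"
      unfolding ReE using M by (intro mult_left_mono) auto
    then show ?thesis by simp
  qed
  then have "norm (f z) * exp (- Re (E z)) * exp (Re (E z)) \<le> C * exp (6 * M / R)"
    using hz C by (intro mult_mono) auto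
  then show ?thesis by (simp add: mult.assoc flip: exp_add)
qed

lemma entire_real_on_reals_cnj:
  assumes hol: "f holomorphic_on UNIV" and re: "\<And>x::real. f (of_real x) \<in> \<real>"
  shows "f (cnj z) = cnj (f z)"
proof -
  define g where "g = (\<lambda>z. f z - (cnj \<circ> f \<circ> cnj) z)"
  have "(cnj \<circ> f \<circ> cnj) holomorphic_on UNIV"
    by (intro holomorphic_on_compose_cnj_cnj holomorphic_on_subset[OF hol]) auto
  then have "g holomorphic_on UNIV" unfolding g_def by (intro holomorphic_intros hol)
  moreover have "g u = 0" if "u \<in> \<real>" for u
    using that re by (auto simp: g_def elim!: Reals_cases) (metis Reals_cnj_iff)
  moreover have "0 islimpt (\<real>::complex set)"
  proof -
    have "(\<lambda>n. of_real (inverse (of_nat (Suc n))) :: complex) \<longlonglongrightarrow> of_real 0"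
      by (intro tendsto_of_real LIMSEQ_inverse_real_of_nat)
    then show ?thesis
      unfolding islimpt_sequential
      by (intro exI[of _ "\<lambda>n. of_real (inverse (of_nat (Suc n)))"]) (auto simp del: of_real_inverse of_nat_Suc)
  qed
  ultimately have "g (cnj z) = 0"
    using analytic_continuation[of g UNIV "\<real>" 0 "cnj z"] by auto
  then show ?thesis by (simp add: g_def)
qed

lemma class_S_cnj:
  assumes "T \<in> class_S"
  shows "T (cnj z) $ i $ j = cnj (T z $ i $ j)"
  using assms by (intro entire_real_on_reals_cnj[of "\<lambda>z. T z $ i $ j"]) (auto simp: class_S_def)

text \<open>
  One value of \<open>corner\<close> controls the whole family: Harnack's inequality in the upper half plane,
  reflection in the real line, and the diamond lemma across it.
\<close>

lemma class_S_locally_bounded: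
  assumes S: "\<And>n. T n \<in> class_S" and w: "Im w > 0" and bd: "\<And>n. norm (corner (T n w)) \<le> B"
  shows "\<exists>C. \<forall>n i j z. norm z \<le> r \<longrightarrow> norm (T n z $ i $ j) \<le> C"
proof -
  \<comment> \<open>The diamond lemma gives a bound on a disk of a quarter of the size. The summand 1 in \<open>M\<close> only makes \<open>M\<close> positive.\<close>
  define R where "R = 4 * (\<bar>r\<bar> + 1)"
  have R: "R > 0" by (simp add: R_def)
  define M where "M = ln B * ((R + norm w)\<^sup>2 / Im w) + 1"
  have B1: "B \<ge> 1" using corner_ge_1[OF class_S_contractive[OF S w]] bd order_trans by blast
  then have lnB: "ln B \<ge> 0" by simp
  have M: "M > 0" using lnB w by (auto simp: M_def intro!: add_nonneg_pos mult_nonneg_nonneg divide_nonneg_nonneg)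
  have upper: "norm (T n u $ i $ j) \<le> 4 * exp (M / Im u)" if u: "Im u > 0" "norm u \<le> R" for n i j u
  proof -
    have hol: "(\<lambda>z. corner (T n z)) holomorphic_on upper_half_plane"
    proof -
      have "(\<lambda>z. T n z $ i $ j) holomorphic_on upper_half_plane" for i j
        using S[of n] unfolding class_S_def by (auto intro: holomorphic_on_subset)
      then show ?thesis unfolding corner_def by (intro holomorphic_intros) auto
    qed
    have g1: "1 \<le> norm (corner (T n z))" if "Im z > 0" for z
      by (rule corner_ge_1[OF class_S_contractive[OF S that]])
    have "ln (norm (corner (T n u))) \<le> ln (norm (corner (T n w))) * ((norm (u - cnj w))\<^sup>2 / (Im u * Im w))"
      by (rule harnack_of_zero_free[OF hol g1 u(1) w])
    also have "\<dots> \<le> ln B * ((R + norm w)\<^sup>2 / (Im u * Im w))"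
    proof (rule mult_mono)
      have "0 < norm (corner (T n w))" using g1[OF w] by linarith
      then show "ln (norm (corner (T n w))) \<le> ln B" using bd[of n] B1 by simp
      have "norm (u - cnj w) \<le> R + norm w" using norm_triangle_ineq4[of u "cnj w"] u(2) by simp
      then have "(norm (u - cnj w))\<^sup>2 \<le> (R + norm w)\<^sup>2" by (intro power_mono) auto
      then show "(norm (u - cnj w))\<^sup>2 / (Im u * Im w) \<le> (R + norm w)\<^sup>2 / (Im u * Im w)"
        using u w by (intro divide_right_mono) auto
    qed (use lnB u w in auto)
    also have "\<dots> \<le> M / Im u"
      using u w by (simp add: M_def field_simps)
    finally have "exp (ln (norm (corner (T n u)))) \<le> exp (M / Im u)" by (subst exp_le_cancel_iff)
    moreover have "0 < norm (corner (T n u))" using g1[OF u(1)] by linarith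
    ultimately have "norm (corner (T n u)) \<le> exp (M / Im u)" by (simp only: exp_ln)
    then show ?thesis
      using entries_le_corner[OF class_S_contractive[OF S u(1)], of n i j] by linarith
  qed
  have "norm (T n z $ i $ j) \<le> 4 * exp (6 * M / R)" if "norm z \<le> r" for n i j z
  proof (rule diamond_bound_of_growth_at_line[where f = "\<lambda>z. T n z $ i $ j", OF _ M R])
    show "(\<lambda>z. T n z $ i $ j) holomorphic_on UNIV" using S[of n] by (simp add: class_S_def)
    show "norm z \<le> R / 4" using that by (simp add: R_def)
    fix u :: complex assume u: "\<bar>Re u\<bar> + \<bar>Im u\<bar> = R" "Im u \<noteq> 0"
    have uR: "norm u \<le> R" using cmod_le[of u] u by simp
    show "norm (T n u $ i $ j) \<le> 4 * exp (M / \<bar>Im u\<bar>)"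
    proof (cases "Im u > 0")
      case True then show ?thesis using upper[of u n i j] uR by simp
    next
      case False
      have "norm (T n (cnj u) $ i $ j) \<le> 4 * exp (M / Im (cnj u))"
        using upper[of "cnj u" n i j] uR u(2) False by simp
      then show ?thesis using False u(2) by (simp add: class_S_cnj[OF S])
    qed
  qed simp
  then show ?thesis by blast
qed

text \<open>
  The contraction inequality is closed under limits; the strict positivity of \<open>Im w\<close> in it then keeps
  the limit transformation inside the open half plane.
\<close>

lemma class_S_limit:
  assumes S: "\<And>n. T n \<in> class_S" and hol: "\<And>i j. (\<lambda>z. T' z $ i $ j) holomorphic_on UNIV"
    and lim: "\<And>z i j. (\<lambda>n. T n z $ i $ j) \<longlonglongrightarrow> T' z $ i $ j"
  shows "T' \<in> class_S"
  unfolding class_S_iff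
proof (intro conjI allI impI)
  show det: "det (T' z) = 1" for z
  proof (rule LIMSEQ_unique)
    show "(\<lambda>n. det (T n z)) \<longlonglongrightarrow> det (T' z)"
      unfolding det_2 by (intro tendsto_intros lim)
    show "(\<lambda>n. det (T n z)) \<longlonglongrightarrow> 1" using S by (simp add: class_S_def)
  qed
  show "T' (of_real x) $ i $ j \<in> \<real>" for x :: real and i j
    using closed_sequentially[OF closed_complex_Reals _ lim[of "of_real x" i j]] S by (auto simp: class_S_def)
  show "uhp_contractive (T' z)" if z: "Im z > 0" for z
    unfolding uhp_contractive_def
  proof (intro conjI allI impI)
    fix w assume w: "Im w > 0"
    let ?J = "\<lambda>A::complex^2^2. Im ((A$1$1 * w + A$1$2) * cnj (A$2$1 * w + A$2$2))"
    have "(\<lambda>n. ?J (T n z)) \<longlonglongrightarrow> ?J (T' z)" by (intro tendsto_intros lim)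
    moreover have "Im w \<le> ?J (T n z)" for n
      using class_S_contractive[OF S z] w by (simp add: uhp_contractive_def)
    ultimately show "Im w \<le> ?J (T' z)" using LIMSEQ_le_const by blast
  qed (rule det)
qed (rule hol)

lemma norm_matrix_2_le: "norm (A::complex^2^2) \<le> (\<Sum>i\<in>UNIV. \<Sum>j\<in>UNIV. norm (A$i$j))"
proof -
  have row: "norm (v::complex^2) \<le> (\<Sum>j\<in>UNIV. norm (v$j))" for v
    unfolding norm_vec_def by (rule L2_set_le_sum) simp
  have "norm A \<le> (\<Sum>i\<in>UNIV. norm (A$i))"
    unfolding norm_vec_def[of A] by (rule L2_set_le_sum) simp
  also have "\<dots> \<le> (\<Sum>i\<in>UNIV. \<Sum>j\<in>UNIV. norm (A$i$j))" by (intro sum_mono row)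
  finally show ?thesis .
qed

lemma uniform_limit_matrix:
  fixes f :: "nat \<Rightarrow> complex \<Rightarrow> complex^2^2"
  assumes "\<And>i j. uniform_limit K (\<lambda>n z. f n z $ i $ j) (\<lambda>z. l z $ i $ j) sequentially"
  shows "uniform_limit K f l sequentially"
proof (rule uniform_limitI)
  fix e :: real assume e: "e > 0"
  have "\<forall>\<^sub>F n in sequentially. \<forall>i j. \<forall>z\<in>K. dist (f n z $ i $ j) (l z $ i $ j) < e / 4"
    by (intro eventually_all_finite uniform_limitD[OF assms]) (use e in auto)
  then show "\<forall>\<^sub>F n in sequentially. \<forall>z\<in>K. dist (f n z) (l z) < e"
  proof eventually_elim
    case (elim n)
    show ?case
    proof
      fix z assume z: "z \<in> K"
      have "norm (f n z - l z) \<le> (\<Sum>i\<in>UNIV. \<Sum>j\<in>UNIV. norm ((f n z - l z)$i$j))" by (rule norm_matrix_2_le)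
      also have "\<dots> < e"
        using elim[rule_format, OF z, of 1 1] elim[rule_format, OF z, of 1 2]
          elim[rule_format, OF z, of 2 1] elim[rule_format, OF z, of 2 2]
        by (simp add: sum_2 dist_norm)
      finally show "dist (f n z) (l z) < e" by (simp add: dist_norm)
    qed
  qed
qed

lemma class_S_montel:
  assumes S: "\<And>n. T n \<in> class_S"
    and bd: "\<And>r. \<exists>C. \<forall>n i j z. norm z \<le> r \<longrightarrow> norm (T n z $ i $ j) \<le> C"
  obtains T' r where "T' \<in> class_S" "strict_mono (r :: nat \<Rightarrow> nat)"
    "\<And>K. compact K \<Longrightarrow> uniform_limit K (\<lambda>n. T (r n)) T' sequentially"
proof -
  have "\<exists>g r. strict_mono (r :: nat \<Rightarrow> nat) \<and>
      (\<forall>(i, j)\<in>I. g i j holomorphic_on UNIV \<and>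
         (\<forall>K. compact K \<longrightarrow> uniform_limit K (\<lambda>n z. T (r n) z $ i $ j) (g i j) sequentially))"
    if "finite I" for I :: "(2 \<times> 2) set"
    using that
  proof (induction I rule: finite_induct)
    case empty
    show ?case by (intro exI[of _ undefined] exI[of _ id]) (auto simp: strict_mono_def)
  next
    case (insert x I)
    obtain i j where x: "x = (i, j)" by (cases x)
    obtain g r where r: "strict_mono (r :: nat \<Rightarrow> nat)" and
      g: "\<And>i j. (i, j) \<in> I \<Longrightarrow> g i j holomorphic_on UNIV"
         "\<And>i j K. (i, j) \<in> I \<Longrightarrow> compact K \<Longrightarrow> uniform_limit K (\<lambda>n z. T (r n) z $ i $ j) (g i j) sequentially"
      using insert.IH by blast
    let ?F = "\<lambda>n z. T (r n) z $ i $ j"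
    obtain h s where h: "h holomorphic_on UNIV" and s: "strict_mono (s :: nat \<Rightarrow> nat)"
      and hs: "\<And>K. \<lbrakk>compact K; K \<subseteq> UNIV\<rbrakk> \<Longrightarrow> uniform_limit K (?F \<circ> s) h sequentially"
    proof (rule Montel[of UNIV "range ?F" ?F])
      show "f holomorphic_on UNIV" if "f \<in> range ?F" for f
        using that S by (auto simp: class_S_def)
      show "\<exists>B. \<forall>f\<in>range ?F. \<forall>z\<in>K. norm (f z) \<le> B" if "compact K" for K
      proof -
        obtain c where c: "\<And>z. z \<in> K \<Longrightarrow> norm z \<le> c"
          using compact_imp_bounded[OF \<open>compact K\<close>] by (auto simp: bounded_iff)
        then show ?thesis using bd[of c] by blast
      qed
    qed auto
    show ?case
    proof (intro exI conjI)
      show "strict_mono (r \<circ> s)" using r s by (rule strict_mono_o)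
      show "\<forall>(k, l)\<in>insert x I. (g(i := (g i)(j := h))) k l holomorphic_on UNIV \<and>
         (\<forall>K. compact K \<longrightarrow> uniform_limit K (\<lambda>n z. T ((r \<circ> s) n) z $ k $ l) ((g(i := (g i)(j := h))) k l) sequentially)"
      proof (clarify, intro conjI allI impI)
        fix k l assume kl: "(k, l) \<in> insert x I"
        show "(g(i := (g i)(j := h))) k l holomorphic_on UNIV"
          using g(1) h kl x by (cases "k = i"; cases "l = j") auto
        fix K :: "complex set" assume K: "compact K"
        show "uniform_limit K (\<lambda>n z. T ((r \<circ> s) n) z $ k $ l) ((g(i := (g i)(j := h))) k l) sequentially"
        proof (cases "(k, l) = (i, j)")
          case True
          then show ?thesis using hs[OF K] by (simp add: o_def)
        next
          case False
          then have "(k, l) \<in> I" "(g(i := (g i)(j := h))) k l = g k l" using kl x by auto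
          moreover have "filterlim s sequentially sequentially" by (rule filterlim_subseq[OF s])
          ultimately show ?thesis
            using filterlim_compose[OF g(2)[OF _ K, of k l]] by (simp add: o_def)
        qed
      qed
    qed
  qed
  from this[OF finite, of UNIV] obtain g r where r: "strict_mono (r :: nat \<Rightarrow> nat)"
    and "\<forall>(i, j)\<in>UNIV. g i j holomorphic_on UNIV \<and>
         (\<forall>K. compact K \<longrightarrow> uniform_limit K (\<lambda>n z. T (r n) z $ i $ j) (g i j) sequentially)"
    by (elim exE conjE) (rule that)
  then have
    g: "\<And>i j. g i j holomorphic_on UNIV"
      "\<And>i j K. compact K \<Longrightarrow> uniform_limit K (\<lambda>n z. T (r n) z $ i $ j) (g i j) sequentially"
    by auto
  define T' where "T' = (\<lambda>z. (\<chi> i j. g i j z) :: complex^2^2)"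
  have ul: "uniform_limit K (\<lambda>n. T (r n)) T' sequentially" if "compact K" for K
    using g(2)[OF that] by (intro uniform_limit_matrix) (simp add: T'_def)
  have "T' \<in> class_S"
  proof (rule class_S_limit[where T = "\<lambda>n. T (r n)"])
    show "(\<lambda>z. T' z $ i $ j) holomorphic_on UNIV" for i j using g(1) by (simp add: T'_def)
    show "(\<lambda>n. T (r n) z $ i $ j) \<longlonglongrightarrow> T' z $ i $ j" for z i j
      using tendsto_uniform_limitI[OF ul[of "{z}"], of z] by (intro tendsto_vec_nth) auto
  qed (rule S)
  then show ?thesis using that r ul by blast
qed

section \<open>Products, limits and two competing limits\<close>

lemma matrix_mult_2: "((A::complex^2^2) ** B) $ i $ j = A$i$1 * B$1$j + A$i$2 * B$2$j"
  by (simp add: matrix_matrix_mult_def sum_2)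

abbreviation denom :: "complex^2^2 \<Rightarrow> complex \<Rightarrow> complex" where
  "denom A w \<equiv> A$2$1 * w + A$2$2"

lemma denom_mult:
  assumes "denom B w \<noteq> 0"
  shows "denom (A ** B) w = denom A (moebius_act B w) * denom B w"
proof -
  have "moebius_act B w * denom B w = B$1$1 * w + B$1$2" using assms by (simp add: moebius_act_def)
  then show ?thesis unfolding matrix_mult_2 by algebra
qed

lemma moebius_act_mult:
  assumes "denom B w \<noteq> 0"
  shows "moebius_act (A ** B) w = moebius_act A (moebius_act B w)"
proof -
  have "(A ** B)$1$1 * w + (A ** B)$1$2 = (A$1$1 * moebius_act B w + A$1$2) * denom B w"
  proof -
    have "moebius_act B w * denom B w = B$1$1 * w + B$1$2" using assms by (simp add: moebius_act_def)
    then show ?thesis unfolding matrix_mult_2 by algebra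
  qed
  then show ?thesis
    unfolding moebius_act_def[of "A ** B"] moebius_act_def[of A] denom_mult[OF assms] using assms by simp
qed

lemma moebius_act_I_conj: "moebius_act (I_mat ** A ** I_mat) w = - moebius_act A (- w)"
proof -
  have "moebius_act (I_mat ** A ** I_mat) w = (A$1$1 * w - A$1$2) / (- (A$2$1 * w) + A$2$2)"
    by (simp add: moebius_act_def matrix_mult_2 I_mat_def)
  also have "\<dots> = - ((- (A$1$1 * w) + A$1$2) / (- (A$2$1 * w) + A$2$2))"
    by (simp add: minus_divide_left)
  finally show ?thesis by (simp add: moebius_act_def)
qed

lemma class_S_mult:
  assumes "T \<in> class_S" "U \<in> class_S"
  shows "(\<lambda>z. T z ** U z) \<in> class_S"
  unfolding class_S_def mem_Collect_eq
proof (intro conjI allI ballI)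
  show "(\<lambda>z. (T z ** U z) $ i $ j) holomorphic_on UNIV" for i j
    unfolding matrix_mult_2 using assms by (intro holomorphic_intros) (auto simp: class_S_def)
  show "det (T z ** U z) = 1" for z using assms by (simp add: class_S_def det_mul)
  show "(T (of_real x) ** U (of_real x)) $ i $ j \<in> \<real>" for x :: real and i j
    unfolding matrix_mult_2 using assms by (intro Reals_add Reals_mult) (auto simp: class_S_def)
  fix w z assume w: "w \<in> upper_half_plane" and z: "z \<in> upper_half_plane"
  have "denom (U z) w \<noteq> 0" using uhp_contractiveD(1)[OF class_S_contractive[OF assms(2)]] w z by simp
  moreover have "moebius_act (U z) w \<in> upper_half_plane" using assms(2) w z unfolding class_S_def by blast
  then have "moebius_act (T z) (moebius_act (U z) w) \<in> upper_half_plane"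
    using assms(1) z unfolding class_S_def by blast
  ultimately show "moebius_act (T z ** U z) w \<in> upper_half_plane"
    by (subst moebius_act_mult)
qed

lemma class_S_one: "(\<lambda>z. mat 1) \<in> class_S"
proof -
  have "moebius_act (mat 1) w = w" for w by (simp add: moebius_act_def mat_def)
  moreover have "(mat 1 :: complex^2^2) $ i $ j \<in> \<real>" for i j by (simp add: mat_def)
  ultimately show ?thesis by (simp add: class_S_def)
qed

lemma moebius_act_uminus: "moebius_act (- A) w = moebius_act A w"
proof -
  have "moebius_act (- A) w = (- (A$1$1 * w + A$1$2)) / (- denom A w)"
    by (simp add: moebius_act_def algebra_simps)
  then show ?thesis unfolding minus_divide_divide by (simp add: moebius_act_def)
qed

lemma class_S_uminus:
  assumes "T \<in> class_S"
  shows "(\<lambda>z. - T z) \<in> class_S"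
  unfolding class_S_def mem_Collect_eq moebius_act_uminus
proof (intro conjI allI)
  show "(\<lambda>z. (- T z) $ i $ j) holomorphic_on UNIV" for i j
    using assms by (simp add: class_S_def holomorphic_on_minus)
  show "det (- T z) = 1" for z
    using assms by (simp add: class_S_def det_2)
  show "(- T (of_real x)) $ i $ j \<in> \<real>" for x :: real and i j
    using assms by (simp add: class_S_def)
qed (use assms in \<open>simp add: class_S_def\<close>)

lemma transfer_prod_class_S:
  assumes "\<And>n. n \<ge> 1 \<Longrightarrow> T n \<in> class_S"
  shows "transfer_prod T n \<in> class_S"
proof (induction n)
  case 0
  then show ?case using class_S_one by (simp cong: conj_cong) 
next
  case (Suc n)
  have "transfer_prod T (Suc n) = (\<lambda>z. T (Suc n) z ** transfer_prod T n z)" by auto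
  then show ?case using class_S_mult[OF assms Suc, of "Suc n"] by simp
qed

text \<open>
  The denominator cannot tend to 0: the numerator would do so too, since the images stay bounded, in contradiction
  to determinant 1.
\<close>

lemma moebius_act_limit:
  assumes lim: "\<And>i j. (\<lambda>n. A n $ i $ j) \<longlonglongrightarrow> A' $ i $ j" and det: "det A' = 1"
    and act: "(\<lambda>n. moebius_act (A n) w) \<longlonglongrightarrow> l" and ne: "\<And>n. denom (A n) w \<noteq> 0"
  shows "denom A' w \<noteq> 0" "moebius_act A' w = l"
proof -
  have num: "moebius_act (A n) w * denom (A n) w = A n $ 1 $ 1 * w + A n $ 1 $ 2" for n
    using ne[of n] by (simp add: moebius_act_def)
  have "(\<lambda>n. moebius_act (A n) w * denom (A n) w) \<longlonglongrightarrow> l * denom A' w"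
    by (intro tendsto_intros lim act)
  moreover have "(\<lambda>n. A n $ 1 $ 1 * w + A n $ 1 $ 2) \<longlonglongrightarrow> A' $ 1 $ 1 * w + A' $ 1 $ 2"
    by (intro tendsto_intros lim)
  ultimately have eq: "A' $ 1 $ 1 * w + A' $ 1 $ 2 = l * denom A' w"
    unfolding num by (rule LIMSEQ_unique[rotated])
  show 1: "denom A' w \<noteq> 0"
  proof
    assume 0: "denom A' w = 0"
    have "(A' $ 1 $ 1 * w + A' $ 1 $ 2) * A' $ 2 $ 1 - denom A' w * A' $ 1 $ 1 = - det A'"
      by (simp add: det_2 algebra_simps)
    then show False unfolding eq 0 det by simp
  qed
  show "moebius_act A' w = l" using eq 1 by (simp add: moebius_act_def)
qed

text \<open>
  Besides \<open>q\<close> and \<open>e\<close> also \<open>cnj q\<close> is a root. If the three were distinct,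
  division by their differences would leave two linear equations that force \<open>a = 0\<close>, then
  \<open>b = 0\<close> and \<open>c = 0\<close>.
\<close>

lemma real_quadratic_roots_cnj:
  fixes a b c q e :: complex
  assumes re: "a \<in> \<real>" "b \<in> \<real>" "c \<in> \<real>" and ne: "a \<noteq> 0 \<or> b \<noteq> 0 \<or> c \<noteq> 0"
    and q: "a * q\<^sup>2 + b * q + c = 0" "Im q > 0" and e: "a * e\<^sup>2 + b * e + c = 0" "Im e < 0"
  shows "e = cnj q"
proof (rule ccontr)
  assume neq: "e \<noteq> cnj q"
  have "cnj (a * q\<^sup>2 + b * q + c) = 0" using q by simp
  then have "a * (cnj q)\<^sup>2 + b * cnj q + c = 0" using re by (simp add: Reals_cnj_iff)
  then have "(cnj q - e) * (a * (cnj q + e) + b) = 0" using e(1) by algebra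
  then have 1: "a * (cnj q + e) + b = 0" using neq by simp
  have "(q - e) * (a * (q + e) + b) = 0" using q(1) e(1) by algebra
  moreover have "q \<noteq> e" using q e by auto
  ultimately have 2: "a * (q + e) + b = 0" by simp
  have "a * (q - cnj q) = 0" using 1 2 by algebra
  moreover have "q \<noteq> cnj q" using q(2) by (auto simp: complex_eq_iff)
  ultimately have "a = 0" by simp
  then show False using 1 q(1) ne by auto
qed

lemma boundary_value_tendsto_entire:
  assumes "f holomorphic_on UNIV"
  shows "((\<lambda>y. f (Complex x y)) \<longlongrightarrow> f (of_real x)) (at_right 0)"
proof -
  have "isCont f (of_real x)"
    using assms by (meson UNIV_I continuous_on_eq_continuous_at holomorphic_on_imp_continuous_on open_UNIV)
  moreover have "((\<lambda>y. Complex x y) \<longlongrightarrow> Complex x 0) (at_right 0)"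
    by (intro tendsto_Complex tendsto_const tendsto_ident_at)
  ultimately show ?thesis
    by (auto simp: complex_of_real_def intro: isCont_tendsto_compose)
qed

lemma real_denom_nonzero:
  assumes re: "\<And>i j. A $ i $ j \<in> \<real>" and det: "det A = 1" and w: "Im w \<noteq> 0"
  shows "denom A w \<noteq> 0"
proof
  assume 0: "denom A w = 0"
  obtain c d where cd: "A $ 2 $ 1 = of_real c" "A $ 2 $ 2 = of_real d"
    using re by (meson Reals_cases)
  have "c * Im w = 0" using 0 cd by (simp add: complex_eq_iff)
  then have "c = 0" using w by simp
  then have "d = 0" using 0 cd by simp
  then show False using cd \<open>c = 0\<close> det by (simp add: det_2)
qed

lemma moebius_boundary_value:
  assumes S: "T \<in> class_S" and F: "has_boundary_value F x w" and w: "Im w \<noteq> 0"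
  shows "((\<lambda>y. moebius_act (T (Complex x y)) (F (Complex x y))) \<longlongrightarrow> moebius_act (T (of_real x)) w) (at_right 0)"
proof -
  have ent: "((\<lambda>y. T (Complex x y) $ i $ j) \<longlongrightarrow> T (of_real x) $ i $ j) (at_right 0)" for i j
    using S by (intro boundary_value_tendsto_entire) (auto simp: class_S_def)
  have "denom (T (of_real x)) w \<noteq> 0"
    using S w by (intro real_denom_nonzero) (simp_all add: class_S_def)
  then show ?thesis
    unfolding moebius_act_def using F[unfolded has_boundary_value_def]
    by (intro tendsto_intros ent)
qed

lemma moebius_act_real_cnj:
  assumes "\<And>i j. A $ i $ j \<in> \<real>"
  shows "moebius_act A (cnj w) = cnj (moebius_act A w)"
  using assms by (simp add: moebius_act_def Reals_cnj_iff)

lemma eventually_Complex_uhp: "eventually (\<lambda>y. Im (Complex x y) > 0) (at_right 0)"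
  using eventually_at_right_less[of 0] by eventually_elim simp

text \<open>
  The coefficients of the quadratic equation for \<open>w\<close> that results from clearing denominators in
  \<open>A w = B w\<close>.
\<close>

definition quad_a :: "complex^2^2 \<Rightarrow> complex^2^2 \<Rightarrow> complex" where
  "quad_a A B = A$1$1 * B$2$1 - B$1$1 * A$2$1"
definition quad_b :: "complex^2^2 \<Rightarrow> complex^2^2 \<Rightarrow> complex" where
  "quad_b A B = A$1$1 * B$2$2 + A$1$2 * B$2$1 - B$1$1 * A$2$2 - B$1$2 * A$2$1"
definition quad_c :: "complex^2^2 \<Rightarrow> complex^2^2 \<Rightarrow> complex" where
  "quad_c A B = A$1$2 * B$2$2 - B$1$2 * A$2$2"

lemma quad_eq_0:
  assumes "moebius_act A w = moebius_act B w" "denom A w \<noteq> 0" "denom B w \<noteq> 0"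
  shows "quad_a A B * w\<^sup>2 + quad_b A B * w + quad_c A B = 0"
proof -
  have "(A$1$1 * w + A$1$2) * denom B w = (B$1$1 * w + B$1$2) * denom A w"
    using assms by (simp add: moebius_act_def frac_eq_eq)
  then show ?thesis unfolding quad_a_def quad_b_def quad_c_def by algebra
qed

text \<open>
  If the equation \<open>P w = Q w\<close> is void, then \<open>P\<^sup>-\<^sup>1 Q\<close> is a scalar matrix of
  determinant 1, so \<open>1\<close> or \<open>- 1\<close> at each point, and by continuity the same everywhere.
\<close>

lemma eq_or_uminus_if_quad_0:
  assumes S: "P \<in> class_S" "Q \<in> class_S"
    and 0: "\<And>z. quad_a (P z) (Q z) = 0" "\<And>z. quad_b (P z) (Q z) = 0" "\<And>z. quad_c (P z) (Q z) = 0"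
  shows "Q = P \<or> Q = (\<lambda>z. - P z)"
proof -
  define k where "k = (\<lambda>z. P z$2$2 * Q z$1$1 - P z$1$2 * Q z$2$1)"
  have det: "P z$1$1 * P z$2$2 - P z$1$2 * P z$2$1 = 1" "Q z$1$1 * Q z$2$2 - Q z$1$2 * Q z$2$1 = 1" for z
    using S by (auto simp: class_S_def det_2)
  note q = 0[unfolded quad_a_def quad_b_def quad_c_def]
  have Q: "Q z$1$1 = k z * P z$1$1" "Q z$1$2 = k z * P z$1$2" "Q z$2$1 = k z * P z$2$1" "Q z$2$2 = k z * P z$2$2" for z
  proof -
    have k': "k z = P z$1$1 * Q z$2$2 - P z$2$1 * Q z$1$2"
      using q(2)[of z] unfolding k_def by (simp add: algebra_simps)
    have "k z * P z$1$1 = Q z$1$1 * (P z$1$1 * P z$2$2 - P z$1$2 * P z$2$1)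
        - P z$1$2 * (P z$1$1 * Q z$2$1 - Q z$1$1 * P z$2$1)"
      unfolding k_def by (simp add: algebra_simps)
    then show "Q z$1$1 = k z * P z$1$1" using q(1)[of z] det(1)[of z] by simp
    have "k z * P z$2$1 = Q z$2$1 * (P z$1$1 * P z$2$2 - P z$1$2 * P z$2$1)
        - P z$2$2 * (P z$1$1 * Q z$2$1 - Q z$1$1 * P z$2$1)"
      unfolding k_def by (simp add: algebra_simps)
    then show "Q z$2$1 = k z * P z$2$1" using q(1)[of z] det(1)[of z] by simp
    have "k z * P z$1$2 = Q z$1$2 * (P z$1$1 * P z$2$2 - P z$1$2 * P z$2$1)
        + P z$1$1 * (P z$1$2 * Q z$2$2 - Q z$1$2 * P z$2$2)"
      unfolding k' by (simp add: algebra_simps)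
    then show "Q z$1$2 = k z * P z$1$2" using q(3)[of z] det(1)[of z] by simp
    have "k z * P z$2$2 = Q z$2$2 * (P z$1$1 * P z$2$2 - P z$1$2 * P z$2$1)
        + P z$2$1 * (P z$1$2 * Q z$2$2 - Q z$1$2 * P z$2$2)"
      unfolding k' by (simp add: algebra_simps)
    then show "Q z$2$2 = k z * P z$2$2" using q(3)[of z] det(1)[of z] by simp
  qed
  have k1: "(k z)\<^sup>2 = 1" for z
  proof -
    have "Q z$1$1 * Q z$2$2 - Q z$1$2 * Q z$2$1 = (k z)\<^sup>2 * (P z$1$1 * P z$2$2 - P z$1$2 * P z$2$1)"
      unfolding Q by (simp add: power2_eq_square algebra_simps)
    then show ?thesis using det[of z] by simp
  qed
  have "(\<lambda>z. P z $ i $ j) holomorphic_on UNIV" "(\<lambda>z. Q z $ i $ j) holomorphic_on UNIV" for i j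
    using S by (auto simp: class_S_def)
  then have "k holomorphic_on UNIV" unfolding k_def by (intro holomorphic_intros)
  then have "continuous_on UNIV k" by (rule holomorphic_on_imp_continuous_on)
  moreover have "range k \<subseteq> {1, -1}" using k1 by (auto simp: power2_eq_1_iff)
  ultimately have "k constant_on UNIV"
    by (intro continuous_finite_range_constant) (auto intro: finite_subset)
  then obtain c where c: "\<And>z. k z = c" by (auto simp: constant_on_def)
  have "c = 1 \<or> c = -1" using k1[of 0] c by (simp add: power2_eq_1_iff)
  then show ?thesis
  proof
    assume "c = 1"
    then have "Q z = P z" for z using Q[of z] c by (simp add: vec_eq_iff forall_2)
    then show ?thesis by auto
  next
    assume "c = -1"
    then have "Q z = - P z" for z using Q[of z] c by (simp add: vec_eq_iff forall_2)
    then show ?thesis by auto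
  qed
qed

lemma null_real_zeros_entire:
  assumes hol: "f holomorphic_on UNIV" and ne: "f z0 \<noteq> 0"
  shows "AE x in lborel. f (complex_of_real x) \<noteq> 0"
proof -
  have "countable {z \<in> UNIV. f z = 0}"
  proof (cases "f constant_on UNIV")
    case True
    then have "{z \<in> UNIV. f z = 0} = {}" using ne by (auto simp: constant_on_def)
    then show ?thesis by simp
  next
    case False
    then show ?thesis by (intro holomorphic_countable_zeros hol) auto
  qed
  then have "countable (complex_of_real ` {x. f (complex_of_real x) = 0})"
    by (rule countable_subset[rotated]) auto
  then have "countable {x. f (complex_of_real x) = 0}"
    by (rule countable_image_inj_on) (simp add: inj_on_def)
  then show ?thesis
    by (intro AE_I'[OF countable_imp_null_set_lborel]) auto
qed

text \<open>
  The function \<open>m_minus H\<close> and the function \<open>- m_plus H\<close> solve the quadratic equation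
  \<open>P w = Q w\<close>, whose coefficients are entire and real on the real line and vanish together only on a
  countable set there. Where the boundary values lie in opposite open half planes, they are a conjugate pair of
  roots, and the real matrix \<open>P x\<close> preserves conjugate pairs.
\<close>

lemma reflectionless_of_two_transfers:
  assumes P: "P \<in> class_S" and Q: "Q \<in> class_S" and neq: "Q \<noteq> P" "Q \<noteq> (\<lambda>z. - P z)"
    and minus: "\<And>z. Im z > 0 \<Longrightarrow> denom (P z) (m_minus H z) \<noteq> 0 \<and> denom (Q z) (m_minus H z) \<noteq> 0 \<and>
        moebius_act (P z) (m_minus H z) = m_minus H' z \<and> moebius_act (Q z) (m_minus H z) = m_minus H' z"
    and plus: "\<And>z. Im z > 0 \<Longrightarrow> denom (P z) (- m_plus H z) \<noteq> 0 \<and> denom (Q z) (- m_plus H z) \<noteq> 0 \<and>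
        moebius_act (P z) (- m_plus H z) = - m_plus H' z \<and> moebius_act (Q z) (- m_plus H z) = - m_plus H' z"
  shows "reflectionless_on H' (Sigma_ac H)"
proof -
  define a where "a = (\<lambda>z. quad_a (P z) (Q z))"
  define b where "b = (\<lambda>z. quad_b (P z) (Q z))"
  define c where "c = (\<lambda>z. quad_c (P z) (Q z))"
  have ent: "(\<lambda>z. P z $ i $ j) holomorphic_on UNIV" "(\<lambda>z. Q z $ i $ j) holomorphic_on UNIV" for i j
    using P Q by (auto simp: class_S_def)
  have hol: "a holomorphic_on UNIV" "b holomorphic_on UNIV" "c holomorphic_on UNIV"
    unfolding a_def b_def c_def quad_a_def quad_b_def quad_c_def by (intro holomorphic_intros ent)+
  have "\<exists>f\<in>{a, b, c}. \<exists>z. f z \<noteq> 0"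
    using eq_or_uminus_if_quad_0[OF P Q] neq unfolding a_def b_def c_def by auto
  then obtain f z0 where f: "f \<in> {a, b, c}" "f z0 \<noteq> 0" by blast
  have "AE x in lborel. f (complex_of_real x) \<noteq> 0"
    using f hol by (intro null_real_zeros_entire) auto
  then show ?thesis
    unfolding reflectionless_on_def
  proof (rule AE_mp, intro AE_I2 impI)
    fix x assume nz: "f (complex_of_real x) \<noteq> 0" and "x \<in> Sigma_ac H"
    then obtain p q where p: "has_boundary_value (m_plus H) x p" "Im p > 0"
      and q: "has_boundary_value (m_minus H) x q" "Im q > 0"
      by (auto simp: Sigma_ac_def)
    have re: "a (of_real x) \<in> \<real>" "b (of_real x) \<in> \<real>" "c (of_real x) \<in> \<real>"
    proof -
      have *: "P (of_real x) $ i $ j \<in> \<real>" "Q (of_real x) $ i $ j \<in> \<real>" for i j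
        using P Q by (auto simp: class_S_def)
      show "a (of_real x) \<in> \<real>" "b (of_real x) \<in> \<real>" "c (of_real x) \<in> \<real>"
        unfolding a_def b_def c_def quad_a_def quad_b_def quad_c_def
        by (intro Reals_add Reals_diff Reals_mult *)+
    qed
    have root: "a (of_real x) * v\<^sup>2 + b (of_real x) * v + c (of_real x) = 0"
      if F: "((\<lambda>y. F (Complex x y)) \<longlongrightarrow> v) (at_right 0)"
        and eq: "\<And>z. Im z > 0 \<Longrightarrow> a z * (F z)\<^sup>2 + b z * F z + c z = 0" for F v
    proof (rule tendsto_unique[OF trivial_limit_at_right_real])
      let ?g = "\<lambda>y. a (Complex x y) * (F (Complex x y))\<^sup>2 + b (Complex x y) * F (Complex x y) + c (Complex x y)"
      show "(?g \<longlongrightarrow> a (of_real x) * v\<^sup>2 + b (of_real x) * v + c (of_real x)) (at_right 0)"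
        by (intro tendsto_intros F boundary_value_tendsto_entire hol)
      have "\<forall>\<^sub>F y in at_right 0. ?g y = 0"
        using eventually_Complex_uhp[of x] by eventually_elim (rule eq)
      then show "(?g \<longlongrightarrow> 0) (at_right 0)" by (rule tendsto_eventually)
    qed
    have rq: "a (of_real x) * q\<^sup>2 + b (of_real x) * q + c (of_real x) = 0"
      using q(1) unfolding has_boundary_value_def
      by (rule root) (use minus in \<open>auto simp: a_def b_def c_def intro!: quad_eq_0\<close>)
    have rp: "a (of_real x) * (- p)\<^sup>2 + b (of_real x) * (- p) + c (of_real x) = 0"
    proof (rule root[of "\<lambda>z. - m_plus H z"])
      show "((\<lambda>y. - m_plus H (Complex x y)) \<longlongrightarrow> - p) (at_right 0)"
        using p(1) unfolding has_boundary_value_def by (intro tendsto_intros)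
      show "a z * (- m_plus H z)\<^sup>2 + b z * (- m_plus H z) + c z = 0" if "Im z > 0" for z
        unfolding a_def b_def c_def using plus[OF that] by (intro quad_eq_0) auto
    qed
    have e: "- p = cnj q"
      using f(1) nz p(2) q(2) by (intro real_quadratic_roots_cnj[OF re _ rq _ rp]) auto
    define q' where "q' = moebius_act (P (of_real x)) q"
    have "has_boundary_value (m_minus H') x q'"
      unfolding has_boundary_value_def q'_def
    proof (rule Lim_transform_eventually[OF moebius_boundary_value[OF P q(1)]])
      show "\<forall>\<^sub>F y in at_right 0. moebius_act (P (Complex x y)) (m_minus H (Complex x y)) = m_minus H' (Complex x y)"
        using eventually_Complex_uhp[of x] by eventually_elim (use minus in blast)
    qed (use q in auto)
    moreover have "has_boundary_value (m_plus H') x (- cnj q')"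
    proof -
      have "((\<lambda>y. moebius_act (P (Complex x y)) (- m_plus H (Complex x y))) \<longlongrightarrow> moebius_act (P (of_real x)) (- p)) (at_right 0)"
        using p unfolding has_boundary_value_def
        by (intro moebius_boundary_value[OF P, of "\<lambda>z. - m_plus H z"]) (auto simp: has_boundary_value_def intro: tendsto_minus)
      then have lim: "((\<lambda>y. - moebius_act (P (Complex x y)) (- m_plus H (Complex x y))) \<longlongrightarrow> - moebius_act (P (of_real x)) (- p)) (at_right 0)"
        by (rule tendsto_minus)
      have "moebius_act (P (of_real x)) (- p) = cnj q'"
        unfolding e q'_def using P by (intro moebius_act_real_cnj) (auto simp: class_S_def)
      moreover have "\<forall>\<^sub>F y in at_right 0.
          - moebius_act (P (Complex x y)) (- m_plus H (Complex x y)) = m_plus H' (Complex x y)"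
        using eventually_Complex_uhp[of x]
      proof eventually_elim
        case (elim y)
        then show ?case using plus[of "Complex x y"] by simp
      qed
      ultimately show ?thesis
        unfolding has_boundary_value_def using Lim_transform_eventually[OF lim] by simp
    qed
    ultimately show "\<exists>p q. has_boundary_value (m_plus H') x p \<and> has_boundary_value (m_minus H') x q \<and> p = - cnj q"
      by blast
  qed
qed

section \<open>Boundary values of bounded holomorphic functions\<close>

text \<open>
  \<open>g\<close> and \<open>L * x - g x\<close> are both monotone, and their Stieltjes measures add up to
  \<open>L\<close> times Lebesgue measure.
\<close>

lemma interval_measure_le_lborel:
  fixes g :: "real \<Rightarrow> real"
  assumes mono: "\<And>x y. x \<le> y \<Longrightarrow> g x \<le> g y" and lip: "\<And>x y. x \<le> y \<Longrightarrow> g y - g x \<le> L * (y - x)"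
    and cont: "continuous_on UNIV g" and L: "L \<ge> 0" and A: "A \<in> sets borel"
  shows "emeasure (interval_measure g) A \<le> ennreal L * emeasure lborel A"
proof -
  define h where "h = (\<lambda>x. L * x - g x)"
  define \<mu> where "\<mu> = interval_measure g"
  define \<nu> where "\<nu> = interval_measure h"
  have hmono: "h x \<le> h y" if "x \<le> y" for x y
    using lip[OF that] by (simp add: h_def algebra_simps)
  have gc: "continuous (at_right a) g" for a
    using cont by (simp add: continuous_on_eq_continuous_at continuous_at_imp_continuous_within)
  have hc: "continuous (at_right a) h" for a
    unfolding h_def by (intro continuous_intros gc)
  have sets: "sets \<mu> = sets borel" "sets \<nu> = sets borel" by (simp_all add: \<mu>_def \<nu>_def)
  define N where "N = measure_of UNIV (sets borel) (\<lambda>A. emeasure \<mu> A + emeasure \<nu> A)"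
  have N: "emeasure N A = emeasure \<mu> A + emeasure \<nu> A" if "A \<in> sets borel" for A
    unfolding N_def
  proof (rule emeasure_measure_of_sigma)
    show "sigma_algebra (UNIV :: real set) (sets borel)"
      using sets.sigma_algebra_axioms[of borel] by simp
    show "positive (sets borel) (\<lambda>A. emeasure \<mu> A + emeasure \<nu> A)" by (simp add: positive_def)
    show "countably_additive (sets borel) (\<lambda>A. emeasure \<mu> A + emeasure \<nu> A)"
      unfolding countably_additive_def
    proof (intro allI impI)
      fix B :: "nat \<Rightarrow> real set"
      assume "range B \<subseteq> sets borel" "disjoint_family B"
      then show "(\<Sum>i. emeasure \<mu> (B i) + emeasure \<nu> (B i)) = emeasure \<mu> (\<Union> (range B)) + emeasure \<nu> (\<Union> (range B))"
        by (simp add: suminf_add[symmetric] suminf_emeasure sets)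
    qed
  qed (rule that)
  define E where "E = range (\<lambda>(a, b). {a<..b::real})"
  have Esig: "sets borel = sigma_sets UNIV E"
    unfolding E_def by (subst borel_sigma_sets_Ioc) (simp add: sets_measure_of)
  have "N = density lborel (\<lambda>_. ennreal L)"
  proof (rule measure_eqI_generator_eq[where E = E and \<Omega> = UNIV and A = "\<lambda>n. {- real n<..real n}"])
    show "Int_stable E"
      unfolding E_def Int_stable_def by (auto simp: greaterThanAtMost_def) (metis Int_greaterThanAtMost greaterThanAtMost_def rangeI case_prod_conv)
    show "sets N = sigma_sets UNIV E" "sets (density lborel (\<lambda>_. ennreal L)) = sigma_sets UNIV E"
      using Esig sets.sigma_sets_eq[of "borel :: real measure"] by (simp_all add: N_def)
    show "emeasure N X = emeasure (density lborel (\<lambda>_. ennreal L)) X" if "X \<in> E" for X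
    proof -
      obtain a b where X: "X = {a<..b}" using \<open>X \<in> E\<close> by (auto simp: E_def)
      show ?thesis
      proof (cases "a \<le> b")
        case True
        have "emeasure N X = ennreal (g b - g a) + ennreal (h b - h a)"
          using True mono hmono gc hc by (simp add: N X \<mu>_def \<nu>_def emeasure_interval_measure_Ioc)
        also have "\<dots> = ennreal (L * (b - a))"
          using mono[OF True] hmono[OF True] by (subst ennreal_plus[symmetric]) (auto simp: h_def algebra_simps)
        also have "\<dots> = emeasure (density lborel (\<lambda>_. ennreal L)) X"
          using True L by (simp add: X emeasure_density_const ennreal_mult)
        finally show ?thesis .
      next
        case False then show ?thesis by (simp add: X N)
      qed
    qed
    show "range (\<lambda>n. {- real n<..real n}) \<subseteq> E" by (auto simp: E_def)
    show "(\<Union>n. {- real n<..real n}) = UNIV"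
    proof (intro equalityI subsetI)
      fix x :: real
      obtain n where "\<bar>x\<bar> < real n" using reals_Archimedean2 by blast
      then show "x \<in> (\<Union>n. {- real n<..real n})" by (intro UN_I[of n]) auto
    qed simp
    show "emeasure N {- real n<..real n} \<noteq> \<infinity>" for n
      using mono hmono gc hc by (simp add: N \<mu>_def \<nu>_def emeasure_interval_measure_Ioc)
  qed (auto simp: E_def)
  then have "emeasure \<mu> A + emeasure \<nu> A = ennreal L * emeasure lborel A"
    using N[OF A] A by (simp add: emeasure_density_const)
  then show ?thesis unfolding \<mu>_def by (metis le_iff_add)
qed

text \<open>
  By the previous lemma the Stieltjes measure of \<open>g\<close> has a density, so \<open>g\<close> is an
  indefinite integral, and the Lebesgue differentiation theorem applies. One-sided derivatives are all that the
  blow-up argument below needs.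
\<close>

lemma lipschitz_mono_right_derivative:
  fixes g :: "real \<Rightarrow> real"
  assumes mono: "\<And>x y. x \<le> y \<Longrightarrow> g x \<le> g y" and lip: "\<And>x y. x \<le> y \<Longrightarrow> g y - g x \<le> L * (y - x)"
    and cont: "continuous_on UNIV g" and L: "L \<ge> 0"
  shows "AE x in lborel. \<exists>D. ((\<lambda>h. (g (x + h) - g x) / h) \<longlongrightarrow> D) (at_right 0)"
proof -
  let ?\<mu> = "interval_measure g"
  have gc: "continuous (at_right a) g" for a
    using cont by (simp add: continuous_on_eq_continuous_at continuous_at_imp_continuous_within)
  have "absolutely_continuous lborel ?\<mu>"
    unfolding absolutely_continuous_def
  proof
    fix A assume "A \<in> null_sets (lborel :: real measure)"
    then have A: "A \<in> sets borel" "emeasure lborel A = 0" by auto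
    then have "emeasure ?\<mu> A \<le> 0"
      using interval_measure_le_lborel[OF mono lip cont L A(1)] by simp
    then show "A \<in> null_sets ?\<mu>" using A(1) by auto
  qed
  then obtain f where f: "f \<in> borel_measurable lborel" and dens: "density lborel f = ?\<mu>"
    using sigma_finite_measure.Radon_Nikodym[OF sigma_finite_lborel, of ?\<mu>] by auto
  have [measurable]: "f \<in> borel_measurable borel" using f by simp
  have nn: "(\<integral>\<^sup>+x. f x * indicator {a<..b} x \<partial>lborel) = ennreal (g b - g a)" if "a \<le> b" for a b
  proof -
    have "emeasure ?\<mu> {a<..b} = (\<integral>\<^sup>+x. f x * indicator {a<..b} x \<partial>lborel)"
      unfolding dens[symmetric] by (rule emeasure_density) auto
    then show ?thesis using emeasure_interval_measure_Ioc[OF that mono gc] by simp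
  qed
  have fin: "AE x in lborel. f x \<noteq> \<infinity>"
  proof -
    have "AE x in lborel. x \<in> {- real n<..real n} \<longrightarrow> f x \<noteq> \<infinity>" for n
    proof -
      have "(\<integral>\<^sup>+x. f x * indicator {- real n<..real n} x \<partial>lborel) \<noteq> \<infinity>" by (subst nn) auto
      then have "AE x in lborel. f x * indicator {- real n<..real n} x \<noteq> \<infinity>"
        by (intro nn_integral_PInf_AE) auto
      then show ?thesis by eventually_elim (auto simp: indicator_def)
    qed
    then have "AE x in lborel. \<forall>n. x \<in> {- real n<..real n} \<longrightarrow> f x \<noteq> \<infinity>"
      by (subst AE_all_countable) blast
    then show ?thesis
    proof eventually_elim
      case (elim x)
      obtain n where "\<bar>x\<bar> < real n" using reals_Archimedean2 by blast
      then have "x \<in> {- real n<..real n}" by auto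
      then show ?case using elim by blast
    qed
  qed
  define \<phi> where "\<phi> = (\<lambda>x. enn2real (f x))"
  have [measurable]: "\<phi> \<in> borel_measurable borel" unfolding \<phi>_def by measurable
  have int: "(\<phi> has_integral (g b - g a)) {a..b}" if ab: "a \<le> b" for a b
  proof -
    have "(\<integral>\<^sup>+x. ennreal (\<phi> x * indicator {a<..b} x) \<partial>lborel) = (\<integral>\<^sup>+x. f x * indicator {a<..b} x \<partial>lborel)"
    proof (rule nn_integral_cong_AE)
      show "AE x in lborel. ennreal (\<phi> x * indicator {a<..b} x) = f x * indicator {a<..b} x"
        using fin by eventually_elim (auto simp: \<phi>_def indicator_def less_top)
    qed
    also have "\<dots> = ennreal (g b - g a)" by (rule nn[OF ab])
    finally have "((\<lambda>x. \<phi> x * indicator {a<..b} x) has_integral (g b - g a)) UNIV"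
      by (intro nn_integral_has_integral) (auto simp: \<phi>_def mono[OF ab])
    moreover have "(\<lambda>x. \<phi> x * indicator {a<..b} x) = (\<lambda>x. if x \<in> {a<..b} then \<phi> x else 0)"
      by (auto simp: indicator_def)
    ultimately have "(\<phi> has_integral (g b - g a)) {a<..b}"
      by (simp only: has_integral_restrict_UNIV)
    moreover have "negligible {x \<in> {a<..b} - {a..b}. \<phi> x \<noteq> 0}" "negligible {x \<in> {a..b} - {a<..b}. \<phi> x \<noteq> 0}"
      by (rule negligible_subset[of "{a}"]; auto)+
    ultimately show ?thesis using has_integral_spike_set_eq by blast
  qed
  have "\<phi> integrable_on cbox a b" for a b
  proof (cases "a \<le> b")
    case True then show ?thesis using int[OF True] by (auto simp: integrable_on_def)
  qed (simp add: integrable_on_empty)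
  then obtain N where N: "negligible N" and
    lim: "\<And>x e. \<lbrakk>x \<notin> N; 0 < e\<rbrakk> \<Longrightarrow>
         \<exists>d>0. \<forall>h. 0 < h \<and> h < d \<longrightarrow>
            norm (integral (cbox x (x + h *\<^sub>R One)) \<phi> /\<^sub>R h ^ DIM(real) - \<phi> x) < e"
    using integrable_ccontinuous_explicit[of \<phi>] by blast
  have "((\<lambda>h. (g (x + h) - g x) / h) \<longlongrightarrow> \<phi> x) (at_right 0)" if x: "x \<notin> N" for x
  proof (rule tendstoI)
    fix e :: real assume e: "e > 0"
    obtain d where d: "d > 0" and
      *: "\<And>h. 0 < h \<Longrightarrow> h < d \<Longrightarrow> norm (integral (cbox x (x + h *\<^sub>R One)) \<phi> /\<^sub>R h ^ DIM(real) - \<phi> x) < e"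
      using lim[OF x e] by blast
    have "\<forall>\<^sub>F h in at_right 0. 0 < h \<and> h < d"
      using d by (intro eventually_conj eventually_at_right_less) (auto intro: eventually_at_rightI)
    then show "\<forall>\<^sub>F h in at_right 0. dist ((g (x + h) - g x) / h) (\<phi> x) < e"
    proof eventually_elim
      case (elim h)
      have "integral (cbox x (x + h *\<^sub>R One)) \<phi> = g (x + h) - g x"
        using int[of x "x + h"] elim by (intro integral_unique) simp
      then show ?case using *[of h] elim by (simp add: dist_norm divide_inverse mult.commute)
    qed
  qed
  moreover have "AE x in lebesgue. x \<notin> N"
    using N by (intro AE_I'[of N]) (auto simp: negligible_iff_null_sets)
  then have "AE x in lborel. x \<notin> N"
    by (simp add: AE_completion_iff)
  ultimately show ?thesis by (auto elim: eventually_mono)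
qed

lemma lipschitz_right_derivative:
  fixes g :: "real \<Rightarrow> complex"
  assumes lip: "\<And>x y. norm (g x - g y) \<le> C * \<bar>x - y\<bar>"
  shows "AE x in lborel. \<exists>D. ((\<lambda>h. (g (x + h) - g x) / of_real h) \<longlongrightarrow> D) (at_right 0)"
proof -
  have C: "C \<ge> 0" using order_trans[OF norm_ge_zero lip[of 1 0]] by simp
  have "C-lipschitz_on UNIV g"
    using lip C by (intro lipschitz_onI) (auto simp: dist_norm)
  then have contg: "continuous_on UNIV g" by (rule lipschitz_on_continuous_on)
  have real: "AE x in lborel. \<exists>D. ((\<lambda>h. (k (x + h) - k x) / h) \<longlongrightarrow> D) (at_right 0)"
    if klip: "\<And>x y. \<bar>k x - k y\<bar> \<le> C * \<bar>x - y\<bar>" and kc: "continuous_on UNIV k" for k :: "real \<Rightarrow> real"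
  proof -
    \<comment> \<open>adding \<open>C * x\<close> makes a function with Lipschitz constant \<open>C\<close> monotone\<close>
    have "AE x in lborel. \<exists>D. ((\<lambda>h. ((k (x + h) + C * (x + h)) - (k x + C * x)) / h) \<longlongrightarrow> D) (at_right 0)"
    proof (rule lipschitz_mono_right_derivative[where g = "\<lambda>x. k x + C * x" and L = "2 * C"])
      fix x y :: real assume xy: "x \<le> y"
      have "C * \<bar>x - y\<bar> = C * y - C * x" using xy by (simp add: algebra_simps)
      then show "k x + C * x \<le> k y + C * y" "(k y + C * y) - (k x + C * x) \<le> 2 * C * (y - x)"
        using klip[of x y] by (auto simp: algebra_simps abs_le_iff)
    qed (use C kc in \<open>auto intro!: continuous_intros\<close>)
    then show ?thesis
    proof eventually_elim
      case (elim x)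
      then obtain D where D: "((\<lambda>h. ((k (x + h) + C * (x + h)) - (k x + C * x)) / h) \<longlongrightarrow> D) (at_right 0)" by blast
      have "((\<lambda>h. (k (x + h) - k x) / h) \<longlongrightarrow> D - C) (at_right 0)"
      proof (rule Lim_transform_eventually[OF tendsto_diff[OF D tendsto_const[of C]]])
        show "\<forall>\<^sub>F h in at_right 0. ((k (x + h) + C * (x + h)) - (k x + C * x)) / h - C = (k (x + h) - k x) / h"
          using eventually_at_right_less[of 0] by eventually_elim (simp add: field_simps)
      qed
      then show ?case by blast
    qed
  qed
  have "AE x in lborel. \<exists>D. ((\<lambda>h. (Re (g (x + h)) - Re (g x)) / h) \<longlongrightarrow> D) (at_right 0)"
  proof (rule real)
    show "\<bar>Re (g x) - Re (g y)\<bar> \<le> C * \<bar>x - y\<bar>" for x y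
      using abs_Re_le_cmod[of "g x - g y"] lip[of x y] by simp
  qed (intro continuous_intros contg)
  moreover have "AE x in lborel. \<exists>D. ((\<lambda>h. (Im (g (x + h)) - Im (g x)) / h) \<longlongrightarrow> D) (at_right 0)"
  proof (rule real)
    show "\<bar>Im (g x) - Im (g y)\<bar> \<le> C * \<bar>x - y\<bar>" for x y
      using abs_Im_le_cmod[of "g x - g y"] lip[of x y] by simp
  qed (intro continuous_intros contg)
  ultimately show ?thesis
  proof eventually_elim
    case (elim x)
    then obtain D D' where D: "((\<lambda>h. (Re (g (x + h)) - Re (g x)) / h) \<longlongrightarrow> D) (at_right 0)"
      "((\<lambda>h. (Im (g (x + h)) - Im (g x)) / h) \<longlongrightarrow> D') (at_right 0)" by blast
    have "((\<lambda>h. Complex ((Re (g (x + h)) - Re (g x)) / h) ((Im (g (x + h)) - Im (g x)) / h)) \<longlongrightarrow> Complex D D') (at_right 0)"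
      by (intro tendsto_Complex D)
    moreover have "Complex ((Re (g (x + h)) - Re (g x)) / h) ((Im (g (x + h)) - Im (g x)) / h) = (g (x + h) - g x) / of_real h" for h
      by (simp add: complex_eq_iff Re_divide_of_real Im_divide_of_real)
    ultimately show ?case by auto
  qed
qed

text \<open>
  Extended by 0 to the lower half plane, \<open>K\<close> is continuous across the positive real axis, hence
  holomorphic there, hence 0.
\<close>

lemma vanishing_boundary_imp_zero:
  assumes hol: "K holomorphic_on upper_half_plane"
    and small: "\<And>z. Re z > 0 \<Longrightarrow> Im z > 0 \<Longrightarrow> norm (K z) \<le> C * Im z" and z: "Im z > 0"
  shows "K z = 0"
proof -
  define S where "S = {z::complex. Re z > 0}"
  define F where "F = (\<lambda>z. if Im z > 0 then K z else 0)"
  have openS: "open S" by (simp add: S_def open_halfspace_Re_gt)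
  have inS: "\<i> \<bullet> z = Im z" for z by (simp add: inner_complex_def)
  have up: "F holomorphic_on {z. 0 < Im z}"
    by (rule holomorphic_transform[of K]) (use hol in \<open>auto simp: F_def upper_half_plane_def\<close>)
  have down: "F holomorphic_on {z. Im z < 0}"
    by (rule holomorphic_transform[of "\<lambda>_. 0"]) (auto simp: F_def)
  have "F holomorphic_on S"
  proof (rule holomorphic_on_paste_across_line[OF openS, of "\<i>" F 0])
    show "F holomorphic_on S \<inter> {z. \<i> \<bullet> z < 0}" "F holomorphic_on S \<inter> {z. 0 < \<i> \<bullet> z}"
      unfolding inS by (auto intro: holomorphic_on_subset[OF down] holomorphic_on_subset[OF up])
    show "continuous_on S F"
      unfolding continuous_on_eq_continuous_at[OF openS]
    proof
      fix w assume w: "w \<in> S"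
      consider "Im w > 0" | "Im w < 0" | "Im w = 0" by linarith
      then show "isCont F w"
      proof cases
        case 1
        then show ?thesis
          using holomorphic_on_imp_continuous_on[OF up]
          by (subst (asm) continuous_on_eq_continuous_at) (auto simp: open_halfspace_Im_gt)
      next
        case 2
        then show ?thesis
          using holomorphic_on_imp_continuous_on[OF down]
          by (subst (asm) continuous_on_eq_continuous_at) (auto simp: open_halfspace_Im_lt)
      next
        case 3
        have "((\<lambda>u. \<bar>C\<bar> * \<bar>Im u\<bar>) \<longlongrightarrow> \<bar>C\<bar> * \<bar>Im w\<bar>) (at w)" by (intro tendsto_intros)
        then have lim: "((\<lambda>u. \<bar>C\<bar> * \<bar>Im u\<bar>) \<longlongrightarrow> 0) (at w)" using 3 by simp
        have "\<forall>\<^sub>F u in at w. u \<in> S" using w openS by (intro eventually_at_in_open')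
        then have "\<forall>\<^sub>F u in at w. norm (F u) \<le> \<bar>C\<bar> * \<bar>Im u\<bar>"
        proof eventually_elim
          case (elim u)
          have *: "C * Im u \<le> \<bar>C\<bar> * \<bar>Im u\<bar>" using abs_ge_self[of "C * Im u"] by (simp only: abs_mult)
          show ?case
          proof (cases "Im u > 0")
            case True
            then show ?thesis using order_trans[OF small *] elim by (simp add: F_def S_def)
          next
            case False
            then have "norm (F u) = 0" by (simp add: F_def)
            then show ?thesis by (metis abs_ge_zero mult_nonneg_nonneg)
          qed
        qed
        then have "(F \<longlongrightarrow> 0) (at w)" using lim by (rule Lim_null_comparison)
        then show ?thesis using 3 by (simp add: isCont_def F_def)
      qed
    qed
  qed simp
  moreover have "connected S" unfolding S_def by (intro convex_connected convex_halfspace_Re_gt)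
  moreover have lim: "Complex 1 y islimpt {z. Re z > 0 \<and> Im z * s > 0}" if "y * s > 0" for y s
  proof -
    have "open {z. Re z > 0 \<and> Im z * s > 0}"
      by (intro open_Collect_conj open_Collect_less continuous_intros)
    then show ?thesis using that by (intro interior_limit_point) (simp add: interior_open)
  qed
  ultimately have FS: "F u = 0" if "u \<in> S" for u
  proof (intro analytic_continuation[of F S "{z. Re z > 0 \<and> Im z * (-1) > 0}" "Complex 1 (-1)" u])
    show "Complex 1 (-1) islimpt {z. Re z > 0 \<and> Im z * (-1) > 0}" by (rule lim) simp
    show "F v = 0" if "v \<in> {z. Re z > 0 \<and> Im z * (-1) > 0}" for v using that by (simp add: F_def)
  qed (use openS that in \<open>auto simp: S_def\<close>)
  show ?thesis
  proof (rule analytic_continuation[of K upper_half_plane "{z. Re z > 0 \<and> Im z * 1 > 0}" "Complex 1 1" z])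
    show "K u = 0" if "u \<in> {z. Re z > 0 \<and> Im z * 1 > 0}" for u
      using FS[of u] that by (simp add: S_def F_def)
  qed (use hol open_uhp convex_uhp convex_connected lim[of 1 1] z in \<open>auto\<close>)
qed

text \<open>
  Blow-up at \<open>x\<close>: the rescaled functions \<open>(G (x + y z) - G x) / y\<close> are uniformly
  Lipschitz, and on the positive real axis they tend to \<open>D * z\<close> as \<open>y \<rightarrow> 0\<close>.
  A locally uniform limit differs from \<open>D * z\<close> by a function with vanishing boundary values, so it
  equals \<open>D * z\<close>. The derivatives of the rescaled functions at \<open>\<i>\<close> are the values
  \<open>f (x + \<i> y)\<close>.
\<close>

lemma scaled_derivative_limit:
  assumes hol: "f holomorphic_on upper_half_plane"
    and G: "\<And>z. Im z > 0 \<Longrightarrow> (G has_field_derivative f z) (at z)"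
    and lip: "\<And>z w. Im z \<ge> 0 \<Longrightarrow> Im w \<ge> 0 \<Longrightarrow> norm (G z - G w) \<le> C * norm (z - w)"
    and D: "((\<lambda>h. (G (of_real (x + h)) - G (of_real x)) / of_real h) \<longlongrightarrow> D) (at_right 0)"
    and y: "\<And>n. y n > 0" "y \<longlonglongrightarrow> 0"
  shows "\<exists>r. strict_mono (r :: nat \<Rightarrow> nat) \<and> (\<lambda>n. f (Complex x (y (r n)))) \<longlonglongrightarrow> D"
proof -
  define p where "p = (\<lambda>n (z::complex). of_real x + of_real (y n) * z)"
  define Gn where "Gn = (\<lambda>n z. (G (p n z) - G (of_real x)) / of_real (y n))"
  have C: "C \<ge> 0" using order_trans[OF norm_ge_zero lip[of 1 0]] by simp
  have Imp: "Im (p n z) = y n * Im z" for n z by (simp add: p_def)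
  have der: "(Gn n has_field_derivative f (p n z)) (at z)" if "Im z > 0" for n z
  proof -
    have "(G has_field_derivative f (p n z)) (at (p n z))" using that y(1)[of n] by (intro G) (simp add: Imp)
    moreover have "(p n has_field_derivative of_real (y n)) (at z)"
      unfolding p_def by (auto intro!: derivative_eq_intros)
    ultimately have "((\<lambda>z. G (p n z)) has_field_derivative f (p n z) * of_real (y n)) (at z)"
      by (rule DERIV_chain2)
    then have "((\<lambda>z. G (p n z) - G (of_real x)) has_field_derivative f (p n z) * of_real (y n) - 0) (at z)"
      by (intro DERIV_diff DERIV_const)
    then have "(Gn n has_field_derivative (f (p n z) * of_real (y n) - 0) / of_real (y n)) (at z)"
      unfolding Gn_def by (rule DERIV_cdivide)
    then show ?thesis using y(1)[of n] by simp
  qed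
  have Gn_lip: "norm (Gn n z - Gn n w) \<le> C * norm (z - w)" if "Im z \<ge> 0" "Im w \<ge> 0" for n z w
  proof -
    have "norm (G (p n z) - G (p n w)) \<le> C * norm (p n z - p n w)"
      using that y(1)[of n] by (intro lip) (simp_all add: Imp)
    also have "p n z - p n w = of_real (y n) * (z - w)" by (simp add: p_def algebra_simps)
    also have "norm (of_real (y n) * (z - w)) = y n * norm (z - w)"
      by (simp only: norm_mult norm_of_real abs_of_pos[OF y(1)])
    finally have "norm (G (p n z) - G (p n w)) / y n \<le> C * (y n * norm (z - w)) / y n"
      by (rule divide_right_mono) (use y(1)[of n] in simp)
    also have "\<dots> = C * norm (z - w)" using y(1)[of n] by simp
    finally have "norm (G (p n z) - G (p n w)) / y n \<le> C * norm (z - w)" .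
    moreover have "Gn n z - Gn n w = (G (p n z) - G (p n w)) / of_real (y n)"
      by (simp add: Gn_def diff_divide_distrib)
    moreover have "norm (of_real (y n) :: complex) = y n" using y(1)[of n] by simp
    ultimately show ?thesis by (simp only: norm_divide)
  qed
  have Gn0: "Gn n 0 = 0" for n by (simp add: Gn_def p_def)
  have Gn_hol: "Gn n holomorphic_on upper_half_plane" for n
    unfolding holomorphic_on_open[OF open_uhp]
  proof
    fix z assume "z \<in> upper_half_plane"
    then have "Im z > 0" by simp
    then show "\<exists>f'. (Gn n has_field_derivative f') (at z)" by (intro exI[of _ "f (p n z)"] der)
  qed
  have Gn_bd: "\<exists>B. \<forall>h\<in>range Gn. \<forall>z\<in>K. norm (h z) \<le> B"
    if K: "compact K" "K \<subseteq> upper_half_plane" for K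
  proof -
    obtain c where c: "\<And>z. z \<in> K \<Longrightarrow> norm z \<le> c"
      using compact_imp_bounded[OF K(1)] by (auto simp: bounded_iff)
    have "norm (Gn n z) \<le> C * c" if "z \<in> K" for n z
    proof -
      have "z \<in> upper_half_plane" using that K(2) by (rule subsetD[rotated])
      then have "Im z \<ge> 0" by simp
      then have "norm (Gn n z) \<le> C * norm z" using Gn_lip[of z 0 n] by (simp add: Gn0)
      also have "\<dots> \<le> C * c" using c[OF that] C by (rule mult_left_mono)
      finally show ?thesis .
    qed
    then show ?thesis by (intro exI[of _ "C * c"]) auto
  qed
  have Gn_hol': "h holomorphic_on upper_half_plane" if "h \<in> range Gn" for h
    using that by (rule rangeE) (simp only: Gn_hol)
  obtain G0 r where G0: "G0 holomorphic_on upper_half_plane" and r: "strict_mono (r :: nat \<Rightarrow> nat)"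
    and pt: "\<And>z. z \<in> upper_half_plane \<Longrightarrow> (\<lambda>n. Gn (r n) z) \<longlonglongrightarrow> G0 z"
    and ul: "\<And>K. \<lbrakk>compact K; K \<subseteq> upper_half_plane\<rbrakk> \<Longrightarrow> uniform_limit K (Gn \<circ> r) G0 sequentially"
    by (rule Montel[OF open_uhp Gn_hol' Gn_bd order_refl]) (assumption | rule that)+
  have yr: "(\<lambda>n. y (r n)) \<longlonglongrightarrow> 0" using LIMSEQ_subseq_LIMSEQ[OF y(2) r] by (simp add: o_def)
  have bdry: "(\<lambda>n. Gn (r n) (of_real t)) \<longlonglongrightarrow> D * of_real t" if t: "t > 0" for t
  proof -
    have "(\<lambda>n. y (r n) * t) \<longlonglongrightarrow> 0 * t" by (intro tendsto_intros yr)
    then have "filterlim (\<lambda>n. y (r n) * t) (at_right 0) sequentially"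
      using y(1) t by (intro tendsto_imp_filterlim_at_right) auto
    then have "(\<lambda>n. (G (of_real (x + y (r n) * t)) - G (of_real x)) / of_real (y (r n) * t)) \<longlonglongrightarrow> D"
      by (rule filterlim_compose[OF D])
    then have "(\<lambda>n. (G (of_real (x + y (r n) * t)) - G (of_real x)) / of_real (y (r n) * t) * of_real t) \<longlonglongrightarrow> D * of_real t"
      by (intro tendsto_intros)
    moreover have "(G (of_real (x + y (r n) * t)) - G (of_real x)) / of_real (y (r n) * t) * of_real t = Gn (r n) (of_real t)" for n
      using y(1)[of "r n"] t by (simp add: Gn_def p_def)
    ultimately show ?thesis by simp
  qed
  have G0_zero: "G0 z - D * z = 0" if z: "Im z > 0" for z
  proof (rule vanishing_boundary_imp_zero[of "\<lambda>z. G0 z - D * z" "C + norm D", OF _ _ z])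
    show "(\<lambda>z. G0 z - D * z) holomorphic_on upper_half_plane" by (intro holomorphic_intros G0)
    fix w assume w: "Re w > 0" "Im w > 0"
    let ?t = "Re w"
    have wt: "norm (w - of_real ?t) = Im w"
      using w by (simp add: cmod_def)
    have "norm (G0 w - D * of_real ?t) \<le> C * Im w"
    proof (rule LIMSEQ_le_const2)
      show "(\<lambda>n. norm (Gn (r n) w - Gn (r n) (of_real ?t))) \<longlonglongrightarrow> norm (G0 w - D * of_real ?t)"
        using w by (intro tendsto_intros pt bdry) auto
      show "\<exists>N. \<forall>n\<ge>N. norm (Gn (r n) w - Gn (r n) (of_real ?t)) \<le> C * Im w"
        using Gn_lip[of w "of_real ?t"] w unfolding wt by simp
    qed
    moreover have "norm (D * of_real ?t - D * w) = norm D * Im w"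
    proof -
      have "D * of_real ?t - D * w = - (D * (w - of_real ?t))" by (simp add: algebra_simps)
      then show ?thesis using wt by (simp only: norm_minus_cancel norm_mult)
    qed
    ultimately show "norm (G0 w - D * w) \<le> (C + norm D) * Im w"
      using norm_triangle_ineq[of "G0 w - D * of_real ?t" "D * of_real ?t - D * w"]
      by (simp add: distrib_right)
  qed
  have G0: "G0 z = D * z" if "Im z > 0" for z using G0_zero[OF that] by simp
  have "(\<lambda>n. deriv ((Gn \<circ> r) n) \<i>) \<longlonglongrightarrow> deriv G0 \<i>"
  proof (rule deriv_complex_uniform_limit[where A = "ball \<i> (1/2)"])
    have sub: "cball \<i> (1/2) \<subseteq> upper_half_plane"
    proof
      fix z assume "z \<in> cball \<i> (1/2)"
      then have "\<bar>Im (\<i> - z)\<bar> \<le> 1/2" using abs_Im_le_cmod[of "\<i> - z"] by (simp add: dist_norm)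
      then have "Im (\<i> - z) \<le> 1/2" by linarith
      then show "z \<in> upper_half_plane" by simp
    qed
    show "uniform_limit (ball \<i> (1/2)) (Gn \<circ> r) G0 sequentially"
      by (rule uniform_limit_on_subset[OF ul[OF compact_cball sub] ball_subset_cball])
    have "(Gn \<circ> r) n holomorphic_on ball \<i> (1/2)" for n
      unfolding o_def by (rule holomorphic_on_subset[OF Gn_hol order_trans[OF ball_subset_cball sub]])
    then show "\<forall>\<^sub>F n in sequentially. (Gn \<circ> r) n holomorphic_on ball \<i> (1/2)" by simp
  qed auto
  moreover have "deriv ((Gn \<circ> r) n) \<i> = f (Complex x (y (r n)))" for n
  proof -
    have "p (r n) \<i> = Complex x (y (r n))" by (simp add: p_def complex_eq_iff)
    then show ?thesis using DERIV_imp_deriv[OF der[of \<i> "r n"]] by simp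
  qed
  moreover have "deriv G0 \<i> = D"
  proof (rule DERIV_imp_deriv)
    have "((\<lambda>z. D * z) has_field_derivative D) (at \<i>)" by (auto intro!: derivative_eq_intros)
    then show "(G0 has_field_derivative D) (at \<i>)"
      by (rule has_field_derivative_transform_within_open[OF _ open_uhp]) (auto simp: G0)
  qed
  ultimately show ?thesis using r by auto
qed

text \<open>
  Fatou's theorem for vertical limits. A primitive \<open>G\<close> of \<open>f\<close> is Lipschitz, so it
  extends to the real line, has a right derivative at almost every \<open>x\<close> there, and at each such point
  the blow-up argument identifies this derivative as the boundary value of \<open>f\<close>.
\<close>

theorem fatou_boundary_values:
  assumes hol: "f holomorphic_on upper_half_plane" and bd: "\<And>z. Im z > 0 \<Longrightarrow> norm (f z) \<le> C"
  shows "AE x in lborel. \<exists>w. has_boundary_value f x w"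
proof -
  have C: "C \<ge> 0" using order_trans[OF norm_ge_zero bd[of \<i>]] by simp
  obtain g where g: "\<And>z. z \<in> upper_half_plane \<Longrightarrow> (g has_field_derivative f z) (at z within upper_half_plane)"
    using holomorphic_convex_primitive'[OF convex_uhp open_uhp hol] by blast
  have "C-lipschitz_on upper_half_plane g"
  proof (rule lipschitz_onI)
    show "dist (g z) (g w) \<le> C * dist z w" if "z \<in> upper_half_plane" "w \<in> upper_half_plane" for z w
      unfolding dist_norm using that bd
      by (intro field_differentiable_bound[OF convex_uhp g]) auto
  qed (rule C)
  then obtain G where Glip: "C-lipschitz_on (closure upper_half_plane) G" and Gg: "\<And>z. z \<in> upper_half_plane \<Longrightarrow> G z = g z"
    using lipschitz_extend_closure by blast
  have cl: "z \<in> closure upper_half_plane" if "Im z \<ge> 0" for z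
  proof -
    have "(\<lambda>n. z + \<i> * of_real (inverse (real (Suc n)))) \<longlonglongrightarrow> z + \<i> * of_real 0"
      by (intro tendsto_intros LIMSEQ_inverse_real_of_nat)
    moreover have "z + \<i> * of_real (inverse (real (Suc n))) \<in> upper_half_plane" for n
    proof -
      have "0 < inverse (real (Suc n))" by simp
      then have "0 < Im z + inverse (real (Suc n))" using that by linarith
      then show ?thesis by (simp del: of_real_inverse of_nat_Suc)
    qed
    ultimately show ?thesis unfolding closure_sequential
      by (intro exI[of _ "\<lambda>n. z + \<i> * of_real (inverse (real (Suc n)))"]) simp
  qed
  have lip: "norm (G z - G w) \<le> C * norm (z - w)" if "Im z \<ge> 0" "Im w \<ge> 0" for z w
    using lipschitz_onD[OF Glip cl[OF that(1)] cl[OF that(2)]] by (simp add: dist_norm)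
  have der: "(G has_field_derivative f z) (at z)" if "Im z > 0" for z
  proof (rule has_field_derivative_transform_within_open[OF _ open_uhp])
    show "(g has_field_derivative f z) (at z)"
      using g[of z] that open_uhp by (metis at_within_open in_uhp)
  qed (use that Gg in auto)
  have "AE x in lborel. \<exists>D. ((\<lambda>h. (G (of_real (x + h)) - G (of_real x)) / of_real h) \<longlongrightarrow> D) (at_right 0)"
  proof (rule lipschitz_right_derivative)
    show "norm (G (of_real x) - G (of_real y)) \<le> C * \<bar>x - y\<bar>" for x y :: real
      using lip[of "of_real x" "of_real y"] by (simp flip: of_real_diff)
  qed
  then show ?thesis
  proof eventually_elim
    case (elim x)
    then obtain D where D: "((\<lambda>h. (G (of_real (x + h)) - G (of_real x)) / of_real h) \<longlongrightarrow> D) (at_right 0)" by blast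
    have "((\<lambda>y. f (Complex x y)) \<longlongrightarrow> D) (at_right 0)"
    proof (rule ccontr)
      assume "\<not> ((\<lambda>y. f (Complex x y)) \<longlongrightarrow> D) (at_right 0)"
      then obtain e where e: "e > 0" and ne: "\<not> (\<forall>\<^sub>F y in at_right 0. dist (f (Complex x y)) D < e)"
        unfolding tendsto_iff by blast
      have "\<exists>y. 0 < y \<and> y < inverse (real (Suc n)) \<and> \<not> dist (f (Complex x y)) D < e" for n
      proof (rule ccontr)
        assume "\<not> ?thesis"
        then have "\<And>y. 0 < y \<Longrightarrow> y < inverse (real (Suc n)) \<Longrightarrow> dist (f (Complex x y)) D < e" by blast
        then have "\<forall>\<^sub>F y in at_right 0. dist (f (Complex x y)) D < e"
          by (intro eventually_at_rightI[of 0 "inverse (real (Suc n))"]) auto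
        then show False using ne by contradiction
      qed
      then obtain y where y: "\<And>n. 0 < y n" "\<And>n. y n < inverse (real (Suc n))" "\<And>n. \<not> dist (f (Complex x (y n))) D < e"
        by metis
      have y0: "y \<longlonglongrightarrow> 0"
        by (rule tendsto_sandwich[OF _ _ tendsto_const LIMSEQ_inverse_real_of_nat])
          (use y(1,2) in \<open>auto intro!: always_eventually less_imp_le\<close>)
      then obtain r where "(\<lambda>n. f (Complex x (y (r n)))) \<longlonglongrightarrow> D"
        using scaled_derivative_limit[where y = y, OF hol der lip D y(1) y0] by blast
      then have "\<forall>\<^sub>F n in sequentially. dist (f (Complex x (y (r n)))) D < e" using e by (rule tendstoD)
      then obtain n where "dist (f (Complex x (y (r n)))) D < e"
        using eventually_happens' sequentially_bot by blast
      then show False using y(3) by blast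
    qed
    then show ?case unfolding has_boundary_value_def by blast
  qed
qed

section \<open>Weak convergence of boundary values\<close>

text \<open>
  A total and measurable version of the boundary values: a limit along one fixed sequence of heights, with an
  arbitrary value where it does not exist.
\<close>

definition bv :: "(complex \<Rightarrow> complex) \<Rightarrow> real \<Rightarrow> complex" where
  "bv f x = lim (\<lambda>k. f (Complex x (inverse (real (Suc k)))))"

lemma boundary_value_sequence:
  assumes "has_boundary_value f x w"
  shows "(\<lambda>k. f (Complex x (inverse (real (Suc k))))) \<longlonglongrightarrow> w"
proof -
  have "filterlim (\<lambda>k. inverse (real (Suc k))) (at_right 0) sequentially"
    by (intro tendsto_imp_filterlim_at_right LIMSEQ_inverse_real_of_nat) simp
  then show ?thesis using assms unfolding has_boundary_value_def by (rule filterlim_compose[rotated])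
qed

lemma bv_eq: "has_boundary_value f x w \<Longrightarrow> bv f x = w"
  unfolding bv_def by (intro limI boundary_value_sequence)

lemma has_bv: "\<exists>w. has_boundary_value f x w \<Longrightarrow> has_boundary_value f x (bv f x)"
  using bv_eq by blast

lemma holomorphic_horizontal_continuous:
  assumes "f holomorphic_on upper_half_plane" "y > 0"
  shows "continuous_on S (\<lambda>x. f (Complex x y))"
proof -
  have "continuous_on (range (\<lambda>x. Complex x y)) f"
    using assms by (intro continuous_on_subset[OF holomorphic_on_imp_continuous_on[OF assms(1)]]) auto
  moreover have "continuous_on S (\<lambda>x. Complex x y)"
    unfolding Complex_eq by (intro continuous_intros)
  ultimately show ?thesis by (rule continuous_on_compose2) auto
qed

lemma holomorphic_horizontal_measurable:
  assumes "f holomorphic_on upper_half_plane" "y > 0"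
  shows "(\<lambda>x. f (Complex x y)) \<in> borel_measurable borel"
  by (intro borel_measurable_continuous_onI holomorphic_horizontal_continuous assms)

lemma bv_measurable:
  assumes "f holomorphic_on upper_half_plane"
  shows "bv f \<in> borel_measurable borel"
  unfolding bv_def
  by (intro borel_measurable_lim_metric holomorphic_horizontal_measurable assms) simp

lemma bv_bounded:
  assumes hol: "f holomorphic_on upper_half_plane" and bd: "\<And>z. Im z > 0 \<Longrightarrow> norm (f z) \<le> C"
  shows "AE x in lborel. norm (bv f x) \<le> C"
proof -
  have "AE x in lborel. \<exists>w. has_boundary_value f x w" by (rule fatou_boundary_values[OF hol bd])
  then show ?thesis
  proof eventually_elim
    case (elim x)
    show ?case
    proof (rule LIMSEQ_le_const2[OF tendsto_norm[OF boundary_value_sequence[OF has_bv[OF elim]]]])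
      have "norm (f (Complex x (inverse (real (Suc n))))) \<le> C" for n by (rule bd) simp
      then show "\<exists>N. \<forall>n\<ge>N. norm (f (Complex x (inverse (real (Suc n))))) \<le> C" by blast
    qed
  qed
qed

lemma bounded_set_integrable:
  fixes f :: "real \<Rightarrow> complex"
  assumes "f \<in> borel_measurable borel" "A \<in> sets borel" "emeasure lborel A < \<infinity>" "AE x in lborel. norm (f x) \<le> C"
  shows "set_integrable lborel A f"
  unfolding set_integrable_def using assms(4)
  by (intro integrableI_bounded_set_indicator[where B = C] assms(3)) (use assms(1,2) in auto)

lemma norm_set_integral_le:
  fixes f :: "real \<Rightarrow> complex"
  assumes f: "f \<in> borel_measurable borel" and A: "A \<in> sets borel" "emeasure lborel A < \<infinity>"
    and bd: "AE x in lborel. x \<in> A \<longrightarrow> norm (f x) \<le> C"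
  shows "norm (LINT x:A|lborel. f x) \<le> C * measure lborel A"
proof -
  have int: "integrable lborel (\<lambda>x. indicator A x *\<^sub>R f x)"
    by (intro integrableI_bounded_set_indicator[where B = C] bd) (use f A in auto)
  have intC: "integrable lborel (\<lambda>x. indicator A x * C)"
    using A by (intro integrable_mult_left integrable_real_indicator) auto
  have "norm (LINT x:A|lborel. f x) \<le> (LINT x|lborel. norm (indicator A x *\<^sub>R f x))"
    unfolding set_lebesgue_integral_def by (rule integral_norm_bound)
  also have "\<dots> \<le> (LINT x|lborel. indicator A x * C)"
  proof (intro integral_mono_AE integrable_norm int intC)
    show "AE x in lborel. norm (indicator A x *\<^sub>R f x) \<le> indicator A x * C"
      using bd by eventually_elim (simp add: indicator_def)
  qed
  also have "\<dots> = C * measure lborel A" using A by simp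
  finally show ?thesis .
qed

lemma emeasure_bounded_part: "emeasure lborel (E \<inter> {-N..N::real}) < \<infinity>"
proof -
  have "emeasure lborel (E \<inter> {-N..N}) \<le> emeasure lborel {-N..N}" by (rule emeasure_mono) auto
  also have "\<dots> < \<infinity>" by (cases "-N \<le> N") auto
  finally show ?thesis .
qed

text \<open>
  Both integrals are increments of one primitive, which is Lipschitz with constant \<open>C\<close>. The bound is
  uniform over all functions bounded by \<open>C\<close>; this is what allows limits of functions and limits at
  the boundary to be interchanged.
\<close>

lemma horizontal_shift:
  assumes hol: "f holomorphic_on upper_half_plane" and bd: "\<And>z. Im z > 0 \<Longrightarrow> norm (f z) \<le> C"
    and y: "y > 0" "\<eta> > 0" and ab: "a \<le> b"
  shows "norm ((LINT x:{a..b}|lborel. f (Complex x y)) - (LINT x:{a..b}|lborel. f (Complex x \<eta>))) \<le> 2 * C * \<bar>y - \<eta>\<bar>"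
proof -
  obtain g where g: "\<And>z. z \<in> upper_half_plane \<Longrightarrow> (g has_field_derivative f z) (at z within upper_half_plane)"
    using holomorphic_convex_primitive'[OF convex_uhp open_uhp hol] by blast
  have g': "(g has_field_derivative f z) (at z)" if "Im z > 0" for z
    using g[of z] that open_uhp by (metis at_within_open in_uhp)
  have lip: "norm (g z - g w) \<le> C * norm (z - w)" if "Im z > 0" "Im w > 0" for z w
  proof (rule field_differentiable_bound[OF convex_uhp g])
    show "norm (f u) \<le> C" if "u \<in> upper_half_plane" for u using that by (intro bd) simp
  qed (use that in simp_all)
  have ftc: "(LINT x:{a..b}|lborel. f (Complex x t)) = g (Complex b t) - g (Complex a t)" if t: "t > 0" for t
    unfolding set_lebesgue_integral_def
  proof (rule integral_FTC_Icc[OF ab])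
    show "((\<lambda>x. g (Complex x t)) has_vector_derivative f (Complex x t)) (at x within {a..b})" for x
    proof -
      have "(g has_field_derivative f (Complex x t)) (at (of_real x + \<i> * of_real t))"
        unfolding Complex_eq[symmetric] using t by (intro g') simp
      then have "((\<lambda>u. g (u + \<i> * of_real t)) has_field_derivative f (Complex x t)) (at (of_real x))"
        by (simp only: DERIV_shift)
      then have "((\<lambda>u. g (of_real u + \<i> * of_real t)) has_vector_derivative f (Complex x t)) (at x within {a..b})"
        by (rule has_vector_derivative_real_field)
      then show ?thesis by (simp only: Complex_eq[symmetric])
    qed
    show "continuous_on {a..b} (\<lambda>x. f (Complex x t))"
      by (rule holomorphic_horizontal_continuous[OF hol t])
  qed
  have v: "norm (g (Complex u y) - g (Complex u \<eta>)) \<le> C * \<bar>y - \<eta>\<bar>" for u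
  proof -
    have "norm (Complex u y - Complex u \<eta>) = \<bar>y - \<eta>\<bar>" by (simp add: cmod_def)
    then show ?thesis using lip[of "Complex u y" "Complex u \<eta>"] y by simp
  qed
  have "norm ((g (Complex b y) - g (Complex b \<eta>)) - (g (Complex a y) - g (Complex a \<eta>)))
      \<le> C * \<bar>y - \<eta>\<bar> + C * \<bar>y - \<eta>\<bar>"
    by (rule order_trans[OF norm_triangle_ineq4 add_mono[OF v v]])
  moreover have eq: "(g (Complex b y) - g (Complex a y)) - (g (Complex b \<eta>) - g (Complex a \<eta>))
      = (g (Complex b y) - g (Complex b \<eta>)) - (g (Complex a y) - g (Complex a \<eta>))"
    by simp
  ultimately show ?thesis unfolding ftc[OF y(1)] ftc[OF y(2)] eq by linarith
qed

lemma bv_interval_integral: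
  assumes hol: "f holomorphic_on upper_half_plane" and bd: "\<And>z. Im z > 0 \<Longrightarrow> norm (f z) \<le> C"
    and y: "y > 0" and ab: "a \<le> b"
  shows "norm ((LINT x:{a..b}|lborel. f (Complex x y)) - (LINT x:{a..b}|lborel. bv f x)) \<le> 2 * C * y"
proof -
  let ?\<eta> = "\<lambda>k. inverse (real (Suc k))"
  have \<eta>: "?\<eta> k > 0" for k by simp
  have "(\<lambda>k. LINT x:{a..b}|lborel. f (Complex x (?\<eta> k))) \<longlonglongrightarrow> (LINT x:{a..b}|lborel. bv f x)"
    unfolding set_lebesgue_integral_def
  proof (rule integral_dominated_convergence[where w = "\<lambda>x. indicator {a..b} x * C"])
    show "(\<lambda>x. indicator {a..b} x *\<^sub>R bv f x) \<in> borel_measurable lborel"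
      using bv_measurable[OF hol] by simp
    show "(\<lambda>x. indicator {a..b} x *\<^sub>R f (Complex x (?\<eta> k))) \<in> borel_measurable lborel" for k
      using holomorphic_horizontal_measurable[OF hol \<eta>, of k] by simp
    show "integrable lborel (\<lambda>x. indicator {a..b} x * C)"
      using ab by (intro integrable_mult_left integrable_real_indicator) auto
    show "AE x in lborel. (\<lambda>k. indicator {a..b} x *\<^sub>R f (Complex x (?\<eta> k))) \<longlonglongrightarrow> indicator {a..b} x *\<^sub>R bv f x"
    proof -
      have "AE x in lborel. \<exists>w. has_boundary_value f x w" by (rule fatou_boundary_values[OF hol bd])
      then show ?thesis by eventually_elim (intro tendsto_intros boundary_value_sequence has_bv)
    qed
    show "AE x in lborel. norm (indicator {a..b} x *\<^sub>R f (Complex x (?\<eta> k))) \<le> indicator {a..b} x * C" for k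
      by (intro always_eventually allI) (simp add: indicator_def bd)
  qed
  then have 1: "(\<lambda>k. norm ((LINT x:{a..b}|lborel. f (Complex x y)) - (LINT x:{a..b}|lborel. f (Complex x (?\<eta> k)))))
      \<longlonglongrightarrow> norm ((LINT x:{a..b}|lborel. f (Complex x y)) - (LINT x:{a..b}|lborel. bv f x))"
    by (intro tendsto_intros)
  have 2: "(\<lambda>k. 2 * C * \<bar>y - ?\<eta> k\<bar>) \<longlonglongrightarrow> 2 * C * \<bar>y - 0\<bar>"
    by (intro tendsto_intros LIMSEQ_inverse_real_of_nat)
  have "norm ((LINT x:{a..b}|lborel. f (Complex x y)) - (LINT x:{a..b}|lborel. bv f x)) \<le> 2 * C * \<bar>y - 0\<bar>"
    by (rule LIMSEQ_le[OF 1 2]) (use horizontal_shift[OF hol bd y \<eta> ab] in blast)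
  then show ?thesis using y by simp
qed

lemma norm_detour:
  fixes b' b a' a :: complex
  shows "norm (b' - b) \<le> norm (a' - a) + norm (a' - b') + norm (a - b)"
proof -
  have "b' - b = ((a' - a) - (a' - b')) + (a - b)" by simp
  then have "norm (b' - b) \<le> norm ((a' - a) - (a' - b')) + norm (a - b)"
    by (simp only: norm_triangle_ineq)
  also have "\<dots> \<le> (norm (a' - a) + norm (a' - b')) + norm (a - b)"
    by (intro add_right_mono norm_triangle_ineq4)
  finally show ?thesis .
qed

lemma weak_convergence_interval:
  assumes fn: "\<And>n. fn n holomorphic_on upper_half_plane" "\<And>n z. Im z > 0 \<Longrightarrow> norm (fn n z) \<le> C"
    and f: "f holomorphic_on upper_half_plane" "\<And>z. Im z > 0 \<Longrightarrow> norm (f z) \<le> C"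
    and lim: "\<And>z. Im z > 0 \<Longrightarrow> (\<lambda>n. fn n z) \<longlonglongrightarrow> f z" and ab: "a \<le> b"
  shows "(\<lambda>n. LINT x:{a..b}|lborel. bv (fn n) x) \<longlonglongrightarrow> (LINT x:{a..b}|lborel. bv f x)"
proof (rule tendstoI)
  fix e :: real assume e: "e > 0"
  have C: "C \<ge> 0" using order_trans[OF norm_ge_zero f(2)[of \<i>]] by simp
  \<comment> \<open>the height at which the errors from both functions add up to at most \<open>e / 2\<close>\<close>
  define y where "y = e / (8 * (C + 1))"
  have y: "y > 0" using e C by (simp add: y_def)
  have "2 * C * y \<le> 2 * (C + 1) * y" using y C by (intro mult_right_mono) auto
  also have "\<dots> = e / 4" using C by (simp add: y_def field_simps)
  finally have Cy: "2 * C * y \<le> e / 4" .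
  have "(\<lambda>n. LINT x:{a..b}|lborel. fn n (Complex x y)) \<longlonglongrightarrow> (LINT x:{a..b}|lborel. f (Complex x y))"
    unfolding set_lebesgue_integral_def
  proof (rule integral_dominated_convergence[where w = "\<lambda>x. indicator {a..b} x * C"])
    show "(\<lambda>x. indicator {a..b} x *\<^sub>R f (Complex x y)) \<in> borel_measurable lborel"
      using holomorphic_horizontal_measurable[OF f(1) y] by simp
    show "(\<lambda>x. indicator {a..b} x *\<^sub>R fn n (Complex x y)) \<in> borel_measurable lborel" for n
      using holomorphic_horizontal_measurable[OF fn(1) y] by simp
    show "integrable lborel (\<lambda>x. indicator {a..b} x * C)"
      using ab by (intro integrable_mult_left integrable_real_indicator) auto
    show "AE x in lborel. (\<lambda>n. indicator {a..b} x *\<^sub>R fn n (Complex x y)) \<longlonglongrightarrow> indicator {a..b} x *\<^sub>R f (Complex x y)"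
      using y by (intro always_eventually allI tendsto_intros lim) simp
    show "AE x in lborel. norm (indicator {a..b} x *\<^sub>R fn n (Complex x y)) \<le> indicator {a..b} x * C" for n
      using y by (intro always_eventually allI) (simp add: indicator_def fn(2))
  qed
  then have "\<forall>\<^sub>F n in sequentially. dist (LINT x:{a..b}|lborel. fn n (Complex x y)) (LINT x:{a..b}|lborel. f (Complex x y)) < e / 2"
    using e by (intro tendstoD) auto
  then show "\<forall>\<^sub>F n in sequentially. dist (LINT x:{a..b}|lborel. bv (fn n) x) (LINT x:{a..b}|lborel. bv f x) < e"
  proof eventually_elim
    case (elim n)
    have "norm ((LINT x:{a..b}|lborel. fn n (Complex x y)) - (LINT x:{a..b}|lborel. bv (fn n) x)) \<le> e / 4"
      by (rule order_trans[OF bv_interval_integral[OF fn(1) fn(2) y ab] Cy])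
    moreover have "norm ((LINT x:{a..b}|lborel. f (Complex x y)) - (LINT x:{a..b}|lborel. bv f x)) \<le> e / 4"
      by (rule order_trans[OF bv_interval_integral[OF f y ab] Cy])
    moreover note norm_detour[of "LINT x:{a..b}|lborel. bv (fn n) x" "LINT x:{a..b}|lborel. bv f x"
        "LINT x:{a..b}|lborel. fn n (Complex x y)" "LINT x:{a..b}|lborel. f (Complex x y)"]
    ultimately show ?case using elim unfolding dist_norm by linarith
  qed
qed

text \<open>
  For intervals, \<open>bv_interval_integral\<close> moves the integrals up to a fixed height, uniformly in
  \<open>n\<close>, where dominated convergence applies. The passage to Borel sets is Dynkin's theorem; the
  uniform bound \<open>C\<close> lets Tannery's theorem handle countable unions.
\<close>

theorem weak_convergence:
  assumes fn: "\<And>n. fn n holomorphic_on upper_half_plane" "\<And>n z. Im z > 0 \<Longrightarrow> norm (fn n z) \<le> C"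
    and f: "f holomorphic_on upper_half_plane" "\<And>z. Im z > 0 \<Longrightarrow> norm (f z) \<le> C"
    and lim: "\<And>z. Im z > 0 \<Longrightarrow> (\<lambda>n. fn n z) \<longlonglongrightarrow> f z" and N: "N \<ge> 0" and E: "E \<in> sets borel"
  shows "(\<lambda>n. LINT x:E \<inter> {-N..N}|lborel. bv (fn n) x) \<longlonglongrightarrow> (LINT x:E \<inter> {-N..N}|lborel. bv f x)"
proof -
  define I where "I = {-N..N}"
  define G where "G = range (\<lambda>a::real. {..a})"
  have sig: "sets borel = sigma_sets UNIV G"
    unfolding G_def by (subst borel_eq_atMost) (simp add: sets_measure_of)
  have bdI: "emeasure lborel (B \<inter> I) < \<infinity>" for B unfolding I_def by (rule emeasure_bounded_part)
  have Ib: "I \<in> sets borel" by (simp add: I_def)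
  have intn: "set_integrable lborel (B \<inter> I) (bv (fn n))" if "B \<in> sets borel" for B n
    using that Ib by (intro bounded_set_integrable[where C = C] bv_measurable bv_bounded fn bdI) auto
  have int: "set_integrable lborel (B \<inter> I) (bv f)" if "B \<in> sets borel" for B
    using that Ib by (intro bounded_set_integrable[where C = C] bv_measurable bv_bounded f bdI) auto
  have "Int_stable G"
    unfolding Int_stable_def G_def by (auto simp: Int_atMost)
  moreover have "G \<subseteq> Pow UNIV" by simp
  moreover have "E \<in> sigma_sets UNIV G" using E sig by simp
  ultimately have "(\<lambda>n. LINT x:E \<inter> I|lborel. bv (fn n) x) \<longlonglongrightarrow> (LINT x:E \<inter> I|lborel. bv f x)"
  proof (induction E rule: sigma_sets_induct_disjoint)
    case (basic A)
    then obtain a where a: "A = {..a}" by (auto simp: G_def)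
    show ?case
    proof (cases "-N \<le> min a N")
      case True
      have "A \<inter> I = {-N..min a N}" by (auto simp: a I_def)
      then show ?thesis using weak_convergence_interval[OF fn f lim True] by simp
    next
      case False
      then have "A \<inter> I = {}" using N by (auto simp: a I_def)
      then show ?thesis by (simp add: set_lebesgue_integral_def)
    qed
  next
    case empty
    then show ?case by (simp add: set_lebesgue_integral_def)
  next
    case (compl A)
    then have A: "A \<in> sets borel" using sig by simp
    have split: "(LINT x:(UNIV - A) \<inter> I|lborel. h x) = (LINT x:I|lborel. h x) - (LINT x:A \<inter> I|lborel. h x)"
      if "\<And>B. B \<in> sets borel \<Longrightarrow> set_integrable lborel (B \<inter> I) h" for h :: "real \<Rightarrow> complex"
    proof -
      have "I = (UNIV - A) \<inter> I \<union> A \<inter> I" by auto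
      then have "(LINT x:I|lborel. h x) = (LINT x:(UNIV - A) \<inter> I \<union> A \<inter> I|lborel. h x)" by simp
      also have "\<dots> = (LINT x:(UNIV - A) \<inter> I|lborel. h x) + (LINT x:A \<inter> I|lborel. h x)"
        using A by (intro set_integral_Un that) auto
      finally show ?thesis by simp
    qed
    have "(\<lambda>n. LINT x:I|lborel. bv (fn n) x) \<longlonglongrightarrow> (LINT x:I|lborel. bv f x)"
      unfolding I_def using N by (intro weak_convergence_interval[OF fn f lim]) auto
    then have "(\<lambda>n. (LINT x:I|lborel. bv (fn n) x) - (LINT x:A \<inter> I|lborel. bv (fn n) x))
        \<longlonglongrightarrow> (LINT x:I|lborel. bv f x) - (LINT x:A \<inter> I|lborel. bv f x)"
      by (intro tendsto_diff compl.IH)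
    moreover have "(LINT x:(UNIV - A) \<inter> I|lborel. bv (fn n) x)
        = (LINT x:I|lborel. bv (fn n) x) - (LINT x:A \<inter> I|lborel. bv (fn n) x)" for n
      by (rule split, rule intn)
    moreover have "(LINT x:(UNIV - A) \<inter> I|lborel. bv f x) = (LINT x:I|lborel. bv f x) - (LINT x:A \<inter> I|lborel. bv f x)"
      by (rule split, rule int)
    ultimately show ?case by (simp only:)
  next
    case (union A)
    have A: "A i \<in> sets borel" for i using union(2) sig by auto
    have disj: "A i \<inter> I \<inter> (A j \<inter> I) = {}" if "i \<noteq> j" for i j
      using union(1) that by (auto simp: disjoint_family_on_def)
    have Un: "(\<Union>i. A i) \<inter> I = (\<Union>i. A i \<inter> I)" by auto
    have AIb: "A i \<inter> I \<in> sets borel" for i using A Ib by auto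
    have split: "(LINT x:(\<Union>i. A i) \<inter> I|lborel. h x) = (\<Sum>i. LINT x:A i \<inter> I|lborel. h x)"
      if "\<And>B. B \<in> sets borel \<Longrightarrow> set_integrable lborel (B \<inter> I) h" for h :: "real \<Rightarrow> complex"
    proof -
      have "set_integrable lborel (\<Union>i. A i \<inter> I) h" using that[of "\<Union>i. A i"] A unfolding Un by auto
      then show ?thesis
        unfolding Un using AIb disj by (intro lebesgue_integral_countable_add) auto
    qed
    have summ: "summable (\<lambda>i. C * measure lborel (A i \<inter> I))"
    proof -
      have "(\<lambda>i. measure lborel (A i \<inter> I)) sums measure lborel (\<Union>i. A i \<inter> I)"
      proof (rule measure_UNION)
        show "range (\<lambda>i. A i \<inter> I) \<subseteq> sets lborel" using AIb by auto
        show "disjoint_family (\<lambda>i. A i \<inter> I)" using disj by (auto simp: disjoint_family_on_def)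
        show "emeasure lborel (\<Union>i. A i \<inter> I) \<noteq> \<infinity>" using bdI[of "\<Union>i. A i"] unfolding Un by simp
      qed
      then show ?thesis by (intro summable_mult) (rule sums_summable)
    qed
    have "(\<lambda>n. \<Sum>i. LINT x:A i \<inter> I|lborel. bv (fn n) x) \<longlonglongrightarrow> (\<Sum>i. LINT x:A i \<inter> I|lborel. bv f x)"
    proof (rule tannerys_theorem[where M = "\<lambda>i. C * measure lborel (A i \<inter> I)" and F = sequentially, THEN conjunct2, THEN conjunct2])
      have "norm (LINT x:A i \<inter> I|lborel. bv (fn n) x) \<le> C * measure lborel (A i \<inter> I)" for i n
      proof (rule norm_set_integral_le[OF bv_measurable[OF fn(1)] AIb bdI])
        show "AE x in lborel. x \<in> A i \<inter> I \<longrightarrow> norm (bv (fn n) x) \<le> C"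
        proof -
          have "AE x in lborel. norm (bv (fn n) x) \<le> C" by (rule bv_bounded[OF fn(1) fn(2)])
          then show ?thesis by eventually_elim simp
        qed
      qed
      then show "\<forall>\<^sub>F (i, n) in sequentially \<times>\<^sub>F sequentially. norm (LINT x:A i \<inter> I|lborel. bv (fn n) x) \<le> C * measure lborel (A i \<inter> I)"
        by (intro always_eventually) auto
    qed (use union.IH summ in auto)
    moreover have "(LINT x:(\<Union>i. A i) \<inter> I|lborel. bv (fn n) x) = (\<Sum>i. LINT x:A i \<inter> I|lborel. bv (fn n) x)" for n
      by (rule split, rule intn)
    moreover have "(LINT x:(\<Union>i. A i) \<inter> I|lborel. bv f x) = (\<Sum>i. LINT x:A i \<inter> I|lborel. bv f x)"
      by (rule split, rule int)
    ultimately show ?case by (simp only:)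
  qed
  then show ?thesis by (simp add: I_def)
qed

section \<open>The Cayley transform and boundary values of Herglotz functions\<close>

definition cayley :: "complex \<Rightarrow> complex" where
  "cayley w = (w - \<i>) / (w + \<i>)"

lemma plus_i_nonzero: "Im w \<ge> 0 \<Longrightarrow> w + \<i> \<noteq> 0"
  by (auto simp: complex_eq_iff)

lemma norm_cayley_less_1:
  assumes "Im w > 0"
  shows "norm (cayley w) < 1"
proof -
  have "norm (w - \<i>) < norm (w - cnj \<i>)" using assms by (intro norm_diff_less_reflected) auto
  then show ?thesis using plus_i_nonzero[of w] assms by (simp add: cayley_def norm_divide)
qed

lemma norm_cayley_herglotz_le_1:
  assumes "herglotz F" "Im z > 0"
  shows "norm (cayley (F z)) \<le> 1"
  using norm_cayley_less_1[OF herglotz_Im_pos[OF assms]] by simp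

lemma cayley_herglotz_holomorphic:
  assumes F: "herglotz F"
  shows "(\<lambda>z. cayley (F z)) holomorphic_on upper_half_plane"
proof -
  have "F z + \<i> \<noteq> 0" if "z \<in> upper_half_plane" for z
    using herglotz_Im_pos[OF F, of z] that by (intro plus_i_nonzero) simp
  then show ?thesis
    unfolding cayley_def using F by (intro holomorphic_intros) (auto simp: herglotz_def)
qed

lemma cayley_cnj: "cnj (cayley p) = cayley (- cnj p)"
proof -
  have "cnj (cayley p) = (- (- cnj p - \<i>)) / (- (- cnj p + \<i>))"
    by (simp add: cayley_def)
  then show ?thesis unfolding minus_divide_divide cayley_def .
qed

lemma cayley_inj:
  assumes "Im w \<ge> 0" "Im v \<ge> 0" "cayley w = cayley v"
  shows "w = v"
proof -
  have "(w - \<i>) * (v + \<i>) = (v - \<i>) * (w + \<i>)"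
    using assms plus_i_nonzero by (simp add: cayley_def frac_eq_eq)
  then have "2 * \<i> * (w - v) = 0" by algebra
  then show ?thesis by simp
qed

lemma cayley_tendsto:
  assumes "(F \<longlongrightarrow> w) A" "Im w \<ge> 0"
  shows "((\<lambda>y. cayley (F y)) \<longlongrightarrow> cayley w) A"
  unfolding cayley_def using plus_i_nonzero[OF assms(2)] by (intro tendsto_intros assms(1))

lemma cayley_diff:
  assumes "Im w \<ge> 0" "Im v \<ge> 0"
  shows "cayley w - cayley v = 2 * \<i> * (w - v) / ((w + \<i>) * (v + \<i>))"
  unfolding cayley_def using plus_i_nonzero[OF assms(1)] plus_i_nonzero[OF assms(2)]
  by (simp add: diff_frac_eq algebra_simps)

text \<open>
  The right hand side is twice the pseudo-hyperbolic distance, which for points of the unit disk is at least half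
  of the Euclidean distance.
\<close>

lemma cayley_diff_le:
  assumes w: "Im w > 0" and v: "Im v > 0"
  shows "norm (cayley w - cayley v) \<le> 2 * (norm (w - v) / norm (w - cnj v))"
proof -
  have le: "norm (u - \<i>) \<le> norm (u + \<i>)" if "Im u > 0" for u
    using norm_diff_less_reflected[of u \<i>] that by simp
  have c1: "norm (cnj v + \<i>) = norm (v - \<i>)" "norm (cnj v - \<i>) = norm (v + \<i>)"
    using complex_mod_cnj[of "v - \<i>"] complex_mod_cnj[of "v + \<i>"] by simp_all
  have "(w - \<i>) * (cnj v + \<i>) - (w + \<i>) * (cnj v - \<i>) = 2 * \<i> * (w - cnj v)" by (simp add: algebra_simps)
  then have "2 * norm (w - cnj v) = norm ((w - \<i>) * (cnj v + \<i>) - (w + \<i>) * (cnj v - \<i>))"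
    by (simp add: norm_mult)
  also have "\<dots> \<le> norm (w - \<i>) * norm (cnj v + \<i>) + norm (w + \<i>) * norm (cnj v - \<i>)"
    unfolding norm_mult[symmetric] by (rule norm_triangle_ineq4)
  also have "\<dots> \<le> norm (w + \<i>) * norm (v + \<i>) + norm (w + \<i>) * norm (v + \<i>)"
    unfolding c1 by (intro add_mono mult_mono le w v) auto
  finally have den: "norm (w - cnj v) \<le> norm (w + \<i>) * norm (v + \<i>)" by linarith
  have pos: "norm (w - cnj v) > 0" using w v by (auto simp: complex_eq_iff)
  have "norm (cayley w - cayley v) = 2 * norm (w - v) / (norm (w + \<i>) * norm (v + \<i>))"
    using w v by (simp add: cayley_diff norm_divide norm_mult)
  also have "\<dots> \<le> 2 * norm (w - v) / norm (w - cnj v)"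
    using den pos by (intro divide_left_mono mult_pos_pos) auto
  finally show ?thesis by simp
qed

lemma real_moebius_Im_pos:
  assumes re: "\<And>i j. A $ i $ j \<in> \<real>" and det: "det A = 1" and w: "Im w > 0"
  shows "Im (moebius_act A w) > 0"
proof -
  have ne: "denom A w \<noteq> 0" "denom A (cnj w) \<noteq> 0" using real_denom_nonzero[OF re det] w by auto
  have dc: "denom A (cnj w) = cnj (denom A w)" using re by (simp add: Reals_cnj_iff)
  have "moebius_act A w - cnj (moebius_act A w) = (w - cnj w) / (denom A w * denom A (cnj w))"
    unfolding moebius_act_real_cnj[OF re, symmetric] by (rule moebius_diff[OF det ne])
  also have "denom A w * denom A (cnj w) = of_real ((norm (denom A w))\<^sup>2)"
    unfolding dc by (rule complex_norm_square[symmetric])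
  finally have "Im (moebius_act A w - cnj (moebius_act A w)) = Im (w - cnj w) / (norm (denom A w))\<^sup>2"
    by (simp only: Im_divide_of_real)
  then have "2 * Im (moebius_act A w) = 2 * Im w / (norm (denom A w))\<^sup>2" by simp
  moreover have "2 * Im w / (norm (denom A w))\<^sup>2 > 0" using ne w by (intro divide_pos_pos) simp_all
  ultimately show ?thesis by linarith
qed

text \<open>
  In numerator and denominator alike the transformation produces the same factor
  \<open>1 / (\<bar>c w + d\<bar> \<bar>c v + d\<bar>)\<close>, because \<open>c\<close> and \<open>d\<close> are
  real.
\<close>

lemma real_moebius_pseudo_distance:
  assumes re: "\<And>i j. A $ i $ j \<in> \<real>" and det: "det A = 1" and w: "Im w > 0" and v: "Im v > 0"
  shows "norm (moebius_act A w - moebius_act A v) / norm (moebius_act A w - cnj (moebius_act A v))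
       = norm (w - v) / norm (w - cnj v)"
proof -
  have ne: "denom A w \<noteq> 0" "denom A v \<noteq> 0" "denom A (cnj v) \<noteq> 0"
    using real_denom_nonzero[OF re det] w v by auto
  have dc: "norm (denom A (cnj v)) = norm (denom A v)"
  proof -
    have "denom A (cnj v) = cnj (denom A v)" using re by (simp add: Reals_cnj_iff)
    then show ?thesis by (simp only: complex_mod_cnj)
  qed
  have 1: "norm (moebius_act A w - moebius_act A v) = norm (w - v) / (norm (denom A w) * norm (denom A v))"
    by (simp only: moebius_diff[OF det ne(1,2)] norm_divide norm_mult)
  have 2: "norm (moebius_act A w - cnj (moebius_act A v)) = norm (w - cnj v) / (norm (denom A w) * norm (denom A v))"
    unfolding moebius_act_real_cnj[OF re, symmetric] by (simp only: moebius_diff[OF det ne(1,3)] norm_divide norm_mult dc)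
  show ?thesis unfolding 1 2 using ne by simp
qed

text \<open>
  Fatou's theorem applies to the Cayley transform \<open>s\<close>; it remains to exclude that \<open>s\<close>
  has boundary value 1, that is, \<open>F\<close> has boundary value infinity, on a set \<open>B\<close> of
  positive measure. The functions \<open>\<psi> n = 1 / (1 - \<i> * F / (n + 1))\<close> are bounded by 1, tend to
  1 in the half plane, and have boundary value 0 on \<open>B\<close>. By weak convergence of the boundary values,
  \<open>B\<close> is a null set.
\<close>

lemma herglotz_boundary_values:
  assumes F: "herglotz F"
  shows "AE x in lborel. \<exists>w. has_boundary_value F x w"
proof -
  define s where "s = (\<lambda>z. cayley (F z))"
  have Fi: "F z + \<i> \<noteq> 0" if "Im z > 0" for z
    using herglotz_Im_pos[OF F that] by (intro plus_i_nonzero) simp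
  have s1: "1 - s z = 2 * \<i> / (F z + \<i>)" if "Im z > 0" for z
    unfolding s_def cayley_def using Fi[OF that] by (simp add: field_simps)
  have s_hol: "s holomorphic_on upper_half_plane" unfolding s_def by (rule cayley_herglotz_holomorphic[OF F])
  have s_bd: "norm (s z) \<le> 1" if "Im z > 0" for z unfolding s_def by (rule norm_cayley_herglotz_le_1[OF F that])
  have ae: "AE x in lborel. \<exists>w. has_boundary_value s x w" by (rule fatou_boundary_values[OF s_hol s_bd])
  define \<psi> where "\<psi> = (\<lambda>n z. 1 / (1 - \<i> * F z / of_real (real (Suc n))))"
  have Re_ge: "1 \<le> Re (1 - \<i> * F z / of_real (real (Suc n)))" if "Im z > 0" for n z
  proof -
    have "Re (1 - \<i> * F z / of_real (real (Suc n))) = 1 + Im (F z) / real (Suc n)"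
      by (simp add: Re_divide_of_real del: of_nat_Suc)
    moreover have "Im (F z) / real (Suc n) \<ge> 0" using herglotz_Im_pos[OF F that] by simp
    ultimately show ?thesis by linarith
  qed
  have ne: "1 - \<i> * F z / of_real (real (Suc n)) \<noteq> 0" if "Im z > 0" for n z
    using Re_ge[OF that, of n] by (metis zero_complex.sel(1) not_one_le_zero)
  have \<psi>_hol: "\<psi> n holomorphic_on upper_half_plane" for n
  proof -
    have "F holomorphic_on upper_half_plane" using F by (simp add: herglotz_def)
    moreover have "1 - \<i> * F z / of_real (real (Suc n)) \<noteq> 0" if "z \<in> upper_half_plane" for z
      using that by (intro ne) simp
    moreover have "complex_of_real (real (Suc n)) \<noteq> 0" by (simp del: of_nat_Suc)
    ultimately show ?thesis unfolding \<psi>_def by (intro holomorphic_intros)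
  qed
  have \<psi>_bd: "norm (\<psi> n z) \<le> 1" if z: "Im z > 0" for n z
  proof -
    have "1 \<le> norm (1 - \<i> * F z / of_real (real (Suc n)))"
      by (rule order_trans[OF Re_ge[OF z] complex_Re_le_cmod])
    moreover have "1 / t \<le> 1" if "1 \<le> t" for t :: real using that by simp
    ultimately show ?thesis unfolding \<psi>_def norm_divide norm_one by blast
  qed
  have \<psi>_lim: "(\<lambda>n. \<psi> n z) \<longlonglongrightarrow> 1" if z: "Im z > 0" for z
  proof -
    have "(\<lambda>n. 1 / (1 - \<i> * F z * of_real (inverse (real (Suc n))))) \<longlonglongrightarrow> 1 / (1 - \<i> * F z * of_real 0)"
      by (intro tendsto_intros LIMSEQ_inverse_real_of_nat) simp
    then show ?thesis by (simp add: \<psi>_def divide_inverse del: of_nat_Suc)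
  qed
  define B where "B = {x. bv s x = 1}"
  have Bb: "B \<in> sets borel"
    unfolding B_def using bv_measurable[OF s_hol] by measurable
  have bv\<psi>: "AE x in lborel. x \<in> B \<longrightarrow> bv (\<psi> n) x = 0" for n
    using ae
  proof eventually_elim
    case (elim x)
    show ?case
    proof
      assume "x \<in> B"
      then have lim: "((\<lambda>y. s (Complex x y)) \<longlongrightarrow> 1) (at_right 0)"
        using has_bv[OF elim] unfolding B_def has_boundary_value_def by simp
      let ?k = "complex_of_real (real (Suc n))"
      \<comment> \<open>this quotient is \<open>\<psi> n\<close>, written in terms of \<open>s\<close>\<close>
      have "((\<lambda>y. ?k * (1 - s (Complex x y)) / ((?k - 1) * (1 - s (Complex x y)) + 2))
          \<longlongrightarrow> ?k * (1 - 1) / ((?k - 1) * (1 - 1) + 2)) (at_right 0)"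
        by (intro tendsto_intros lim) simp
      then have l: "((\<lambda>y. ?k * (1 - s (Complex x y)) / ((?k - 1) * (1 - s (Complex x y)) + 2)) \<longlongrightarrow> 0) (at_right 0)"
        by simp
      have "((\<lambda>y. \<psi> n (Complex x y)) \<longlongrightarrow> 0) (at_right 0)"
      proof (rule Lim_transform_eventually[OF l])
        show "\<forall>\<^sub>F y in at_right 0. ?k * (1 - s (Complex x y)) / ((?k - 1) * (1 - s (Complex x y)) + 2) = \<psi> n (Complex x y)"
          using eventually_Complex_uhp[of x]
        proof eventually_elim
          case (elim y)
          let ?F = "F (Complex x y)"
          have k: "?k \<noteq> 0" by (simp del: of_nat_Suc)
          have fi: "?F + \<i> \<noteq> 0" by (rule Fi[OF elim])
          have a: "?k * (1 - s (Complex x y)) = 2 * \<i> * ?k / (?F + \<i>)" unfolding s1[OF elim] by simp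
          have b: "(?k - 1) * (1 - s (Complex x y)) + 2 = 2 * \<i> * (?k - \<i> * ?F) / (?F + \<i>)"
            unfolding s1[OF elim] using fi by (simp add: divide_simps) (simp add: algebra_simps)
          have "?k * (1 - s (Complex x y)) / ((?k - 1) * (1 - s (Complex x y)) + 2) = ?k / (?k - \<i> * ?F)"
            unfolding a b using fi by simp
          also have "\<dots> = 1 / ((?k - \<i> * ?F) / ?k)" by simp
          also have "(?k - \<i> * ?F) / ?k = 1 - \<i> * ?F / ?k" unfolding diff_divide_distrib using k by simp
          finally show ?case by (simp only: \<psi>_def)
        qed
      qed
      then show "bv (\<psi> n) x = 0" by (intro bv_eq) (simp add: has_boundary_value_def)
    qed
  qed
  have null: "AE x in lborel. x \<notin> B \<inter> {- real N..real N}" for N :: nat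
  proof -
    let ?A = "B \<inter> {- real N..real N}"
    have "(\<lambda>n. LINT x:?A|lborel. bv (\<psi> n) x) \<longlonglongrightarrow> (LINT x:?A|lborel. bv (\<lambda>_. 1) x)"
      by (rule weak_convergence[where C = 1 and fn = \<psi> and f = "\<lambda>_. 1", OF \<psi>_hol \<psi>_bd _ _ \<psi>_lim _ Bb]) simp_all
    moreover have "(LINT x:?A|lborel. bv (\<psi> n) x) = 0" for n
    proof -
      have "AE x in lborel. indicator ?A x *\<^sub>R bv (\<psi> n) x = 0"
        using bv\<psi>[of n] by eventually_elim (simp add: indicator_def)
      then show ?thesis unfolding set_lebesgue_integral_def by (rule integral_eq_zero_AE)
    qed
    moreover have "bv (\<lambda>_. 1) x = 1" for x by (simp add: bv_def)
    ultimately have "(LINT x:?A|lborel. (1::complex)) = 0"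
      by (simp add: LIMSEQ_const_iff)
    moreover have "(LINT x:?A|lborel. (1::complex)) = of_real (measure lborel ?A)"
    proof -
      have "(LINT x:?A|lborel. (1::complex)) = (LINT x|lborel. complex_of_real (indicator ?A x))"
        unfolding set_lebesgue_integral_def by (intro Bochner_Integration.integral_cong) (auto simp: indicator_def)
      then show ?thesis using Bb emeasure_bounded_part[of B "real N"] by simp
    qed
    ultimately have "measure lborel ?A = 0" by simp
    then have "emeasure lborel ?A = 0"
      using emeasure_bounded_part[of B "real N"] by (simp add: emeasure_eq_ennreal_measure)
    then show ?thesis using Bb by (intro AE_I'[of ?A]) auto
  qed
  have "AE x in lborel. \<forall>N::nat. x \<notin> B \<inter> {- real N..real N}"
    unfolding AE_all_countable using null by blast
  with ae show ?thesis
  proof eventually_elim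
    case (elim x)
    obtain N where "\<bar>x\<bar> < real N" using reals_Archimedean2 by blast
    then have "x \<in> {- real N..real N}" by auto
    then have "x \<notin> B" using elim(2) by blast
    then have ne1: "1 - bv s x \<noteq> 0" by (simp add: B_def)
    have lim: "((\<lambda>y. s (Complex x y)) \<longlongrightarrow> bv s x) (at_right 0)"
      using has_bv[OF elim(1)] by (simp only: has_boundary_value_def)
    then have l: "((\<lambda>y. 2 * \<i> / (1 - s (Complex x y)) - \<i>) \<longlongrightarrow> 2 * \<i> / (1 - bv s x) - \<i>) (at_right 0)"
      by (intro tendsto_intros ne1)
    have "((\<lambda>y. F (Complex x y)) \<longlongrightarrow> 2 * \<i> / (1 - bv s x) - \<i>) (at_right 0)"
    proof (rule Lim_transform_eventually[OF l])
      show "\<forall>\<^sub>F y in at_right 0. 2 * \<i> / (1 - s (Complex x y)) - \<i> = F (Complex x y)"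
        using eventually_Complex_uhp[of x]
      proof eventually_elim
        case (elim y)
        show ?case unfolding s1[OF elim] using Fi[OF elim] by simp
      qed
    qed
    then show ?case unfolding has_boundary_value_def by blast
  qed
qed

lemma AE_le_of_set_integrals:
  fixes d :: "real \<Rightarrow> real"
  assumes d: "d \<in> borel_measurable borel" and bd: "AE x in lborel. \<bar>d x\<bar> \<le> C" and A: "A \<in> sets borel"
    and le: "\<And>E N. E \<in> sets borel \<Longrightarrow> E \<subseteq> A \<Longrightarrow> N \<ge> 0 \<Longrightarrow>
          (LINT x:E \<inter> {-N..N}|lborel. d x) \<le> c * measure lborel (E \<inter> {-N..N})"
  shows "AE x in lborel. x \<in> A \<longrightarrow> d x \<le> c"
proof -
  define E where "E = {x\<in>A. d x > c}"
  have [measurable]: "d \<in> borel_measurable borel" "A \<in> sets borel" using d A by auto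
  have E: "E \<in> sets borel" unfolding E_def by measurable
  have null: "AE x in lborel. x \<notin> E \<inter> {- real N..real N}" for N :: nat
  proof -
    let ?B = "E \<inter> {- real N..real N}"
    have fin: "emeasure lborel ?B < \<infinity>" by (rule emeasure_bounded_part)
    have Bb: "?B \<in> sets borel" using E by auto
    let ?h = "\<lambda>x. indicator ?B x *\<^sub>R (d x - c)"
    have i1: "integrable lborel (\<lambda>x. indicator ?B x *\<^sub>R d x)"
      by (intro integrableI_bounded_set_indicator[where B = C] fin) (use bd Bb in \<open>auto elim: eventually_mono\<close>)
    have i2: "integrable lborel (\<lambda>x. indicator ?B x *\<^sub>R c)"
      by (intro integrableI_bounded_set_indicator[where B = "\<bar>c\<bar>"] fin) (use Bb in auto)
    have int: "integrable lborel ?h"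
      unfolding scaleR_diff_right by (intro Bochner_Integration.integrable_diff i1 i2)
    have "(LINT x|lborel. ?h x) = (LINT x|lborel. indicator ?B x *\<^sub>R d x) - (LINT x|lborel. indicator ?B x *\<^sub>R c)"
      unfolding scaleR_diff_right by (rule Bochner_Integration.integral_diff[OF i1 i2])
    also have "(LINT x|lborel. indicator ?B x *\<^sub>R c) = c * measure lborel ?B" using Bb fin by simp
    also have "(LINT x|lborel. indicator ?B x *\<^sub>R d x) - c * measure lborel ?B \<le> 0"
      using le[OF E, of "real N"] unfolding set_lebesgue_integral_def by (simp add: E_def)
    finally have le0: "(LINT x|lborel. ?h x) \<le> 0" .
    have nn: "0 \<le> ?h x" for x by (simp add: indicator_def E_def)
    then have "(LINT x|lborel. ?h x) \<ge> 0" by (intro Bochner_Integration.integral_nonneg) simp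
    then have "(LINT x|lborel. ?h x) = 0" using le0 by linarith
    then have "AE x in lborel. ?h x = 0"
      using nn by (subst (asm) integral_nonneg_eq_0_iff_AE[OF int]) auto
    then show ?thesis
      by eventually_elim (auto simp: indicator_def E_def split: if_splits)
  qed
  have "AE x in lborel. \<forall>N::nat. x \<notin> E \<inter> {- real N..real N}"
    unfolding AE_all_countable using null by blast
  then show ?thesis
  proof eventually_elim
    case (elim x)
    obtain N where "\<bar>x\<bar> < real N" using reals_Archimedean2 by blast
    then have "x \<in> {- real N..real N}" by auto
    then have "x \<notin> E" using elim by blast
    then show ?case by (simp add: E_def not_less)
  qed
qed

text \<open>
  The bound for the real part of \<open>\<theta> * d x\<close> with \<open>\<theta> = 1, -1, \<i>, -\<i>\<close>
  confines \<open>d x\<close> to a square, whence the factor 2.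
\<close>

lemma AE_norm_le_of_set_integrals:
  fixes d :: "real \<Rightarrow> complex"
  assumes d: "d \<in> borel_measurable borel" and bd: "AE x in lborel. norm (d x) \<le> C" and A: "A \<in> sets borel"
    and le: "\<And>E N. E \<in> sets borel \<Longrightarrow> E \<subseteq> A \<Longrightarrow> N \<ge> 0 \<Longrightarrow>
          norm (LINT x:E \<inter> {-N..N}|lborel. d x) \<le> c * measure lborel (E \<inter> {-N..N})"
  shows "AE x in lborel. x \<in> A \<longrightarrow> norm (d x) \<le> 2 * c"
proof -
  have real: "AE x in lborel. x \<in> A \<longrightarrow> Re (\<theta> * d x) \<le> c" if \<theta>: "norm \<theta> = 1" for \<theta>
  proof (rule AE_le_of_set_integrals[where C = C])
    show "(\<lambda>x. Re (\<theta> * d x)) \<in> borel_measurable borel" using d by measurable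
    show "AE x in lborel. \<bar>Re (\<theta> * d x)\<bar> \<le> C"
      using bd
    proof eventually_elim
      case (elim x)
      have "\<bar>Re (\<theta> * d x)\<bar> \<le> norm (\<theta> * d x)" by (rule abs_Re_le_cmod)
      then show ?case using elim \<theta> by (simp add: norm_mult)
    qed
    fix E and N :: real assume E: "E \<in> sets borel" "E \<subseteq> A" and N: "N \<ge> 0"
    let ?B = "E \<inter> {-N..N}"
    have Bb: "?B \<in> sets borel" using E by auto
    have int: "set_integrable lborel ?B d"
      by (rule bounded_set_integrable[OF d Bb emeasure_bounded_part bd])
    then have "integrable lborel (\<lambda>x. \<theta> * (indicator ?B x *\<^sub>R d x))"
      unfolding set_integrable_def by (rule integrable_mult_right)
    then have "(LINT x|lborel. Re (\<theta> * (indicator ?B x *\<^sub>R d x))) = Re (LINT x|lborel. \<theta> * (indicator ?B x *\<^sub>R d x))"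
      by (rule integral_Re)
    also have "(LINT x|lborel. \<theta> * (indicator ?B x *\<^sub>R d x)) = \<theta> * (LINT x:?B|lborel. d x)"
      unfolding set_lebesgue_integral_def by (rule integral_mult_right_zero)
    also have "Re (\<theta> * (LINT x:?B|lborel. d x)) \<le> norm (\<theta> * (LINT x:?B|lborel. d x))" by (rule complex_Re_le_cmod)
    also have "\<dots> \<le> c * measure lborel ?B" using le[OF E N] \<theta> by (simp add: norm_mult)
    also have "(\<lambda>x. Re (\<theta> * (indicator ?B x *\<^sub>R d x))) = (\<lambda>x. indicator ?B x *\<^sub>R Re (\<theta> * d x))"
      by (auto simp: indicator_def)
    finally show "(LINT x:?B|lborel. Re (\<theta> * d x)) \<le> c * measure lborel ?B"
      unfolding set_lebesgue_integral_def .
  qed (rule A)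
  have "norm (1::complex) = 1" "norm (-1::complex) = 1" "norm \<i> = 1" "norm (-\<i>) = 1" by simp_all
  note r = real[OF this(1)] real[OF this(2)] real[OF this(3)] real[OF this(4)]
  from r show ?thesis
  proof eventually_elim
    case (elim x)
    show ?case
    proof
      assume "x \<in> A"
      then have "\<bar>Re (d x)\<bar> \<le> c" "\<bar>Im (d x)\<bar> \<le> c" using elim by auto
      then show "norm (d x) \<le> 2 * c" using cmod_le[of "d x"] by linarith
    qed
  qed
qed

section \<open>Sequences of transformations: bounded expansion\<close>

lemma loc_uniform_limit_tendsto:
  assumes "loc_uniform_limit S f l" "z \<in> S"
  shows "(\<lambda>n. f n z) \<longlonglongrightarrow> l z"
proof -
  obtain U where "z \<in> U" "uniform_limit (U \<inter> S) f l sequentially"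
    using assms unfolding loc_uniform_limit_def by blast
  then show ?thesis using assms(2) by (intro tendsto_uniform_limitI[where S = "U \<inter> S"]) auto
qed

lemma loc_uniform_limit_UNIV_if_compact:
  assumes "\<And>K. compact K \<Longrightarrow> uniform_limit K f l sequentially"
  shows "loc_uniform_limit UNIV f l"
  unfolding loc_uniform_limit_def
proof
  fix z :: complex
  have "uniform_limit (ball z 1 \<inter> UNIV) f l sequentially"
    using uniform_limit_on_subset[OF assms[OF compact_cball[of z 1]]] ball_subset_cball by blast
  then show "\<exists>U. open U \<and> z \<in> U \<and> uniform_limit (U \<inter> UNIV) f l sequentially"
    by (intro exI[of _ "ball z 1"]) simp
qed

lemma Im_m_pos:
  assumes "herglotz_pair H" "Im z > 0"
  shows "Im (m_plus H z) > 0" "Im (m_minus H z) > 0"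
  using assms herglotz_Im_pos unfolding herglotz_pair_def by blast+

locale transfer_sequence =
  fixes H :: "nat \<Rightarrow> m_pair" and H_lim :: m_pair
    and T :: "nat \<Rightarrow> complex \<Rightarrow> complex^2^2"
  assumes pair: "\<And>n. n \<ge> 1 \<Longrightarrow> herglotz_pair (H n)"
    and pair_lim: "herglotz_pair H_lim"
    and transfer: "\<And>n. n \<ge> 1 \<Longrightarrow> type_S_via (T n) (H n) (H (n + 1))"
    and lim_plus: "loc_uniform_limit upper_half_plane (\<lambda>n. m_plus (H n)) (m_plus H_lim)"
    and lim_minus: "loc_uniform_limit upper_half_plane (\<lambda>n. m_minus (H n)) (m_minus H_lim)"
begin

abbreviation P :: "nat \<Rightarrow> complex \<Rightarrow> complex^2^2" where "P \<equiv> transfer_prod T"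

lemma T_class_S: "n \<ge> 1 \<Longrightarrow> T n \<in> class_S"
  using transfer[of n] by (simp add: type_S_via_def)

lemma P_class_S: "P n \<in> class_S"
  using T_class_S by (rule transfer_prod_class_S)

lemma transfer_step:
  assumes "n \<ge> 1" "Im z > 0"
  shows "moebius_act (T n z) (m_minus (H n) z) = m_minus (H (Suc n)) z"
    and "moebius_act (T n z) (- m_plus (H n) z) = - m_plus (H (Suc n)) z"
    and "denom (T n z) (m_minus (H n) z) \<noteq> 0"
    and "denom (T n z) (- m_plus (H n) z) \<noteq> 0"
proof -
  show 1: "moebius_act (T n z) (m_minus (H n) z) = m_minus (H (Suc n)) z"
    and 2: "moebius_act (T n z) (- m_plus (H n) z) = - m_plus (H (Suc n)) z"
    using transfer[OF assms(1)] assms(2) by (auto simp: type_S_via_def moebius_act_I_conj)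
  have "herglotz_pair (H (Suc n))" using pair[of "Suc n"] by simp
  note pos = Im_m_pos[OF this assms(2)]
  show "denom (T n z) (m_minus (H n) z) \<noteq> 0"
    using 1 pos by (auto simp: moebius_act_def)
  show "denom (T n z) (- m_plus (H n) z) \<noteq> 0"
  proof
    assume "denom (T n z) (- m_plus (H n) z) = 0"
    then have "moebius_act (T n z) (- m_plus (H n) z) = 0" unfolding moebius_act_def by (simp only: div_by_0)
    then show False using 2 pos by auto
  qed
qed

lemma orbit_minus:
  assumes "Im z > 0"
  shows "denom (P n z) (m_minus (H 1) z) \<noteq> 0"
    "moebius_act (P n z) (m_minus (H 1) z) = m_minus (H (Suc n)) z"
proof (induction n)
  case 0
  show "denom (P 0 z) (m_minus (H 1) z) \<noteq> 0" 
    "moebius_act (P 0 z) (m_minus (H 1) z) = m_minus (H (Suc 0)) z"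
    by (simp_all add: mat_def moebius_act_def)
next
  case (Suc n)
  show "denom (P (Suc n) z) (m_minus (H 1) z) \<noteq> 0"
    using transfer_step(3)[of "Suc n" z] assms Suc by (simp add: denom_mult)
  show "moebius_act (P (Suc n) z) (m_minus (H 1) z) = m_minus (H (Suc (Suc n))) z"
    using transfer_step(1)[of "Suc n" z] assms Suc by (simp add: moebius_act_mult)
qed

lemma orbit_plus:
  assumes "Im z > 0"
  shows "denom (P n z) (- m_plus (H 1) z) \<noteq> 0"
    "moebius_act (P n z) (- m_plus (H 1) z) = - m_plus (H (Suc n)) z"
proof (induction n)
  case 0
  show "denom (P 0 z) (- m_plus (H 1) z) \<noteq> 0" 
    "moebius_act (P 0 z) (- m_plus (H 1) z) = - m_plus (H (Suc 0)) z"
    by (simp_all add: mat_def moebius_act_def)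
next
  case (Suc n)
  have "1 \<le> Suc n" by simp
  note step = transfer_step[OF this assms]
  show "denom (P (Suc n) z) (- m_plus (H 1) z) \<noteq> 0"
    unfolding transfer_prod.simps denom_mult[OF Suc(1)] Suc(2) using step(4) Suc(1) by (simp only: mult_eq_0_iff simp_thms)
  show "moebius_act (P (Suc n) z) (- m_plus (H 1) z) = - m_plus (H (Suc (Suc n))) z"
    unfolding transfer_prod.simps moebius_act_mult[OF Suc(1)] Suc(2) by (rule step(2))
qed

lemma m_minus_tendsto:
  assumes "Im z > 0"
  shows "(\<lambda>n. m_minus (H (Suc n)) z) \<longlonglongrightarrow> m_minus H_lim z"
  using loc_uniform_limit_tendsto[OF lim_minus, of z] assms by (intro LIMSEQ_Suc) simp

lemma m_plus_tendsto:
  assumes "Im z > 0"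
  shows "(\<lambda>n. m_plus (H (Suc n)) z) \<longlonglongrightarrow> m_plus H_lim z"
  using loc_uniform_limit_tendsto[OF lim_plus, of z] assms by (intro LIMSEQ_Suc) simp

text \<open>
  The reciprocal of the hyperbolic derivative of \<open>P n z\<close> at \<open>m_minus (H 1) z\<close>, up to the
  factor \<open>Im (m_minus (H 1) z)\<close>, which is the same for all \<open>n\<close>.
\<close>

definition expansion :: "nat \<Rightarrow> complex \<Rightarrow> real" where
  "expansion n z = Im (m_minus (H (Suc n)) z) * (norm (denom (P n z) (m_minus (H 1) z)))\<^sup>2"

lemma expansion_incseq:
  assumes z: "Im z > 0"
  shows "incseq (\<lambda>n. expansion n z)"
proof (rule incseq_SucI)
  fix n
  let ?w = "m_minus (H (Suc n)) z"
  have 1: "1 \<le> Suc n" by simp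
  have "Im ?w > 0" using Im_m_pos(2)[OF pair[OF 1] z] .
  then have "Im ?w \<le> Im (moebius_act (T (Suc n) z) ?w) * (norm (denom (T (Suc n) z) ?w))\<^sup>2"
    by (rule uhp_contractiveD(4)[OF class_S_contractive[OF T_class_S[OF 1] z]])
  also have "moebius_act (T (Suc n) z) ?w = m_minus (H (Suc (Suc n))) z"
    by (rule transfer_step(1)[OF 1 z])
  finally have "Im ?w * (norm (denom (P n z) (m_minus (H 1) z)))\<^sup>2
      \<le> Im (m_minus (H (Suc (Suc n))) z) * (norm (denom (T (Suc n) z) ?w))\<^sup>2 * (norm (denom (P n z) (m_minus (H 1) z)))\<^sup>2"
    by (rule mult_right_mono) simp
  then show "expansion n z \<le> expansion (Suc n) z"
    unfolding expansion_def transfer_prod.simps denom_mult[OF orbit_minus(1)[OF z]] orbit_minus(2)[OF z]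
    by (simp add: norm_mult power_mult_distrib mult.assoc)
qed

text \<open>
  The image of \<open>m_minus (H 1) z\<close> under \<open>P n z\<close> converges to a point of the open upper
  half plane, so a bound for \<open>expansion\<close> amounts to a bound for the denominator at this point, which
  controls all entries.
\<close>

lemma corner_bounded_if_expansion_bounded:
  assumes z: "Im z > 0" and bd: "\<And>n. expansion n z \<le> B"
  shows "\<exists>C. \<forall>n. norm (corner (P n z)) \<le> C"
proof -
  let ?m = "\<lambda>n. m_minus (H (Suc n)) z"
  let ?w = "m_minus (H 1) z"
  have Im_pos: "Im (?m n) > 0" for n using Im_m_pos(2)[OF pair z, of "Suc n"] by simp
  have limpos: "Im (m_minus H_lim z) > 0" using Im_m_pos(2)[OF pair_lim z] .
  have "(\<lambda>n. 1 / Im (?m n)) \<longlonglongrightarrow> 1 / Im (m_minus H_lim z)"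
    using limpos by (intro tendsto_intros m_minus_tendsto z) auto
  then have "Bseq (\<lambda>n. 1 / Im (?m n))" using convergentI convergent_imp_Bseq by blast
  then obtain L where L: "\<And>n. norm (1 / Im (?m n)) \<le> L" unfolding Bseq_def by blast
  have "Bseq ?m" using m_minus_tendsto[OF z] convergentI convergent_imp_Bseq by blast
  then obtain W where W: "\<And>n. norm (?m n) \<le> W" unfolding Bseq_def by blast
  define D where "D = sqrt (B * L)"
  have D: "norm (denom (P n z) ?w) \<le> D" for n
    unfolding D_def
  proof (rule real_le_rsqrt)
    have e0: "expansion n z \<ge> 0" using Im_pos[of n] by (simp add: expansion_def)
    have "(norm (denom (P n z) ?w))\<^sup>2 = expansion n z * (1 / Im (?m n))"
      unfolding expansion_def using Im_pos[of n] by simp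
    also have "\<dots> \<le> B * L"
      using bd[of n] L[of n] e0 Im_pos[of n] by (intro mult_mono) auto
    finally show "(norm (denom (P n z) ?w))\<^sup>2 \<le> B * L" .
  qed
  have w: "Im ?w > 0" using Im_pos[of 0] by simp
  define E where "E = (1 + W) * D * (1 + (1 + norm ?w) / Im ?w)"
  have E: "norm (P n z $ i $ j) \<le> E" for n i j
    unfolding E_def
  proof (rule entries_bound_by_orbit[OF class_S_contractive[OF P_class_S z] w D])
    show "norm (moebius_act (P n z) ?w) \<le> W" unfolding orbit_minus(2)[OF z] by (rule W)
  qed
  have "norm (corner (P n z)) \<le> 2 * E" for n
  proof -
    have "norm (corner (P n z)) = norm ((P n z$1$1 + P n z$2$2) - \<i> * (P n z$1$2 - P n z$2$1)) / 2"
      by (simp add: corner_def norm_divide)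
    also have "norm ((P n z$1$1 + P n z$2$2) - \<i> * (P n z$1$2 - P n z$2$1))
        \<le> norm (P n z$1$1 + P n z$2$2) + norm (\<i> * (P n z$1$2 - P n z$2$1))"
      by (rule norm_triangle_ineq4)
    also have "\<dots> \<le> (norm (P n z$1$1) + norm (P n z$2$2)) + (norm (P n z$1$2) + norm (P n z$2$1))"
      unfolding norm_mult norm_ii mult_1 by (intro add_mono norm_triangle_ineq norm_triangle_ineq4)
    also have "\<dots> \<le> (E + E) + (E + E)" by (intro add_mono E)
    finally show ?thesis by simp
  qed
  then show ?thesis by blast
qed

lemma signed_moebius_act: "moebius_act (if b then A else - A) w = moebius_act A w"
  by (simp add: moebius_act_uminus)

lemma signed_denom: "denom (if b then A else - A) w = (if b then denom A w else - denom A w)"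
  by simp

lemma signed_limit_acts:
  fixes s :: "nat \<Rightarrow> bool"
  assumes Q: "Q \<in> class_S" and r: "strict_mono r"
    and lim: "\<And>z. (\<lambda>n. if s n then P (r n) z else - P (r n) z) \<longlonglongrightarrow> Q z" and z: "Im z > 0"
  shows "denom (Q z) (m_minus (H 1) z) \<noteq> 0" "moebius_act (Q z) (m_minus (H 1) z) = m_minus H_lim z"
    "denom (Q z) (- m_plus (H 1) z) \<noteq> 0" "moebius_act (Q z) (- m_plus (H 1) z) = - m_plus H_lim z"
proof -
  have ent: "(\<lambda>n. (if s n then P (r n) z else - P (r n) z) $ i $ j) \<longlonglongrightarrow> Q z $ i $ j" for i j
    using lim by (intro tendsto_vec_nth)
  have det: "det (Q z) = 1" using Q by (simp add: class_S_def)
  have "(\<lambda>n. m_minus (H (Suc (r n))) z) \<longlonglongrightarrow> m_minus H_lim z"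
    using LIMSEQ_subseq_LIMSEQ[OF m_minus_tendsto[OF z] r] by (simp add: o_def)
  then have 1: "(\<lambda>n. moebius_act (if s n then P (r n) z else - P (r n) z) (m_minus (H 1) z)) \<longlonglongrightarrow> m_minus H_lim z"
    unfolding signed_moebius_act orbit_minus(2)[OF z] .
  have ne1: "denom (if s n then P (r n) z else - P (r n) z) (m_minus (H 1) z) \<noteq> 0" for n
    unfolding signed_denom using orbit_minus(1)[OF z, of "r n"] by (metis neg_equal_0_iff_equal)
  show "denom (Q z) (m_minus (H 1) z) \<noteq> 0" "moebius_act (Q z) (m_minus (H 1) z) = m_minus H_lim z"
    by (rule moebius_act_limit[OF ent det 1 ne1])+
  have "(\<lambda>n. - m_plus (H (Suc (r n))) z) \<longlonglongrightarrow> - m_plus H_lim z"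
    using LIMSEQ_subseq_LIMSEQ[OF m_plus_tendsto[OF z] r] by (intro tendsto_minus) (simp add: o_def)
  then have 2: "(\<lambda>n. moebius_act (if s n then P (r n) z else - P (r n) z) (- m_plus (H 1) z)) \<longlonglongrightarrow> - m_plus H_lim z"
    unfolding signed_moebius_act orbit_plus(2)[OF z] .
  have ne2: "denom (if s n then P (r n) z else - P (r n) z) (- m_plus (H 1) z) \<noteq> 0" for n
    unfolding signed_denom using orbit_plus(1)[OF z, of "r n"] by (metis neg_equal_0_iff_equal)
  show "denom (Q z) (- m_plus (H 1) z) \<noteq> 0" "moebius_act (Q z) (- m_plus (H 1) z) = - m_plus H_lim z"
    by (rule moebius_act_limit[OF ent det 2 ne2])+
qed

lemma reflectionless_of_two_signed_limits:
  fixes s s' :: "nat \<Rightarrow> bool"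
  assumes Q: "Q \<in> class_S" "strict_mono r" "\<And>z. (\<lambda>n. if s n then P (r n) z else - P (r n) z) \<longlonglongrightarrow> Q z"
    and Q': "Q' \<in> class_S" "strict_mono r'" "\<And>z. (\<lambda>n. if s' n then P (r' n) z else - P (r' n) z) \<longlonglongrightarrow> Q' z"
    and neq: "Q' \<noteq> Q" "Q' \<noteq> (\<lambda>z. - Q z)"
  shows "reflectionless_on H_lim (Sigma_ac (H 1))"
  by (rule reflectionless_of_two_transfers[OF Q(1) Q'(1) neq])
    (intro conjI signed_limit_acts[OF Q] signed_limit_acts[OF Q']; assumption)+

text \<open>
  All limit points are \<open>Q\<close> or \<open>- Q\<close> for one \<open>Q\<close>. Choosing the sign of
  \<open>P n\<close> that brings it closer to \<open>Q\<close> at the point \<open>\<i>\<close> excludes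
  \<open>- Q\<close>, and then every subsequence has a further subsequence that converges to \<open>Q\<close>.
\<close>

lemma signed_convergence:
  assumes bd: "\<And>r. \<exists>C. \<forall>n i j z. norm z \<le> r \<longrightarrow> norm (P n z $ i $ j) \<le> C"
    and nr: "\<not> reflectionless_on H_lim (Sigma_ac (H 1))"
  obtains s :: "nat \<Rightarrow> bool" and Q where "Q \<in> class_S"
    "\<And>K. compact K \<Longrightarrow> uniform_limit K (\<lambda>n z. if s n then P n z else - P n z) Q sequentially"
proof -
  obtain Q r where Q: "Q \<in> class_S" and r: "strict_mono (r :: nat \<Rightarrow> nat)"
    and lim: "\<And>K. compact K \<Longrightarrow> uniform_limit K (\<lambda>n. P (r n)) Q sequentially"
    using class_S_montel[of P, OF P_class_S bd] by blast
  have Qpt: "(\<lambda>n. if True then P (r n) z else - P (r n) z) \<longlonglongrightarrow> Q z" for z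
    using tendsto_uniform_limitI[OF lim[of "{z}"], of z] by simp
  \<comment> \<open>\<open>s n\<close> says that \<open>P n\<close> keeps its sign; the choice favours \<open>Q\<close> over \<open>- Q\<close>\<close>
  define s where "s = (\<lambda>n. norm (P n \<i> - Q \<i>) \<le> norm (P n \<i> + Q \<i>))"
  define sP where "sP = (\<lambda>n z. if s n then P n z else - P n z)"
  have closer: "norm (sP n \<i> - Q \<i>) \<le> norm (sP n \<i> + Q \<i>)" for n
  proof (cases "s n")
    case True then show ?thesis by (simp add: sP_def s_def)
  next
    case False
    have "norm (- P n \<i> - Q \<i>) = norm (P n \<i> + Q \<i>)" "norm (- P n \<i> + Q \<i>) = norm (P n \<i> - Q \<i>)"
      by (metis minus_diff_eq norm_minus_cancel diff_minus_eq_add add.commute minus_add_distrib uminus_add_conv_diff)+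
    then show ?thesis using False by (simp add: sP_def s_def)
  qed
  have sP_S: "sP n \<in> class_S" for n
    using P_class_S[of n] class_S_uminus[OF P_class_S, of n] by (cases "s n") (simp_all add: sP_def)
  have sP_bd: "\<exists>C. \<forall>n i j z. norm z \<le> r \<longrightarrow> norm (sP n z $ i $ j) \<le> C" for r
  proof -
    have "norm (sP n z $ i $ j) = norm (P n z $ i $ j)" for n z i j by (simp add: sP_def)
    then show ?thesis using bd[of r] by simp
  qed
  have "uniform_limit K sP Q sequentially" if K: "compact K" for K
  proof (rule ccontr)
    assume "\<not> uniform_limit K sP Q sequentially"
    then obtain e where e: "e > 0" and "\<not> (\<forall>\<^sub>F n in sequentially. \<forall>z\<in>K. dist (sP n z) (Q z) < e)"
      unfolding uniform_limit_iff by blast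
    then have inf: "infinite {n. \<not> (\<forall>z\<in>K. dist (sP n z) (Q z) < e)}"
      by (simp add: cofinite_eq_sequentially[symmetric] eventually_cofinite)
    define u where "u = enumerate {n. \<not> (\<forall>z\<in>K. dist (sP n z) (Q z) < e)}"
    have u: "strict_mono u" unfolding u_def by (rule strict_mono_enumerate[OF inf])
    have far: "\<not> (\<forall>z\<in>K. dist (sP (u n) z) (Q z) < e)" for n
      using enumerate_in_set[OF inf, of n] unfolding u_def by simp
    obtain Q' v where Q': "Q' \<in> class_S" and v: "strict_mono (v :: nat \<Rightarrow> nat)"
      and lim': "\<And>K. compact K \<Longrightarrow> uniform_limit K (\<lambda>n. sP (u (v n))) Q' sequentially"
    proof -
      have "\<exists>C. \<forall>n i j z. norm z \<le> r \<longrightarrow> norm (sP (u n) z $ i $ j) \<le> C" for r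
        using sP_bd[of r] by blast
      then show ?thesis using class_S_montel[of "\<lambda>n. sP (u n)", OF sP_S] that by blast
    qed
    have Q'pt: "(\<lambda>n. sP (u (v n)) z) \<longlonglongrightarrow> Q' z" for z
      using tendsto_uniform_limitI[OF lim'[of "{z}"], of z] by simp
    have "Q' = Q \<or> Q' = (\<lambda>z. - Q z)"
    proof (rule ccontr)
      assume "\<not> (Q' = Q \<or> Q' = (\<lambda>z. - Q z))"
      then have "reflectionless_on H_lim (Sigma_ac (H 1))"
        using reflectionless_of_two_signed_limits[OF Q r Qpt Q', of "\<lambda>n. u (v n)" "\<lambda>n. s (u (v n))"]
          Q'pt strict_mono_o[OF u v] by (simp add: sP_def o_def)
      then show False using nr by contradiction
    qed
    moreover have "Q' \<noteq> (\<lambda>z. - Q z)"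
    proof
      assume eq: "Q' = (\<lambda>z. - Q z)"
      have "norm (Q' \<i> - Q \<i>) \<le> norm (Q' \<i> + Q \<i>)"
      proof (rule LIMSEQ_le)
        show "(\<lambda>n. norm (sP (u (v n)) \<i> - Q \<i>)) \<longlonglongrightarrow> norm (Q' \<i> - Q \<i>)"
          by (intro tendsto_intros Q'pt)
        show "(\<lambda>n. norm (sP (u (v n)) \<i> + Q \<i>)) \<longlonglongrightarrow> norm (Q' \<i> + Q \<i>)"
          by (intro tendsto_intros Q'pt)
      qed (use closer in blast)
      then have "norm (- Q \<i> - Q \<i>) \<le> 0" by (simp add: eq)
      then have "- Q \<i> - Q \<i> = 0" by simp
      then have "- (Q \<i> $ i $ j) - Q \<i> $ i $ j = 0" for i j
        by (metis vector_minus_component vector_uminus_component zero_index)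
      then have "Q \<i> $ i $ j = 0" for i j by (auto simp: complex_eq_iff dest: spec)
      then have "det (Q \<i>) = 0" by (simp add: det_2)
      then show False using Q by (simp add: class_S_def)
    qed
    ultimately have "uniform_limit K (\<lambda>n. sP (u (v n))) Q sequentially" using lim'[OF K] by simp
    then have "\<forall>\<^sub>F n in sequentially. \<forall>z\<in>K. dist (sP (u (v n)) z) (Q z) < e"
      using e by (rule uniform_limitD)
    then obtain n where "\<forall>z\<in>K. dist (sP (u (v n)) z) (Q z) < e"
      using eventually_happens' sequentially_bot by blast
    then show False using far by blast
  qed
  then show ?thesis using that[OF Q, of s] unfolding sP_def by blast
qed

text \<open>
  Signs of the products translate into signs of the factors: \<open>T n\<close> changes sign exactly if the signs
  of \<open>P n\<close> and \<open>P (n - 1)\<close> differ. The empty product must keep the sign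
  \<open>+\<close>, which is why \<open>t 0\<close> is set to \<open>True\<close>.
\<close>

lemma choice_of_signs:
  fixes s :: "nat \<Rightarrow> bool"
  assumes Q: "Q \<in> class_S"
    and lim: "\<And>K. compact K \<Longrightarrow> uniform_limit K (\<lambda>n z. if s n then P n z else - P n z) Q sequentially"
  shows "\<exists>T' T_lim. (\<forall>n\<ge>1. T' n = T n \<or> T' n = (\<lambda>z. - T n z)) \<and> T_lim \<in> class_S \<and>
           loc_uniform_limit UNIV (transfer_prod T') T_lim"
proof -
  define t where "t = (\<lambda>n. n = 0 \<or> s n)"
  define T' where "T' = (\<lambda>n z. if t n = t (n - 1) then T n z else - T n z)"
  have minus_mult: "(- A) ** B = - (A ** B)" "A ** (- B) = - (A ** B)" for A B :: "complex^2^2"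
    by (simp_all add: vec_eq_iff matrix_mult_2)
  have prod: "transfer_prod T' n z = (if t n then P n z else - P n z)" for n z
  proof (induction n)
    case 0 then show ?case by (simp add: t_def)
  next
    case (Suc n)
    then show ?case by (simp add: T'_def minus_mult)
  qed
  have "uniform_limit K (transfer_prod T') Q sequentially" if "compact K" for K
  proof (rule uniform_limit_cong[THEN iffD1, OF _ _ lim[OF that]])
    show "\<forall>\<^sub>F n in sequentially. \<forall>z\<in>K. (if s n then P n z else - P n z) = transfer_prod T' n z"
      using eventually_gt_at_top[of 0] by eventually_elim (simp add: prod t_def)
  qed simp
  then have "loc_uniform_limit UNIV (transfer_prod T') Q" by (rule loc_uniform_limit_UNIV_if_compact)
  moreover have "T' n = T n \<or> T' n = (\<lambda>z. - T n z)" for n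
    by (cases "t n = t (n - 1)") (simp_all add: T'_def)
  ultimately show ?thesis using Q by blast
qed

theorem dichotomy_if_expansion_bounded:
  assumes z: "Im z > 0" and bd: "\<And>n. expansion n z \<le> B"
  shows "reflectionless_on H_lim (Sigma_ac (H 1)) \<or>
         (\<exists>T' T_lim. (\<forall>n\<ge>1. T' n = T n \<or> T' n = (\<lambda>z. - T n z)) \<and> T_lim \<in> class_S \<and>
                     loc_uniform_limit UNIV (transfer_prod T') T_lim)"
proof (cases "reflectionless_on H_lim (Sigma_ac (H 1))")
  case nr: False
  obtain C where C: "\<And>n. norm (corner (P n z)) \<le> C"
    using corner_bounded_if_expansion_bounded[OF z bd] by blast
  have "\<exists>C. \<forall>n i j z. norm z \<le> r \<longrightarrow> norm (P n z $ i $ j) \<le> C" for r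
    by (rule class_S_locally_bounded[OF P_class_S z C])
  then obtain s Q where "Q \<in> class_S"
    "\<And>K. compact K \<Longrightarrow> uniform_limit K (\<lambda>n z. if s n then P n z else - P n z) Q sequentially"
    using signed_convergence[OF _ nr] by blast
  then have "\<exists>T' T_lim. (\<forall>n\<ge>1. T' n = T n \<or> T' n = (\<lambda>z. - T n z)) \<and> T_lim \<in> class_S \<and>
                     loc_uniform_limit UNIV (transfer_prod T') T_lim"
    by (rule choice_of_signs)
  then show ?thesis ..
qed simp

end

section \<open>Sequences of transformations: unbounded expansion\<close>

lemma herglotz_moebius_const:
  assumes S: "T \<in> class_S" and w: "Im w > 0"
  shows "herglotz (\<lambda>z. moebius_act (T z) w)"
  unfolding herglotz_def
proof
  have ent: "(\<lambda>z. T z $ i $ j) holomorphic_on upper_half_plane" for i j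
    using S unfolding class_S_def by (auto intro: holomorphic_on_subset)
  have "denom (T z) w \<noteq> 0" if "z \<in> upper_half_plane" for z
    using that by (intro uhp_contractiveD(1)[OF class_S_contractive[OF S] w]) simp
  then show "(\<lambda>z. moebius_act (T z) w) holomorphic_on upper_half_plane"
    unfolding moebius_act_def by (intro holomorphic_intros ent)
  show "(\<lambda>z. moebius_act (T z) w) ` upper_half_plane \<subseteq> upper_half_plane"
    using S w unfolding class_S_def by auto
qed

lemma Im_minus_cnj: "Im (- cnj w) = Im w"
  by simp

lemma set_integral_cnj: "(LINT x:A|M. cnj (f x)) = cnj (LINT x:A|M. f x)"
  using Bochner_Integration.integral_cnj[of M "\<lambda>x. indicator A x *\<^sub>R f x"]
  by (simp only: set_lebesgue_integral_def complex_cnj_scaleR)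

lemma measurable_cnj:
  "f \<in> borel_measurable borel \<Longrightarrow> (\<lambda>x. cnj (f x)) \<in> borel_measurable borel"
  by (rule borel_measurable_continuous_on[where f = cnj]) (intro continuous_intros)

context transfer_sequence
begin

text \<open>
  Denominators at two points are comparable with a constant independent of \<open>n\<close>, because their zero
  stays outside the upper half plane; and at \<open>m_minus (H 1) z\<close> the growth of \<open>expansion\<close>
  must come from the denominator, as the imaginary parts stay bounded.
\<close>

lemma denom_at_top:
  assumes z: "Im z > 0" and w: "Im w > 0" and unb: "\<not> (\<exists>B. \<forall>n. expansion n z \<le> B)"
  shows "filterlim (\<lambda>n. norm (denom (P n z) w)) at_top sequentially"
proof -
  let ?m = "\<lambda>n. m_minus (H (Suc n)) z"
  let ?w0 = "m_minus (H 1) z"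
  \<comment> \<open>the constant by which the two denominators are comparable\<close>
  define \<kappa> where "\<kappa> = 1 + norm (?w0 - w) / Im w"
  have \<kappa>: "\<kappa> \<ge> 1" using w by (simp add: \<kappa>_def)
  have "Bseq ?m" using m_minus_tendsto[OF z] convergentI convergent_imp_Bseq by blast
  then obtain L where L0: "L > 0" and L: "\<And>n. norm (?m n) \<le> L" unfolding Bseq_def by blast
  have D0: "norm (denom (P n z) ?w0) \<le> \<kappa> * norm (denom (P n z) w)" for n
  proof -
    have "norm (P n z $ 2 $ 1) * Im w \<le> norm (denom (P n z) w)"
      by (rule coeff_le_of_zero_free[OF uhp_contractiveD(1)[OF class_S_contractive[OF P_class_S z]] w])
    then have c: "norm (P n z $ 2 $ 1) \<le> norm (denom (P n z) w) / Im w" using w by (simp add: pos_le_divide_eq)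
    have "denom (P n z) ?w0 = denom (P n z) w + P n z $ 2 $ 1 * (?w0 - w)" by (simp add: algebra_simps)
    then have "norm (denom (P n z) ?w0) \<le> norm (denom (P n z) w) + norm (P n z $ 2 $ 1) * norm (?w0 - w)"
      by (metis norm_triangle_ineq norm_mult)
    also have "\<dots> \<le> norm (denom (P n z) w) + norm (denom (P n z) w) / Im w * norm (?w0 - w)"
      by (intro add_left_mono mult_right_mono c) simp
    also have "\<dots> = \<kappa> * norm (denom (P n z) w)" by (simp add: \<kappa>_def distrib_right)
    finally show ?thesis .
  qed
  show ?thesis
    unfolding filterlim_at_top_ge[where c = 0]
  proof (intro allI impI)
    fix Z :: real assume Z: "0 \<le> Z"
    obtain n0 where n0: "expansion n0 z > L * (\<kappa> * Z)\<^sup>2" using unb by (meson not_le)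
    show "\<forall>\<^sub>F n in sequentially. Z \<le> norm (denom (P n z) w)"
      using eventually_ge_at_top[of n0]
    proof eventually_elim
      case (elim n)
      let ?D = "norm (denom (P n z) w)"
      have "L * (\<kappa> * Z)\<^sup>2 \<le> expansion n z"
        using n0 incseqD[OF expansion_incseq[OF z] elim] by linarith
      also have "\<dots> \<le> L * (\<kappa> * ?D)\<^sup>2"
        unfolding expansion_def using L0 order_trans[OF Im_le_norm L]
        by (intro mult_mono power_mono D0) auto
      finally have "(\<kappa> * Z)\<^sup>2 \<le> (\<kappa> * ?D)\<^sup>2" using L0 by simp
      then have "\<kappa> * Z \<le> \<kappa> * ?D" by (rule power2_le_imp_le) (use \<kappa> in simp)
      then show "Z \<le> ?D" using \<kappa> by simp
    qed
  qed
qed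

lemma contraction_to_zero:
  assumes z: "Im z > 0" and w: "Im w > 0" and v: "Im v > 0" and unb: "\<not> (\<exists>B. \<forall>n. expansion n z \<le> B)"
  shows "(\<lambda>n. cayley (moebius_act (P n z) w) - cayley (moebius_act (P n z) v)) \<longlonglongrightarrow> 0"
proof (rule Lim_null_comparison)
  have inv: "(\<lambda>n. inverse (norm (denom (P n z) u))) \<longlonglongrightarrow> 0" if "Im u > 0" for u
    by (rule filterlim_compose[OF tendsto_inverse_0_at_top[OF filterlim_ident] denom_at_top[OF z that unb]])
  have "(\<lambda>n. 2 * norm (w - v) * (inverse (norm (denom (P n z) w)) * inverse (norm (denom (P n z) v)))) \<longlonglongrightarrow> 2 * norm (w - v) * (0 * 0)"
    by (intro tendsto_intros inv w v)
  then show "(\<lambda>n. 2 * norm (w - v) * (inverse (norm (denom (P n z) w)) * inverse (norm (denom (P n z) v)))) \<longlonglongrightarrow> 0"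
    by simp
  show "\<forall>\<^sub>F n in sequentially. norm (cayley (moebius_act (P n z) w) - cayley (moebius_act (P n z) v))
      \<le> 2 * norm (w - v) * (inverse (norm (denom (P n z) w)) * inverse (norm (denom (P n z) v)))"
  proof (intro always_eventually allI)
    fix n
    note contr = class_S_contractive[OF P_class_S z, of n]
    note Dw = uhp_contractiveD(1)[OF contr w] and Dv = uhp_contractiveD(1)[OF contr v]
    let ?a = "moebius_act (P n z) w" and ?b = "moebius_act (P n z) v"
    have a: "Im ?a > 0" by (rule uhp_contractiveD(3)[OF contr w])
    have b: "Im ?b > 0" by (rule uhp_contractiveD(3)[OF contr v])
    have "1 \<le> norm (?a + \<i>)" "1 \<le> norm (?b + \<i>)"
      using a b Im_le_norm[of "?a + \<i>"] Im_le_norm[of "?b + \<i>"] by simp_all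
    then have "1 * 1 \<le> norm (?a + \<i>) * norm (?b + \<i>)" by (intro mult_mono) auto
    then have "2 * norm (?a - ?b) / (norm (?a + \<i>) * norm (?b + \<i>)) \<le> 2 * norm (?a - ?b) / 1"
      by (intro divide_left_mono) auto
    moreover have "cayley ?a - cayley ?b = 2 * \<i> * (?a - ?b) / ((?a + \<i>) * (?b + \<i>))"
      using a b by (intro cayley_diff) simp_all
    ultimately have "norm (cayley ?a - cayley ?b) \<le> 2 * norm (?a - ?b)"
      by (simp only: norm_mult norm_divide norm_ii norm_numeral mult_1_right div_by_1)
    also have "?a - ?b = (w - v) / (denom (P n z) w * denom (P n z) v)"
      using contr by (intro moebius_diff Dw Dv) (simp add: uhp_contractive_def)
    also have "2 * norm \<dots> = 2 * norm (w - v) * (inverse (norm (denom (P n z) w)) * inverse (norm (denom (P n z) v)))"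
      by (simp only: norm_divide norm_mult divide_inverse inverse_mult_distrib mult.assoc norm_inverse)
    finally show "norm (cayley ?a - cayley ?b)
        \<le> 2 * norm (w - v) * (inverse (norm (denom (P n z) w)) * inverse (norm (denom (P n z) v)))" .
  qed
qed

lemma boundary_minus:
  assumes q: "has_boundary_value (m_minus (H 1)) x q" "Im q > 0"
  shows "bv (\<lambda>z. cayley (m_minus (H (Suc n)) z)) x = cayley (moebius_act (P n (of_real x)) q)"
proof (rule bv_eq)
  have re: "\<And>i j. P n (of_real x) $ i $ j \<in> \<real>" and det: "det (P n (of_real x)) = 1"
    using P_class_S[of n] by (auto simp: class_S_def)
  have "((\<lambda>y. cayley (moebius_act (P n (Complex x y)) (m_minus (H 1) (Complex x y))))
      \<longlongrightarrow> cayley (moebius_act (P n (of_real x)) q)) (at_right 0)"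
    using real_moebius_Im_pos[OF re det q(2)] q
    by (intro cayley_tendsto moebius_boundary_value[OF P_class_S q(1)]) auto
  then show "has_boundary_value (\<lambda>z. cayley (m_minus (H (Suc n)) z)) x (cayley (moebius_act (P n (of_real x)) q))"
    unfolding has_boundary_value_def
  proof (rule Lim_transform_eventually)
    show "\<forall>\<^sub>F y in at_right 0. cayley (moebius_act (P n (Complex x y)) (m_minus (H 1) (Complex x y)))
        = cayley (m_minus (H (Suc n)) (Complex x y))"
      using eventually_Complex_uhp[of x] by eventually_elim (simp only: orbit_minus(2))
  qed
qed

lemma boundary_plus:
  assumes p: "has_boundary_value (m_plus (H 1)) x p" "Im p > 0"
  shows "cnj (bv (\<lambda>z. cayley (m_plus (H (Suc n)) z)) x) = cayley (moebius_act (P n (of_real x)) (- cnj p))"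
proof -
  have re: "\<And>i j. P n (of_real x) $ i $ j \<in> \<real>" and det: "det (P n (of_real x)) = 1"
    using P_class_S[of n] by (auto simp: class_S_def)
  let ?e = "moebius_act (P n (of_real x)) (- cnj p)"
  have e: "Im ?e > 0" using p(2) by (intro real_moebius_Im_pos[OF re det]) simp
  have refl: "moebius_act (P n (of_real x)) (- p) = cnj ?e"
    using moebius_act_real_cnj[OF re, of "- cnj p"] by simp
  have "((\<lambda>y. - m_plus (H 1) (Complex x y)) \<longlongrightarrow> - p) (at_right 0)"
    using p(1) unfolding has_boundary_value_def by (rule tendsto_minus)
  then have "((\<lambda>y. moebius_act (P n (Complex x y)) (- m_plus (H 1) (Complex x y))) \<longlongrightarrow> cnj ?e) (at_right 0)"
    unfolding refl[symmetric] using p(2)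
    by (intro moebius_boundary_value[OF P_class_S, of "\<lambda>z. - m_plus (H 1) z"]) (simp_all add: has_boundary_value_def)
  then have "((\<lambda>y. - moebius_act (P n (Complex x y)) (- m_plus (H 1) (Complex x y))) \<longlongrightarrow> - cnj ?e) (at_right 0)"
    by (rule tendsto_minus)
  then have lim: "((\<lambda>y. cayley (- moebius_act (P n (Complex x y)) (- m_plus (H 1) (Complex x y)))) \<longlongrightarrow> cayley (- cnj ?e)) (at_right 0)"
    using e by (intro cayley_tendsto) simp_all
  have "has_boundary_value (\<lambda>z. cayley (m_plus (H (Suc n)) z)) x (cayley (- cnj ?e))"
    unfolding has_boundary_value_def
  proof (rule Lim_transform_eventually[OF lim])
    show "\<forall>\<^sub>F y in at_right 0. cayley (- moebius_act (P n (Complex x y)) (- m_plus (H 1) (Complex x y)))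
        = cayley (m_plus (H (Suc n)) (Complex x y))"
      using eventually_Complex_uhp[of x] by eventually_elim (simp only: orbit_plus(2) minus_minus)
  qed
  then have "bv (\<lambda>z. cayley (m_plus (H (Suc n)) z)) x = cayley (- cnj ?e)" by (rule bv_eq)
  then show ?thesis by (simp add: cayley_cnj)
qed

lemma boundary_const:
  assumes w: "Im w1 > 0" "Im w2 > 0"
  shows "bv (\<lambda>z. cayley (moebius_act (P n z) w1) - cayley (moebius_act (P n z) w2)) x
       = cayley (moebius_act (P n (of_real x)) w1) - cayley (moebius_act (P n (of_real x)) w2)"
proof (rule bv_eq)
  have re: "\<And>i j. P n (of_real x) $ i $ j \<in> \<real>" and det: "det (P n (of_real x)) = 1"
    using P_class_S[of n] by (auto simp: class_S_def)
  have *: "((\<lambda>y. cayley (moebius_act (P n (Complex x y)) u)) \<longlongrightarrow> cayley (moebius_act (P n (of_real x)) u)) (at_right 0)"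
    if u: "Im u > 0" for u
    using real_moebius_Im_pos[OF re det u] u
    by (intro cayley_tendsto moebius_boundary_value[OF P_class_S, of "\<lambda>_. u"]) (auto simp: has_boundary_value_def)
  show "has_boundary_value (\<lambda>z. cayley (moebius_act (P n z) w1) - cayley (moebius_act (P n z) w2)) x
      (cayley (moebius_act (P n (of_real x)) w1) - cayley (moebius_act (P n (of_real x)) w2))"
    unfolding has_boundary_value_def by (intro tendsto_diff * w)
qed

lemma herglotz_Suc: "herglotz (m_minus (H (Suc n)))" "herglotz (m_plus (H (Suc n)))"
  using pair[of "Suc n"] by (simp_all add: herglotz_pair_def)

lemma herglotz_lim: "herglotz (m_minus H_lim)" "herglotz (m_plus H_lim)"
  using pair_lim by (simp_all add: herglotz_pair_def)

text \<open>
  Where \<open>m_minus H_lim\<close> and \<open>- cnj (m_plus H_lim)\<close> have boundary values, this is the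
  difference of their Cayley transforms, by \<open>cayley_cnj\<close>. The Cayley transform makes all functions
  bounded, as weak convergence requires.
\<close>

definition defect :: "real \<Rightarrow> complex" where
  "defect x = bv (\<lambda>z. cayley (m_minus H_lim z)) x - cnj (bv (\<lambda>z. cayley (m_plus H_lim z)) x)"

text \<open>
  Up to a null set the part of \<open>Sigma_ac (H 1)\<close> on which the boundary values of
  \<open>m_minus (H 1)\<close> and \<open>- cnj (m_plus (H 1))\<close> are within pseudo-hyperbolic distance
  \<open>\<epsilon>\<close> of \<open>w1\<close> and \<open>w2\<close>.
\<close>

definition cell :: "real \<Rightarrow> complex \<Rightarrow> complex \<Rightarrow> real set" where
  "cell \<epsilon> w1 w2 = {x. Im (bv (m_minus (H 1)) x) > 0 \<and> Im (bv (m_plus (H 1)) x) > 0 \<and>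
     norm (bv (m_minus (H 1)) x - w1) < \<epsilon> * norm (bv (m_minus (H 1)) x - cnj w1) \<and>
     norm (- cnj (bv (m_plus (H 1)) x) - w2) < \<epsilon> * norm (- cnj (bv (m_plus (H 1)) x) - cnj w2)}"

lemma cell_measurable: "cell \<epsilon> w1 w2 \<in> sets borel"
proof -
  have [measurable]: "bv (m_minus (H 1)) \<in> borel_measurable borel" "bv (m_plus (H 1)) \<in> borel_measurable borel"
    using pair[of 1] by (auto simp: herglotz_pair_def herglotz_def intro: bv_measurable)
  have [measurable]: "(\<lambda>x. cnj (bv (m_plus (H 1)) x)) \<in> borel_measurable borel"
    by (intro measurable_cnj) measurable
  show ?thesis unfolding cell_def by measurable
qed

text \<open>
  \<open>P n x\<close> is a hyperbolic isometry, so the approximation on the cell does not deteriorate as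
  \<open>n\<close> grows.
\<close>

lemma cell_pointwise:
  assumes w: "Im w1 > 0" "Im w2 > 0" and x: "x \<in> cell \<epsilon> w1 w2"
    and m: "has_boundary_value (m_minus (H 1)) x (bv (m_minus (H 1)) x)"
    and p: "has_boundary_value (m_plus (H 1)) x (bv (m_plus (H 1)) x)"
  shows "norm (bv (\<lambda>z. cayley (m_minus (H (Suc n)) z)) x - cnj (bv (\<lambda>z. cayley (m_plus (H (Suc n)) z)) x)
      - bv (\<lambda>z. cayley (moebius_act (P n z) w1) - cayley (moebius_act (P n z) w2)) x) \<le> 4 * \<epsilon>"
proof -
  define q where "q = bv (m_minus (H 1)) x"
  define e where "e = - cnj (bv (m_plus (H 1)) x)"
  define A where "A = P n (of_real x)"
  have re: "\<And>i j. A $ i $ j \<in> \<real>" and det: "det A = 1"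
    using P_class_S[of n] by (auto simp: class_S_def A_def)
  have q: "Im q > 0" "norm (q - w1) < \<epsilon> * norm (q - cnj w1)"
    and e: "Im e > 0" "norm (e - w2) < \<epsilon> * norm (e - cnj w2)"
    and bp: "Im (bv (m_plus (H 1)) x) > 0"
    using x by (simp_all add: cell_def q_def e_def)
  have close: "norm (cayley (moebius_act A u) - cayley (moebius_act A v)) \<le> 2 * \<epsilon>"
    if "Im u > 0" "Im v > 0" "norm (u - v) < \<epsilon> * norm (u - cnj v)" for u v
  proof -
    have pos: "norm (u - cnj v) > 0" using that(1,2) by (auto simp: complex_eq_iff)
    have "norm (cayley (moebius_act A u) - cayley (moebius_act A v))
        \<le> 2 * (norm (moebius_act A u - moebius_act A v) / norm (moebius_act A u - cnj (moebius_act A v)))"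
      by (intro cayley_diff_le real_moebius_Im_pos[OF re det] that)
    also have "\<dots> = 2 * (norm (u - v) / norm (u - cnj v))"
      by (simp only: real_moebius_pseudo_distance[OF re det that(1,2)])
    also have "\<dots> \<le> 2 * \<epsilon>" using that(3) pos by (simp add: pos_divide_le_eq)
    finally show ?thesis .
  qed
  have b1: "bv (\<lambda>z. cayley (m_minus (H (Suc n)) z)) x = cayley (moebius_act A q)"
    unfolding A_def q_def by (rule boundary_minus[OF m q(1)[unfolded q_def]])
  have b2: "cnj (bv (\<lambda>z. cayley (m_plus (H (Suc n)) z)) x) = cayley (moebius_act A e)"
    unfolding A_def e_def by (rule boundary_plus[OF p bp])
  have "norm ((cayley (moebius_act A q) - cayley (moebius_act A w1)) - (cayley (moebius_act A e) - cayley (moebius_act A w2)))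
      \<le> 2 * \<epsilon> + 2 * \<epsilon>"
    by (rule order_trans[OF norm_triangle_ineq4 add_mono[OF close[OF q(1) w(1) q(2)] close[OF e(1) w(2) e(2)]]])
  moreover have eq: "cayley (moebius_act A q) - cayley (moebius_act A e) - (cayley (moebius_act A w1) - cayley (moebius_act A w2))
     = (cayley (moebius_act A q) - cayley (moebius_act A w1)) - (cayley (moebius_act A e) - cayley (moebius_act A w2))"
    by simp
  ultimately show ?thesis unfolding b1 b2 boundary_const[OF w] A_def[symmetric] eq by linarith
qed

text \<open>
  Weak limit of the preceding estimate over subsets of the cell: the first two terms converge to
  \<open>defect\<close>, and the third one, which compares the images of two fixed points, converges to 0 because
  \<open>P n\<close> collapses the upper half plane.
\<close>

lemma defect_small_on_cell:
  assumes unb: "\<And>z. Im z > 0 \<Longrightarrow> \<not> (\<exists>B. \<forall>n. expansion n z \<le> B)"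
    and w: "Im w1 > 0" "Im w2 > 0"
  shows "AE x in lborel. x \<in> cell \<epsilon> w1 w2 \<longrightarrow> norm (defect x) \<le> 2 * (4 * \<epsilon>)"
proof -
  let ?u = "\<lambda>n z. cayley (m_minus (H (Suc n)) z)" and ?v = "\<lambda>n z. cayley (m_plus (H (Suc n)) z)"
  let ?ul = "\<lambda>z. cayley (m_minus H_lim z)" and ?vl = "\<lambda>z. cayley (m_plus H_lim z)"
  let ?f = "\<lambda>n z. cayley (moebius_act (P n z) w1) - cayley (moebius_act (P n z) w2)"
  let ?A = "cell \<epsilon> w1 w2"
  have u: "?u n holomorphic_on upper_half_plane" "\<And>z. Im z > 0 \<Longrightarrow> norm (?u n z) \<le> 1" for n
    by (rule cayley_herglotz_holomorphic[OF herglotz_Suc(1)], rule norm_cayley_herglotz_le_1[OF herglotz_Suc(1)])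
  have v: "?v n holomorphic_on upper_half_plane" "\<And>z. Im z > 0 \<Longrightarrow> norm (?v n z) \<le> 1" for n
    by (rule cayley_herglotz_holomorphic[OF herglotz_Suc(2)], rule norm_cayley_herglotz_le_1[OF herglotz_Suc(2)])
  have ul: "?ul holomorphic_on upper_half_plane" "\<And>z. Im z > 0 \<Longrightarrow> norm (?ul z) \<le> 1"
    by (rule cayley_herglotz_holomorphic[OF herglotz_lim(1)], rule norm_cayley_herglotz_le_1[OF herglotz_lim(1)])
  have vl: "?vl holomorphic_on upper_half_plane" "\<And>z. Im z > 0 \<Longrightarrow> norm (?vl z) \<le> 1"
    by (rule cayley_herglotz_holomorphic[OF herglotz_lim(2)], rule norm_cayley_herglotz_le_1[OF herglotz_lim(2)])
  have fh: "herglotz (\<lambda>z. moebius_act (P n z) w1)" "herglotz (\<lambda>z. moebius_act (P n z) w2)" for n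
    by (intro herglotz_moebius_const P_class_S w)+
  have f1: "?f n holomorphic_on upper_half_plane" for n
    by (intro holomorphic_on_diff cayley_herglotz_holomorphic fh)
  have f2: "norm (?f n z) \<le> 2" if "Im z > 0" for n z
    using order_trans[OF norm_triangle_ineq4 add_mono[OF norm_cayley_herglotz_le_1[OF fh(1) that, of n]
        norm_cayley_herglotz_le_1[OF fh(2) that, of n]]] by simp
  have ulim: "(\<lambda>n. ?u n z) \<longlonglongrightarrow> ?ul z" if "Im z > 0" for z
    using Im_m_pos(2)[OF pair_lim that] by (intro cayley_tendsto m_minus_tendsto that) simp
  have vlim: "(\<lambda>n. ?v n z) \<longlonglongrightarrow> ?vl z" if "Im z > 0" for z
    using Im_m_pos(1)[OF pair_lim that] by (intro cayley_tendsto m_plus_tendsto that) simp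
  have flim: "(\<lambda>n. ?f n z) \<longlonglongrightarrow> 0" if "Im z > 0" for z
    by (rule contraction_to_zero[OF that w unb[OF that]])
  have good: "AE x in lborel. has_boundary_value (m_minus (H 1)) x (bv (m_minus (H 1)) x)
      \<and> has_boundary_value (m_plus (H 1)) x (bv (m_plus (H 1)) x)"
    using herglotz_boundary_values[OF herglotz_Suc(1)[of 0]] herglotz_boundary_values[OF herglotz_Suc(2)[of 0]]
    by eventually_elim (use has_bv in auto)
  show ?thesis
  proof (rule AE_norm_le_of_set_integrals[where C = 2])
    show "defect \<in> borel_measurable borel"
      unfolding defect_def by (intro borel_measurable_diff measurable_cnj bv_measurable ul vl)
    have "AE x in lborel. norm (bv ?ul x) \<le> 1" "AE x in lborel. norm (bv ?vl x) \<le> 1"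
      by (rule bv_bounded[OF ul], assumption, rule bv_bounded[OF vl], assumption)
    then show "AE x in lborel. norm (defect x) \<le> 2"
    proof eventually_elim
      case (elim x)
      have "norm (defect x) \<le> norm (bv ?ul x) + norm (cnj (bv ?vl x))"
        unfolding defect_def by (rule norm_triangle_ineq4)
      then show ?case using elim by simp
    qed
    show "?A \<in> sets borel" by (rule cell_measurable)
    fix E and N :: real assume E: "E \<in> sets borel" "E \<subseteq> ?A" and N: "N \<ge> 0"
    let ?B = "E \<inter> {-N..N}"
    have Bb: "?B \<in> sets borel" using E by auto
    have si: "set_integrable lborel ?B (bv g)"
      if "g holomorphic_on upper_half_plane" "\<And>z. Im z > 0 \<Longrightarrow> norm (g z) \<le> C" for g C
    proof (rule bounded_set_integrable[OF bv_measurable[OF that(1)] Bb emeasure_bounded_part])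
      show "AE x in lborel. norm (bv g x) \<le> C" by (rule bv_bounded[OF that])
    qed
    have sic: "set_integrable lborel ?B (\<lambda>x. cnj (bv g x))"
      if "g holomorphic_on upper_half_plane" "\<And>z. Im z > 0 \<Longrightarrow> norm (g z) \<le> C" for g C
    proof (rule bounded_set_integrable[OF measurable_cnj[OF bv_measurable[OF that(1)]] Bb emeasure_bounded_part])
      have "AE x in lborel. norm (bv g x) \<le> C" by (rule bv_bounded[OF that])
      then show "AE x in lborel. norm (cnj (bv g x)) \<le> C" by simp
    qed
    let ?I = "\<lambda>g. LINT x:?B|lborel. bv g x"
    have "(\<lambda>n. ?I (?u n)) \<longlonglongrightarrow> ?I ?ul"
      by (rule weak_convergence[OF u ul ulim N E(1)])
    moreover have "(\<lambda>n. cnj (?I (?v n))) \<longlonglongrightarrow> cnj (?I ?vl)"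
      by (rule tendsto_cnj, rule weak_convergence[OF v vl vlim N E(1)])
    moreover have "(\<lambda>n. ?I (?f n)) \<longlonglongrightarrow> ?I (\<lambda>_. 0)"
      by (rule weak_convergence[where C = 2, OF f1 f2 _ _ flim N E(1)]) simp_all
    ultimately have lim: "(\<lambda>n. ?I (?u n) - cnj (?I (?v n)) - ?I (?f n)) \<longlonglongrightarrow> ?I ?ul - cnj (?I ?vl) - ?I (\<lambda>_. 0)"
      by (intro tendsto_diff)
    have comb: "?I (?u n) - cnj (?I (?v n)) - ?I (?f n) = (LINT x:?B|lborel. bv (?u n) x - cnj (bv (?v n) x) - bv (?f n) x)" for n
    proof -
      have i: "set_integrable lborel ?B (bv (?u n))" "set_integrable lborel ?B (\<lambda>x. cnj (bv (?v n) x))"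
        "set_integrable lborel ?B (bv (?f n))"
        by (rule si[OF u], assumption, rule sic[OF v], assumption, rule si[OF f1 f2], assumption)
      show ?thesis
        unfolding set_integral_diff(2)[OF set_integral_diff(1)[OF i(1,2)] i(3)] set_integral_diff(2)[OF i(1,2)] set_integral_cnj ..
    qed
    have bound: "norm (?I (?u n) - cnj (?I (?v n)) - ?I (?f n)) \<le> 4 * \<epsilon> * measure lborel ?B" for n
      unfolding comb
    proof (rule norm_set_integral_le[OF _ Bb emeasure_bounded_part])
      show "(\<lambda>x. bv (?u n) x - cnj (bv (?v n) x) - bv (?f n) x) \<in> borel_measurable borel"
        by (intro borel_measurable_diff measurable_cnj bv_measurable u v f1)
      show "AE x in lborel. x \<in> ?B \<longrightarrow> norm (bv (?u n) x - cnj (bv (?v n) x) - bv (?f n) x) \<le> 4 * \<epsilon>"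
        using good
      proof eventually_elim
        case (elim x)
        show ?case
        proof
          assume "x \<in> ?B"
          then have "x \<in> ?A" using E(2) by blast
          then show "norm (bv (?u n) x - cnj (bv (?v n) x) - bv (?f n) x) \<le> 4 * \<epsilon>"
            using elim by (intro cell_pointwise[OF w]) auto
        qed
      qed
    qed
    have "norm (?I ?ul - cnj (?I ?vl) - ?I (\<lambda>_. 0)) \<le> 4 * \<epsilon> * measure lborel ?B"
      by (rule LIMSEQ_le_const2[OF tendsto_norm[OF lim]]) (use bound in blast)
    moreover have "?I (\<lambda>_. 0) = 0" by (simp add: bv_def set_lebesgue_integral_def)
    moreover have "(LINT x:?B|lborel. defect x) = ?I ?ul - cnj (?I ?vl)"
    proof -
      have i: "set_integrable lborel ?B (bv ?ul)" "set_integrable lborel ?B (\<lambda>x. cnj (bv ?vl x))"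
        by (rule si[OF ul], assumption, rule sic[OF vl], assumption)
      show ?thesis unfolding defect_def set_integral_diff(2)[OF i] set_integral_cnj ..
    qed
    ultimately show "norm (LINT x:?B|lborel. defect x) \<le> 4 * \<epsilon> * measure lborel ?B" by simp
  qed
qed

text \<open>
  For each \<open>\<epsilon>\<close> countably many cells, with centres in a dense set, cover
  \<open>Sigma_ac (H 1)\<close>. Hence the \<open>defect\<close> is 0 almost everywhere on this set, and the
  Cayley transform is injective.
\<close>

theorem reflectionless_if_expansion_unbounded:
  assumes unb: "\<And>z. Im z > 0 \<Longrightarrow> \<not> (\<exists>B. \<forall>n. expansion n z \<le> B)"
  shows "reflectionless_on H_lim (Sigma_ac (H 1))"
proof -
  obtain D :: "complex set" where D: "countable D" "\<And>X. open X \<Longrightarrow> X \<noteq> {} \<Longrightarrow> \<exists>d\<in>D. d \<in> X"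
    using countable_dense_exists by blast
  define D' where "D' = D \<inter> upper_half_plane"
  have D': "countable D'" using D(1) by (simp add: D'_def)
  have near: "\<exists>w\<in>D'. norm (q - w) < \<epsilon> * norm (q - cnj w)" if q: "Im q > 0" and \<epsilon>: "\<epsilon> > 0" for q \<epsilon>
  proof -
    let ?X = "ball q (\<epsilon> * Im q) \<inter> upper_half_plane"
    have "open ?X" by (intro open_Int open_ball open_uhp)
    moreover have "q \<in> ?X" using q \<epsilon> by simp
    then have "?X \<noteq> {}" by blast
    ultimately obtain w where w: "w \<in> D" "w \<in> ?X" using D(2)[of ?X] by blast
    have "Im q \<le> Im (q - cnj w)" using w(2) by simp
    then have "Im q \<le> norm (q - cnj w)" by (rule order_trans[OF _ Im_le_norm])
    then have "\<epsilon> * Im q \<le> \<epsilon> * norm (q - cnj w)" using \<epsilon> by simp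
    moreover have "norm (q - w) < \<epsilon> * Im q" using w(2) by (simp add: dist_norm)
    ultimately have "norm (q - w) < \<epsilon> * norm (q - cnj w)" by (rule less_le_trans[rotated])
    then show ?thesis using w by (intro bexI[of _ w]) (simp_all add: D'_def)
  qed
  have "AE x in lborel. \<forall>k::nat. \<forall>w1\<in>D'. \<forall>w2\<in>D'. x \<in> cell (inverse (real (Suc k))) w1 w2
      \<longrightarrow> norm (defect x) \<le> 2 * (4 * inverse (real (Suc k)))"
    unfolding AE_all_countable AE_ball_countable[OF D']
  proof (intro allI ballI)
    fix k :: nat and w1 w2 assume "w1 \<in> D'" "w2 \<in> D'"
    then have w: "Im w1 > 0" "Im w2 > 0" by (simp_all add: D'_def)
    show "AE x in lborel. x \<in> cell (inverse (real (Suc k))) w1 w2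
      \<longrightarrow> norm (defect x) \<le> 2 * (4 * inverse (real (Suc k)))"
      by (rule defect_small_on_cell[OF _ w]) (rule unb)
  qed
  then show ?thesis
    unfolding reflectionless_on_def
    using herglotz_boundary_values[OF herglotz_lim(1)] herglotz_boundary_values[OF herglotz_lim(2)]
  proof eventually_elim
    case (elim x)
    show ?case
    proof
      assume "x \<in> Sigma_ac (H 1)"
      then obtain p q where pq: "has_boundary_value (m_plus (H 1)) x p" "has_boundary_value (m_minus (H 1)) x q"
        "Im p > 0" "Im q > 0"
        unfolding Sigma_ac_def mem_Collect_eq by blast
      have bvs: "bv (m_plus (H 1)) x = p" "bv (m_minus (H 1)) x = q"
        by (rule bv_eq[OF pq(1)], rule bv_eq[OF pq(2)])
      have small: "norm (defect x) \<le> 8 * inverse (real (Suc k))" for k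
      proof -
        have \<epsilon>: "inverse (real (Suc k)) > 0" by simp
        obtain w1 where w1: "w1 \<in> D'" "norm (q - w1) < inverse (real (Suc k)) * norm (q - cnj w1)"
          using near[OF pq(4) \<epsilon>] by blast
        obtain w2 where w2: "w2 \<in> D'" "norm (- cnj p - w2) < inverse (real (Suc k)) * norm (- cnj p - cnj w2)"
          using near[OF _ \<epsilon>, of "- cnj p"] pq(3) by (simp only: Im_minus_cnj) blast
        have "x \<in> cell (inverse (real (Suc k))) w1 w2"
          unfolding cell_def mem_Collect_eq bvs by (intro conjI pq w1 w2)
        then have "norm (defect x) \<le> 2 * (4 * inverse (real (Suc k)))"
          by (rule elim(1)[rule_format, OF w1(1) w2(1)])
        then show ?thesis by simp
      qed
      have "(\<lambda>k. 8 * inverse (real (Suc k))) \<longlonglongrightarrow> 8 * 0"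
        by (intro tendsto_intros LIMSEQ_inverse_real_of_nat)
      then have "norm (defect x) \<le> 8 * 0"
        by (rule LIMSEQ_le_const) (intro exI allI impI small)
      then have d0: "defect x = 0" by simp
      obtain q' where q': "has_boundary_value (m_minus H_lim) x q'" using elim(2) by blast
      obtain p' where p': "has_boundary_value (m_plus H_lim) x p'" using elim(3) by blast
      have nonneg: "Im b \<ge> 0" if "has_boundary_value F x b" "herglotz F" for F b
      proof (rule tendsto_lowerbound[OF tendsto_Im[OF that(1)[unfolded has_boundary_value_def]]])
        show "\<forall>\<^sub>F y in at_right 0. 0 \<le> Im (F (Complex x y))"
          using eventually_Complex_uhp[of x] by eventually_elim (rule less_imp_le, rule herglotz_Im_pos[OF that(2)])
      qed simp
      have Imq: "Im q' \<ge> 0" by (rule nonneg[OF q' herglotz_lim(1)])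
      have Imp: "Im p' \<ge> 0" by (rule nonneg[OF p' herglotz_lim(2)])
      have bv_cayley: "bv (\<lambda>z. cayley (F z)) x = cayley b" if "has_boundary_value F x b" "Im b \<ge> 0" for F b
        using cayley_tendsto[OF that[unfolded has_boundary_value_def]]
        by (intro bv_eq) (simp only: has_boundary_value_def)
      have "defect x = cayley q' - cayley (- cnj p')"
        by (simp only: defect_def bv_cayley[OF q' Imq] bv_cayley[OF p' Imp] cayley_cnj)
      then have "cayley q' - cayley (- cnj p') = 0" using d0 by (simp only:)
      then have eq: "cayley q' = cayley (- cnj p')" by (simp only: right_minus_eq)
      have Imp': "Im (- cnj p') \<ge> 0" using Imp by simp
      have "q' = - cnj p'" by (rule cayley_inj[OF Imq Imp' eq])
      then have "p' = - cnj q'" by (simp only: complex_cnj_minus complex_cnj_cnj minus_minus)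
      then show "\<exists>p q. has_boundary_value (m_plus H_lim) x p \<and> has_boundary_value (m_minus H_lim) x q \<and> p = - cnj q"
        by (intro exI[of _ p'] exI[of _ q'] conjI p' q')
    qed
  qed
qed

end

theorem theorem4p3:
  fixes H :: "nat \<Rightarrow> m_pair" and H_lim :: m_pair
    and T :: "nat \<Rightarrow> complex \<Rightarrow> complex^2^2"
  assumes "\<And>n. n \<ge> 1 \<Longrightarrow> herglotz_pair (H n)"
    and "herglotz_pair H_lim"
    and "\<And>n. n \<ge> 1 \<Longrightarrow> type_S_via (T n) (H n) (H (n + 1))"
    and "loc_uniform_limit upper_half_plane (\<lambda>n. m_plus (H n)) (m_plus H_lim)"
    and "loc_uniform_limit upper_half_plane (\<lambda>n. m_minus (H n)) (m_minus H_lim)"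
  shows "reflectionless_on H_lim (Sigma_ac (H 1)) \<or>
         (\<exists>T' T_lim. (\<forall>n\<ge>1. T' n = T n \<or> T' n = (\<lambda>z. - T n z)) \<and>
                     T_lim \<in> class_S \<and>
                     loc_uniform_limit UNIV (transfer_prod T') T_lim)"
proof -
  interpret transfer_sequence H H_lim T
    by (rule transfer_sequence.intro; fact)
  show ?thesis
  proof (cases "\<exists>z B. Im z > 0 \<and> (\<forall>n. expansion n z \<le> B)")
    case True
    then obtain z B where "Im z > 0" "\<And>n. expansion n z \<le> B" by blast
    then show ?thesis by (rule dichotomy_if_expansion_bounded)
  next
    case False
    have "reflectionless_on H_lim (Sigma_ac (H 1))"
    proof (rule reflectionless_if_expansion_unbounded)
      show "\<not> (\<exists>B. \<forall>n. expansion n z \<le> B)" if "Im z > 0" for z using False that by blast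
    qed
    then show ?thesis ..
  qed
qed

end
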